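(* Let $N_{50}=2430068453031180290203185942420933$. For all $1\leq\lambda<(2\cdot N_{50})^{1/100}\approx 2.17$, there exists a constant $0<\beta<1$ such that, with all but exponentially small probability, a configuration of $n$ particles drawn from the stationary distribution $\pi$ of the Markov chain $\mathcal{M}$ with bias parameter $\lambda$ is $\beta$-expanded; that is, there exist $n^*\ge0$ and $\gamma<1$ such that for all $n>n^*$, $\mathbb{P}(p(\sigma)\le\beta\cdot p_{max})<\gamma^{\sqrt n}$ for $\sigma\sim\pi$.
   Context: Let $\Gamma$ be the triangular lattice. A configuration of $n$ particles is a set of $n$ vertices ("locations") of $\Gamma$, considered up to translation (rotated copies count as distinct). The configuration is connected if the subgraph of $\Gamma$ induced by the occupied locations is connected. A hole is a maximal finite connected set of unoccupied locations. ($N_{50}$ is the number of connected configurations of 50 particles with no holes.) For a connected configuration $\sigma$ with no holes, $p(\sigma)$ is the length of the closed walk around its single external boundary (an edge traversed twice is counted twice). $p_{max}=2n-2$; $\sigma$ is $\beta$-expanded if $p(\sigma)>\beta\cdot p_{max}$. The Markov chain $\mathcal{M}$ (bias $\lambda>0$) has state space $\Omega$, the set of connected configurations of $n$ particles with no holes. For a location $\ell$, $N(\ell)$ is the set of particles at locations adjacent to $\ell$. For adjacent $\ell,\ell'$, let $\mathbb{S}=N(\ell)\cap N(\ell')$ and $N(\ell\cup\ell')=(N(\ell)\cup N(\ell'))$ minus particles located at $\ell$ or $\ell'$. Property 1: $|\mathbb{S}|\in\{1,2\}$ and every particle in $N(\ell\cup\ell')$ is connected to a particle of $\mathbb{S}$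 by a lattice path all of whose vertices are particles of $N(\ell\cup\ell')$. Property 2: $|\mathbb{S}|=0$; each of $\ell,\ell'$ has at least one adjacent particle other than one located at the other location; the particles of $N(\ell)$ not at $\ell'$ are connected by paths within this set; the particles of $N(\ell')$ not at $\ell$ are connected by paths within this set. One step from $\sigma$: choose a particle $P$ uniformly (location $\ell$), a neighbor $\ell'$ of $\ell$ uniformly among six, and $q$ uniform in $(0,1)$. If $\ell'$ is occupied, do nothing. Otherwise let $t$ (resp. $t'$) be the number of triangular faces incident to $\ell$ (resp. $\ell'$) with all three vertices occupied when $P$ is at $\ell$ (resp. at $\ell'$); move $P$ to $\ell'$ if (1) $\ell$ does not have exactly five occupied neighbors, (2) $\ell,\ell'$ satisfy Property 1 or 2, and (3) $q<\lambda^{t'-t}$; else do nothing. $\pi$ is the stationary distribution of $\mathcal{M}$. *)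

theory Defs
  imports Complex_Main
begin

section \<open>The triangular lattice\<close>

text \<open>Vertices of the triangular lattice in axial coordinates: a point (a,b) is
  a * e1 + b * e2 with e1, e2 unit vectors at angle 60 degrees.  The six
  neighbour directions are listed in counter-clockwise cyclic order.\<close>

type_synonym loc = "int \<times> int"

definition padd :: "loc \<Rightarrow> loc \<Rightarrow> loc" where
  "padd x y = (fst x + fst y, snd x + snd y)"

definition dirs :: "loc list" where
  "dirs = [(1,0), (0,1), (-1,1), (-1,0), (0,-1), (1,-1)]"

definition adj :: "loc \<Rightarrow> loc \<Rightarrow> bool" where
  "adj x y \<longleftrightarrow> (\<exists>d\<in>set dirs. y = padd x d)"

text \<open>Edge relation of the subgraph of the lattice induced by a vertex set U.\<close>
definition induced_rel :: "loc set \<Rightarrow> (loc \<times> loc) set" where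
  "induced_rel U = {(x, y). x \<in> U \<and> y \<in> U \<and> adj x y}"

definition lconnected :: "loc set \<Rightarrow> bool" where
  "lconnected U \<longleftrightarrow> (\<forall>x\<in>U. \<forall>y\<in>U. (x, y) \<in> (induced_rel U)\<^sup>*)"

text \<open>Connected component of x inside U.\<close>
definition comp :: "loc set \<Rightarrow> loc \<Rightarrow> loc set" where
  "comp U x = {y. (x, y) \<in> (induced_rel U)\<^sup>*}"

text \<open>A hole is a maximal finite connected set of unoccupied locations, i.e. a finite
  connected component of the complement.\<close>
definition is_hole :: "loc set \<Rightarrow> loc set \<Rightarrow> bool" where
  "is_hole S H \<longleftrightarrow> (\<exists>x. x \<notin> S \<and> H = comp (- S) x \<and> finite H)"

definition no_holes :: "loc set \<Rightarrow> bool" where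
  "no_holes S \<longleftrightarrow> \<not> (\<exists>H. is_hole S H)"

section \<open>Configurations up to translation\<close>

definition shift :: "loc \<Rightarrow> loc set \<Rightarrow> loc set" where
  "shift v S = padd v ` S"

definition cls :: "loc set \<Rightarrow> loc set set" where
  "cls S = range (\<lambda>v. shift v S)"

definition rep :: "loc set set \<Rightarrow> loc set" where
  "rep C = (SOME S. S \<in> C)"

text \<open>State space: connected hole-free configurations of n particles, up to translation.\<close>
definition Omega :: "nat \<Rightarrow> loc set set set" where
  "Omega n = cls ` {S. finite S \<and> card S = n \<and> lconnected S \<and> no_holes S}"

section \<open>Perimeter\<close>

text \<open>Length of the closed walk around the external boundary (edges traversed twice
  counted twice) = number of directed lattice edges (u,v) between particles whose
  left-hand face is the external face.  The face to the left of the dart (u,v) is the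
  unit triangle with third vertex u + rot60(v - u); for a connected hole-free
  configuration it is a bounded face iff that third vertex is occupied.  The dart
  in direction dirs!i has left vertex in direction dirs!(i+1 mod 6).\<close>
definition perim_set :: "loc set \<Rightarrow> nat" where
  "perim_set S = card {(u, i). u \<in> S \<and> i < (6::nat) \<and> padd u (dirs ! i) \<in> S
                       \<and> padd u (dirs ! ((i + 1) mod 6)) \<notin> S}"

definition perim :: "loc set set \<Rightarrow> nat" where
  "perim C = perim_set (rep C)"

section \<open>The Markov chain M\<close>

definition Nb :: "loc set \<Rightarrow> loc \<Rightarrow> loc set" where
  "Nb S l = {x \<in> S. adj l x}"

text \<open>Number of triangular faces incident to l with all three vertices occupied
  (l itself is taken as occupied).\<close>
definition tri :: "loc set \<Rightarrow> loc \<Rightarrow> nat" where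
  "tri S l = card {i. i < (6::nat) \<and> padd l (dirs ! i) \<in> S
                     \<and> padd l (dirs ! ((i + 1) mod 6)) \<in> S}"

definition prop1 :: "loc set \<Rightarrow> loc \<Rightarrow> loc \<Rightarrow> bool" where
  "prop1 S l l' \<longleftrightarrow>
     (let SS = Nb S l \<inter> Nb S l'; NU = (Nb S l \<union> Nb S l') - {l, l'} in
      card SS \<in> {1, 2} \<and> (\<forall>x\<in>NU. \<exists>s\<in>SS. (x, s) \<in> (induced_rel NU)\<^sup>*))"

definition prop2 :: "loc set \<Rightarrow> loc \<Rightarrow> loc \<Rightarrow> bool" where
  "prop2 S l l' \<longleftrightarrow>
     card (Nb S l \<inter> Nb S l') = 0 \<and>
     Nb S l - {l'} \<noteq> {} \<and> Nb S l' - {l} \<noteq> {} \<and>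
     lconnected (Nb S l - {l'}) \<and> lconnected (Nb S l' - {l})"

text \<open>Configuration after moving the particle at l to l'.\<close>
definition move :: "loc set \<Rightarrow> loc \<Rightarrow> loc \<Rightarrow> loc set" where
  "move S l l' = insert l' (S - {l})"

text \<open>Probability (over q uniform in (0,1)) that the particle at l, having chosen the
  neighbouring location l', actually moves: P(q < lambda^(t'-t)).\<close>
definition acc :: "real \<Rightarrow> loc set \<Rightarrow> loc \<Rightarrow> loc \<Rightarrow> real" where
  "acc lam S l l' =
     (if l' \<notin> S \<and> card (Nb S l) \<noteq> 5 \<and> (prop1 S l l' \<or> prop2 S l l')
      then min 1 (lam powr (real (tri (move S l l') l') - real (tri S l)))
      else 0)"

text \<open>One-step transition probability between translation classes.\<close>
definition trans_prob :: "real \<Rightarrow> loc set set \<Rightarrow> loc set set \<Rightarrow> real" where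
  "trans_prob lam C C' =
     (let S = rep C in
      \<Sum>l\<in>S. \<Sum>i<(6::nat).
        (1 / (6 * real (card S))) *
        (acc lam S l (padd l (dirs ! i)) *
           (if cls (move S l (padd l (dirs ! i))) = C' then 1 else 0)
         + (1 - acc lam S l (padd l (dirs ! i))) * (if C' = C then 1 else 0)))"

definition stationary :: "real \<Rightarrow> nat \<Rightarrow> (loc set set \<Rightarrow> real) \<Rightarrow> bool" where
  "stationary lam n \<pi> \<longleftrightarrow>
     (\<forall>C\<in>Omega n. 0 \<le> \<pi> C) \<and> (\<Sum>C\<in>Omega n. \<pi> C) = 1 \<and>
     (\<forall>C'\<in>Omega n. (\<Sum>C\<in>Omega n. \<pi> C * trans_prob lam C C') = \<pi> C')"

end

theory Submission
  imports Defs "HOL-Library.Product_Plus"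
begin

text \<open>The chain is reversible with respect to the weights lam ^ t, where t is the number of occupied
  triangles, and it is irreducible, so that every stationary distribution is proportional to
  these weights.

  Irreducibility: every configuration can be squeezed into a single column. In the rightmost
  column, a particle both of whose common neighbours with an empty site on its left are occupied
  can fold into that site, unless this would close a hole because the site has an isolated
  occupied neighbour straight ahead; such an obstacle can first be removed. If no particle can
  fold, the topmost particle of the column slides upwards along the next column until it can be
  tucked in there.

  Since p = 2n - 2 - t, configurations with many triangles are those of small perimeter, but this
  formula is not needed: t \<le> 2n holds trivially, and an estimate for site percolation with open
  probability close to 1 bounds the number of configurations of perimeter at most \<beta> (2n - 2) by
  an exponential in n with base as close to 1 as desired when \<beta> is small. On the other hand, a transfer
  matrix for column-convex configurations with columns of height at most 3 shows that the
  partition function is at least of order (1.03 lam^2)^n for lam \<le> 50/23; here 50/23 exceeds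
  the bound (2 N_50)^(1/100), and the number N_50 plays no other role.\<close>

section \<open>Lattice geometry\<close>

text \<open>The proof compares exponential rates. A compressed configuration has weight at most
  lam^(2n), so the partition function has to exceed lam^(2n) by a larger exponential factor than the
  number of such configurations: 1.03^n against 1.0201^n, which is one factor 1.01^n for the
  particles and one for the boundary sites. Columns of height 1 alone contribute only about 2^n, far
  below lam^(2n) near lam = 50/23. Triangles have to be traded against the h + k ways of placing a
  column of height k beside one of height h. With heights 1 and 2 the rate at lam = 50/23 is still
  below lam^2; height 3 is the first that suffices. The resulting bound decays exponentially in n,
  hence faster than in sqrt n.

  On the side of the chain, states are translation classes, and several moves may realise the same
  transition; balance is therefore proved by a bijection between moves. The squeezing moves are
  constructed in one direction only, since balance makes the reversed transitions positive as
  well.\<close>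

lemma padd_eq [simp]: "padd x y = x + y"
  by (simp add: padd_def plus_prod_def)

text \<open>Rotation by 60 degrees. Since \<open>rot (rot d) = rot d - d\<close>, every site near an
  edge is an integer combination of d and \<open>rot d\<close>, so one argument serves all six
  directions.\<close>

definition rot :: "loc \<Rightarrow> loc" where
  "rot v = (- snd v, fst v + snd v)"

lemma adj_iff: "adj x y \<longleftrightarrow> y - x \<in> set dirs"
  by (auto simp: adj_def intro!: bexI[of _ "y - x"])

lemma dirs_cases:
  assumes "d \<in> set dirs"
  obtains "d = (1,0)" | "d = (0,1)" | "d = (-1,1)" | "d = (-1,0)" | "d = (0,-1)" | "d = (1,-1)"
proof -
  have "d = (1,0) \<or> d = (0,1) \<or> d = (-1,1) \<or> d = (-1,0) \<or> d = (0,-1) \<or> d = (1,-1)"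
    using assms by (simp add: dirs_def)
  then show ?thesis using that by (elim disjE)
qed

lemma dirs_minus:
  assumes "d \<in> set dirs"
  shows "- d \<in> set dirs"
  using assms by (cases rule: dirs_cases) (auto simp: dirs_def)

lemma dirs_eq:
  assumes "d \<in> set dirs"
  shows "set dirs = {d, rot d, rot d - d, - d, - rot d, d - rot d}"
  using assms by (cases rule: dirs_cases) (simp_all add: dirs_def rot_def insert_commute)

lemma adj_sym: "adj x y \<longleftrightarrow> adj y x"
  using dirs_minus[of "y - x"] dirs_minus[of "x - y"] by (auto simp: adj_iff)

lemma adj_irrefl [simp]: "\<not> adj x x"
  by (simp add: adj_iff dirs_def zero_prod_def)

lemma adj_nbrs:
  assumes "d \<in> set dirs"
  shows "adj l x \<longleftrightarrow> x \<in> {l + d, l + rot d, l + rot d - d, l - d, l - rot d, l + d - rot d}"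
  unfolding adj_iff dirs_eq[OF assms] by (auto simp: algebra_simps)

lemma conn_edge: "x \<in> U \<Longrightarrow> y \<in> U \<Longrightarrow> adj x y \<Longrightarrow> (x, y) \<in> (induced_rel U)\<^sup>*"
  by (auto simp: induced_rel_def)

lemma conn_sym: "(x, y) \<in> (induced_rel U)\<^sup>* \<Longrightarrow> (y, x) \<in> (induced_rel U)\<^sup>*"
proof -
  have "sym (induced_rel U)"
    by (auto simp: sym_def induced_rel_def adj_sym)
  then show "(x, y) \<in> (induced_rel U)\<^sup>* \<Longrightarrow> (y, x) \<in> (induced_rel U)\<^sup>*"
    by (meson sym_rtrancl symD)
qed

lemma conn_mono: "(x, y) \<in> (induced_rel U)\<^sup>* \<Longrightarrow> U \<subseteq> V \<Longrightarrow> (x, y) \<in> (induced_rel V)\<^sup>*"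
proof -
  assume "U \<subseteq> V"
  then have "induced_rel U \<subseteq> induced_rel V"
    by (auto simp: induced_rel_def)
  then show "(x, y) \<in> (induced_rel U)\<^sup>* \<Longrightarrow> (x, y) \<in> (induced_rel V)\<^sup>*"
    using rtrancl_mono by blast
qed

text \<open>Paths are transported edge by edge. Applied to a map that displaces a single site, this
  turns connectivity before a move into connectivity after it.\<close>

lemma conn_map:
  assumes "(x, y) \<in> (induced_rel U)\<^sup>*"
    and "\<And>u v. u \<in> U \<Longrightarrow> v \<in> U \<Longrightarrow> adj u v \<Longrightarrow> (f u, f v) \<in> (induced_rel V)\<^sup>*"
  shows "(f x, f y) \<in> (induced_rel V)\<^sup>*"
  using assms(1)
proof (induction rule: rtrancl_induct)
  case (step y z)
  then have "(f y, f z) \<in> (induced_rel V)\<^sup>*"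
    using assms(2) by (auto simp: induced_rel_def)
  with step.IH show ?case by (rule rtrancl_trans)
qed auto

text \<open>Induction over a connected set in the form of an invariant R. It is also used for
  contradictions, where R is the part of S on one side of a gap.\<close>

lemma lconnected_closed:
  assumes "lconnected S" "x \<in> S" "x \<in> R"
    and "\<And>u v. u \<in> R \<Longrightarrow> v \<in> S \<Longrightarrow> adj u v \<Longrightarrow> v \<in> R"
  shows "S \<subseteq> R"
proof
  fix y assume "y \<in> S"
  then have "(x, y) \<in> (induced_rel S)\<^sup>*"
    using assms by (auto simp: lconnected_def)
  then show "y \<in> R"
    by (induction rule: rtrancl_induct) (use assms in \<open>auto simp: induced_rel_def\<close>)
qed

lemma lconnected_nbr:
  assumes "lconnected S" "finite S" "card S \<ge> 2" "x \<in> S"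
  obtains y where "y \<in> S" "adj x y"
proof -
  have "\<not> S \<subseteq> {x}"
    using assms(2,3) by (metis card.empty card.insert card_mono finite.emptyI finite.insertI
        empty_iff not_less_eq_eq numeral_2_eq_2 One_nat_def)
  then obtain z where "z \<in> S" "z \<notin> {x}" by auto
  then show ?thesis
    using lconnected_closed[of S x "{x}"] assms that by blast
qed

definition conf :: "loc set \<Rightarrow> bool" where
  "conf S \<longleftrightarrow> finite S \<and> lconnected S \<and> no_holes S"

lemma Omega_conf: "Omega n = cls ` {S. conf S \<and> card S = n}"
  by (auto simp: Omega_def conf_def)

lemma no_holes_iff: "no_holes S \<longleftrightarrow> (\<forall>x. x \<notin> S \<longrightarrow> infinite (comp (- S) x))"
  by (auto simp: no_holes_def is_hole_def)

section \<open>Local patterns of valid moves\<close>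

text \<open>The eight sites around the edge from l to l + d form a cycle
  s1, a, b, c, s2, c', b', a' where s1 and s2 are the common neighbours, a, b, c are the other
  neighbours of l + d and a', b', c' those of l.\<close>

definition vpat :: "loc set \<Rightarrow> loc \<Rightarrow> loc \<Rightarrow> bool" where
  "vpat S l d \<longleftrightarrow>
    (let s1 = l + rot d \<in> S; s2 = l + d - rot d \<in> S;
         a = l + d + rot d \<in> S; b = l + d + d \<in> S; c = l + d + d - rot d \<in> S;
         a' = l + rot d - d \<in> S; b' = l - d \<in> S; c' = l - rot d \<in> S
     in ((s1 \<or> s2) \<and> \<not> (s1 \<and> s2 \<and> a' \<and> b' \<and> c') \<and>
         (a \<longrightarrow> s1 \<or> b \<and> c \<and> s2) \<and> (b \<longrightarrow> a \<and> s1 \<or> c \<and> s2) \<and> (c \<longrightarrow> s2 \<or> b \<and> a \<and> s1) \<and>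
         (a' \<longrightarrow> s1 \<or> b' \<and> c' \<and> s2) \<and> (b' \<longrightarrow> a' \<and> s1 \<or> c' \<and> s2) \<and> (c' \<longrightarrow> s2 \<or> b' \<and> a' \<and> s1))
      \<or> (\<not> s1 \<and> \<not> s2 \<and> (a \<or> b \<or> c) \<and> (a \<and> c \<longrightarrow> b) \<and> (a' \<or> b' \<or> c') \<and> (a' \<and> c' \<longrightarrow> b')))"

definition vmove :: "loc set \<Rightarrow> loc set \<Rightarrow> bool" where
  "vmove S S' \<longleftrightarrow> (\<exists>l d. l \<in> S \<and> d \<in> set dirs \<and> l + d \<notin> S \<and> vpat S l d \<and> S' = move S l (l + d))"

lemma edge_vectors:
  assumes d: "d \<in> set dirs"
  shows "v \<in> set dirs \<and> v \<noteq> d \<longleftrightarrow> v \<in> {rot d, d - rot d, rot d - d, - d, - rot d}"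
    and "v - d \<in> set dirs \<and> v \<noteq> 0 \<longleftrightarrow> v \<in> {rot d, d - rot d, d + rot d, d + d, d + d - rot d}"
    and "v \<in> set dirs \<and> v - d \<in> set dirs \<longleftrightarrow> v \<in> {rot d, d - rot d}"
proof -
  have "d \<notin> {rot d, d - rot d, rot d - d, - d, - rot d}"
    using d by (cases rule: dirs_cases) (simp_all add: rot_def)
  then show "v \<in> set dirs \<and> v \<noteq> d \<longleftrightarrow> v \<in> {rot d, d - rot d, rot d - d, - d, - rot d}"
    unfolding dirs_eq[OF d] by blast
  have "0 \<notin> {rot d, d - rot d, d + rot d, d + d, d + d - rot d}"
    using d by (cases rule: dirs_cases) (simp_all add: rot_def zero_prod_def)
  moreover have "v - d \<in> set dirs \<longleftrightarrow> v \<in> {0, rot d, d - rot d, d + rot d, d + d, d + d - rot d}"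
    unfolding dirs_eq[OF d] by (auto simp: algebra_simps)
  ultimately show "v - d \<in> set dirs \<and> v \<noteq> 0 \<longleftrightarrow>
      v \<in> {rot d, d - rot d, d + rot d, d + d, d + d - rot d}"
    by blast
  show "v \<in> set dirs \<and> v - d \<in> set dirs \<longleftrightarrow> v \<in> {rot d, d - rot d}"
  proof
    assume v: "v \<in> set dirs \<and> v - d \<in> set dirs"
    then have "v \<in> {d, rot d, rot d - d, - d, - rot d, d - rot d}"
      using dirs_eq[OF d] by simp
    moreover have "d - d \<notin> set dirs" "rot d - d - d \<notin> set dirs" "- d - d \<notin> set dirs"
      "- rot d - d \<notin> set dirs"
      using d by (cases rule: dirs_cases; simp add: rot_def dirs_def zero_prod_def)+
    ultimately show "v \<in> {rot d, d - rot d}" using v by blast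
  next
    assume "v \<in> {rot d, d - rot d}"
    then show "v \<in> set dirs \<and> v - d \<in> set dirs"
      using d by (auto simp: dirs_eq[OF d] algebra_simps)
  qed
qed

lemma Nb_edge:
  assumes "d \<in> set dirs"
  shows "Nb S l - {l + d} =
           S \<inter> {l + rot d, l + d - rot d, l + rot d - d, l - d, l - rot d}"
    and "Nb S (l + d) - {l} =
           S \<inter> {l + rot d, l + d - rot d, l + d + rot d, l + d + d, l + d + d - rot d}"
    and "Nb S l \<inter> Nb S (l + d) = S \<inter> {l + rot d, l + d - rot d}"
    and "(Nb S l \<union> Nb S (l + d)) - {l, l + d} =
           S \<inter> {l + rot d, l + d - rot d, l + d + rot d, l + d + d, l + d + d - rot d,
             l + rot d - d, l - d, l - rot d}"
proof -
  have 1: "adj l x \<and> x \<noteq> l + d \<longleftrightarrow> x \<in> {l + rot d, l + d - rot d, l + rot d - d, l - d, l - rot d}"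
    for x
    using edge_vectors(1)[OF assms, of "x - l"] by (auto simp: adj_iff algebra_simps)
  have 2: "adj (l + d) x \<and> x \<noteq> l \<longleftrightarrow>
      x \<in> {l + rot d, l + d - rot d, l + d + rot d, l + d + d, l + d + d - rot d}" for x
    using edge_vectors(2)[OF assms, of "x - l"] by (auto simp: adj_iff algebra_simps)
  have 3: "adj l x \<and> adj (l + d) x \<longleftrightarrow> x \<in> {l + rot d, l + d - rot d}" for x
    using edge_vectors(3)[OF assms, of "x - l"] by (auto simp: adj_iff algebra_simps)
  show A: "Nb S l - {l + d} = S \<inter> {l + rot d, l + d - rot d, l + rot d - d, l - d, l - rot d}"
    using 1 by (auto simp: Nb_def)
  show B: "Nb S (l + d) - {l} =
      S \<inter> {l + rot d, l + d - rot d, l + d + rot d, l + d + d, l + d + d - rot d}"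
    using 2 by (auto simp: Nb_def)
  show "Nb S l \<inter> Nb S (l + d) = S \<inter> {l + rot d, l + d - rot d}"
    using 3 by (auto simp: Nb_def)
  have "l \<notin> Nb S l" "l + d \<notin> Nb S (l + d)" by (auto simp: Nb_def)
  then have "(Nb S l \<union> Nb S (l + d)) - {l, l + d} = (Nb S l - {l + d}) \<union> (Nb S (l + d) - {l})"
    by auto
  also have "\<dots> = S \<inter> {l + rot d, l + d - rot d, l + d + rot d, l + d + d, l + d + d - rot d,
             l + rot d - d, l - d, l - rot d}"
    unfolding A B by auto
  finally show "(Nb S l \<union> Nb S (l + d)) - {l, l + d} =
      S \<inter> {l + rot d, l + d - rot d, l + d + rot d, l + d + d, l + d + d - rot d,
        l + rot d - d, l - d, l - rot d}" .
qed

lemma ring_adj: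
  assumes "d \<in> set dirs"
  shows "adj (l + rot d) (l + d + rot d)" "adj (l + d + rot d) (l + d + d)"
    "adj (l + d + d) (l + d + d - rot d)" "adj (l + d + d - rot d) (l + d - rot d)"
    "adj (l + d - rot d) (l - rot d)" "adj (l - rot d) (l - d)"
    "adj (l - d) (l + rot d - d)" "adj (l + rot d - d) (l + rot d)"
    "adj l (l + rot d)" "adj l (l + d - rot d)" "adj l (l + rot d - d)" "adj l (l - d)"
    "adj l (l - rot d)" "adj l (l + d)"
    "adj (l + d) (l + rot d)" "adj (l + d) (l + d - rot d)" "adj (l + d) (l + d + rot d)"
    "adj (l + d) (l + d + d)" "adj (l + d) (l + d + d - rot d)"
  using assms
  by (cases rule: dirs_cases; simp add: adj_iff algebra_simps; simp add: dirs_def rot_def)+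

lemma conn_edge2:
  "x \<in> U \<Longrightarrow> y \<in> U \<Longrightarrow> z \<in> U \<Longrightarrow> adj x y \<Longrightarrow> adj y z \<Longrightarrow> (x, z) \<in> (induced_rel U)\<^sup>*"
  by (meson conn_edge rtrancl_trans)

lemma conn_edge3:
  "x \<in> U \<Longrightarrow> y \<in> U \<Longrightarrow> z \<in> U \<Longrightarrow> w \<in> U \<Longrightarrow> adj x y \<Longrightarrow> adj y z \<Longrightarrow> adj z w
    \<Longrightarrow> (x, w) \<in> (induced_rel U)\<^sup>*"
  by (meson conn_edge conn_edge2 rtrancl_trans)

text \<open>The sites s1 and s2 cut the ring into two arcs of three sites. In the first disjunct of
  \<open>vpat\<close> every occupied site of an arc is joined along this arc to an occupied s1 or
  s2, which is Property 1. In the second, the occupied sites of each arc are contiguous and exist,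
  which is Property 2.\<close>

lemma vpat_prop:
  assumes d: "d \<in> set dirs" and "l + d \<notin> S" and v: "vpat S l d"
  shows "prop1 S l (l + d) \<or> prop2 S l (l + d)"
proof -
  note A = ring_adj[OF d, of l]
  note A' = A[THEN adj_sym[THEN iffD1]]
  let ?NU = "S \<inter> {l + rot d, l + d - rot d, l + d + rot d, l + d + d, l + d + d - rot d,
             l + rot d - d, l - d, l - rot d}"
  show ?thesis
  proof (cases "l + rot d \<in> S \<or> l + d - rot d \<in> S")
    case True
    have "card (S \<inter> {l + rot d, l + d - rot d}) \<le> card {l + rot d, l + d - rot d}"
      by (rule card_mono) auto
    also have "\<dots> \<le> 2" by (simp add: card_insert_le_m1)
    finally have "card (S \<inter> {l + rot d, l + d - rot d}) \<in> {1, 2}"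
      using True by (auto simp: le_Suc_eq numeral_2_eq_2)
    moreover have impl:
      "l + d + rot d \<in> S \<Longrightarrow> l + rot d \<in> S \<or> l + d + d \<in> S \<and> l + d + d - rot d \<in> S \<and> l + d - rot d \<in> S"
      "l + d + d \<in> S \<Longrightarrow> l + d + rot d \<in> S \<and> l + rot d \<in> S \<or> l + d + d - rot d \<in> S \<and> l + d - rot d \<in> S"
      "l + d + d - rot d \<in> S \<Longrightarrow> l + d - rot d \<in> S \<or> l + d + d \<in> S \<and> l + d + rot d \<in> S \<and> l + rot d \<in> S"
      "l + rot d - d \<in> S \<Longrightarrow> l + rot d \<in> S \<or> l - d \<in> S \<and> l - rot d \<in> S \<and> l + d - rot d \<in> S"
      "l - d \<in> S \<Longrightarrow> l + rot d - d \<in> S \<and> l + rot d \<in> S \<or> l - rot d \<in> S \<and> l + d - rot d \<in> S"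
      "l - rot d \<in> S \<Longrightarrow> l + d - rot d \<in> S \<or> l - d \<in> S \<and> l + rot d - d \<in> S \<and> l + rot d \<in> S"
      using v True unfolding vpat_def Let_def by blast+
    moreover have "\<forall>x\<in>?NU. \<exists>s\<in>S \<inter> {l + rot d, l + d - rot d}. (x, s) \<in> (induced_rel ?NU)\<^sup>*"
    proof
      fix x assume x: "x \<in> ?NU"
      have e: "x \<in> ?NU \<Longrightarrow> y \<in> ?NU \<Longrightarrow> adj x y \<Longrightarrow> (x, y) \<in> (induced_rel ?NU)\<^sup>*" for x y
        by (rule conn_edge)
      have e2: "x \<in> ?NU \<Longrightarrow> y \<in> ?NU \<Longrightarrow> z \<in> ?NU \<Longrightarrow> adj x y \<Longrightarrow> adj y z \<Longrightarrow>
         (x, z) \<in> (induced_rel ?NU)\<^sup>*" for x y z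
        by (rule conn_edge2)
      have e3: "x \<in> ?NU \<Longrightarrow> y \<in> ?NU \<Longrightarrow> z \<in> ?NU \<Longrightarrow> w \<in> ?NU \<Longrightarrow> adj x y \<Longrightarrow> adj y z \<Longrightarrow> adj z w \<Longrightarrow>
         (x, w) \<in> (induced_rel ?NU)\<^sup>*" for x y z w
        by (rule conn_edge3)
      have r: "(x, x) \<in> (induced_rel ?NU)\<^sup>*" by simp
      from x have xS: "x \<in> S" by simp
      from x consider "x = l + rot d" | "x = l + d - rot d" | "x = l + d + rot d" | "x = l + d + d"
        | "x = l + d + d - rot d" | "x = l + rot d - d" | "x = l - d" | "x = l - rot d" by blast
      then show "\<exists>s\<in>S \<inter> {l + rot d, l + d - rot d}. (x, s) \<in> (induced_rel ?NU)\<^sup>*"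
      proof cases
        case 1 then show ?thesis using r x by blast
      next
        case 2 then show ?thesis using r x by blast
      next
        case 3
        show ?thesis
        proof (cases "l + rot d \<in> S")
          case True
          then have "(x, l + rot d) \<in> (induced_rel ?NU)\<^sup>*" using x True unfolding 3 by (intro e A') auto
          then show ?thesis using True by blast
        next
          case False
          then have f: "l + d + d \<in> S" "l + d + d - rot d \<in> S" "l + d - rot d \<in> S"
            using impl False xS unfolding 3 by blast+
          then have "(x, l + d - rot d) \<in> (induced_rel ?NU)\<^sup>*"
            using x f unfolding 3 by (intro e3[of _ "l + d + d" "l + d + d - rot d"] A) auto
          then show ?thesis using f by blast
        qed
      next
        case 4
        then have "l + d + rot d \<in> S \<and> l + rot d \<in> S \<or> l + d + d - rot d \<in> S \<and> l + d - rot d \<in> S"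
          using v True x by (auto simp: vpat_def Let_def)
        then show ?thesis
        proof
          assume f: "l + d + rot d \<in> S \<and> l + rot d \<in> S"
          then have "(x, l + rot d) \<in> (induced_rel ?NU)\<^sup>*"
            using x f unfolding 4 by (intro e2[of _ "l + d + rot d"] A') auto
          then show ?thesis using f by blast
        next
          assume f: "l + d + d - rot d \<in> S \<and> l + d - rot d \<in> S"
          then have "(x, l + d - rot d) \<in> (induced_rel ?NU)\<^sup>*"
            using x f unfolding 4 by (intro e2[of _ "l + d + d - rot d"] A) auto
          then show ?thesis using f by blast
        qed
      next
        case 5
        show ?thesis
        proof (cases "l + d - rot d \<in> S")
          case True
          then have "(x, l + d - rot d) \<in> (induced_rel ?NU)\<^sup>*" using x True unfolding 5 by (intro e A) auto
          then show ?thesis using True by blast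
        next
          case False
          then have f: "l + d + d \<in> S" "l + d + rot d \<in> S" "l + rot d \<in> S"
            using impl False xS unfolding 5 by blast+
          then have "(x, l + rot d) \<in> (induced_rel ?NU)\<^sup>*"
            using x f unfolding 5 by (intro e3[of _ "l + d + d" "l + d + rot d"] A') auto
          then show ?thesis using f by blast
        qed
      next
        case 6
        show ?thesis
        proof (cases "l + rot d \<in> S")
          case True
          then have "(x, l + rot d) \<in> (induced_rel ?NU)\<^sup>*" using x True unfolding 6 by (intro e A) auto
          then show ?thesis using True by blast
        next
          case False
          then have f: "l - d \<in> S" "l - rot d \<in> S" "l + d - rot d \<in> S"
            using impl False xS unfolding 6 by blast+
          then have "(x, l + d - rot d) \<in> (induced_rel ?NU)\<^sup>*"
            using x f unfolding 6 by (intro e3[of _ "l - d" "l - rot d"] A') auto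
          then show ?thesis using f by blast
        qed
      next
        case 7
        then have "l + rot d - d \<in> S \<and> l + rot d \<in> S \<or> l - rot d \<in> S \<and> l + d - rot d \<in> S"
          using v True x by (auto simp: vpat_def Let_def)
        then show ?thesis
        proof
          assume f: "l + rot d - d \<in> S \<and> l + rot d \<in> S"
          then have "(x, l + rot d) \<in> (induced_rel ?NU)\<^sup>*"
            using x f unfolding 7 by (intro e2[of _ "l + rot d - d"] A) auto
          then show ?thesis using f by blast
        next
          assume f: "l - rot d \<in> S \<and> l + d - rot d \<in> S"
          then have "(x, l + d - rot d) \<in> (induced_rel ?NU)\<^sup>*"
            using x f unfolding 7 by (intro e2[of _ "l - rot d"] A') auto
          then show ?thesis using f by blast
        qed
      next
        case 8
        show ?thesis
        proof (cases "l + d - rot d \<in> S")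
          case True
          then have "(x, l + d - rot d) \<in> (induced_rel ?NU)\<^sup>*" using x True unfolding 8 by (intro e A') auto
          then show ?thesis using True by blast
        next
          case False
          then have f: "l - d \<in> S" "l + rot d - d \<in> S" "l + rot d \<in> S"
            using impl False xS unfolding 8 by blast+
          then have "(x, l + rot d) \<in> (induced_rel ?NU)\<^sup>*"
            using x f unfolding 8 by (intro e3[of _ "l - d" "l + rot d - d"] A) auto
          then show ?thesis using f by blast
        qed
      qed
    qed
    ultimately have "prop1 S l (l + d)"
      unfolding prop1_def Let_def Nb_edge[OF d] by blast
    then show ?thesis ..
  next
    case False
    have v2: "l + d + rot d \<in> S \<or> l + d + d \<in> S \<or> l + d + d - rot d \<in> S"
      "l + d + rot d \<in> S \<and> l + d + d - rot d \<in> S \<longrightarrow> l + d + d \<in> S"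
      "l + rot d - d \<in> S \<or> l - d \<in> S \<or> l - rot d \<in> S"
      "l + rot d - d \<in> S \<and> l - rot d \<in> S \<longrightarrow> l - d \<in> S"
      using v False unfolding vpat_def Let_def by blast+
    have *: "lconnected (S \<inter> {p, q, x, y, z})"
      if "p \<notin> S" "q \<notin> S" "adj x y" "adj y z" "x \<in> S \<and> z \<in> S \<longrightarrow> y \<in> S" for p q x y z
    proof -
      have eq: "S \<inter> {p, q, x, y, z} = S \<inter> {x, y, z}" using that by auto
      have adj: "adj y x" "adj z y" using that adj_sym by auto
      show ?thesis
        unfolding eq lconnected_def using that adj
        by (auto intro: conn_edge conn_edge2[where y = y])
    qed
    have "lconnected (S \<inter> {l + rot d, l + d - rot d, l + rot d - d, l - d, l - rot d})"
      by (rule *[OF _ _ A'(7) A'(6)]) (use False v2 in blast)+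
    moreover have "lconnected (S \<inter> {l + rot d, l + d - rot d, l + d + rot d, l + d + d, l + d + d - rot d})"
      by (rule *[OF _ _ A(2) A(3)]) (use False v2 in blast)+
    moreover have "S \<inter> {l + rot d, l + d - rot d} = {}"
      using False by blast
    moreover have "S \<inter> {l + rot d, l + d - rot d, l + rot d - d, l - d, l - rot d} \<noteq> {}"
      "S \<inter> {l + rot d, l + d - rot d, l + d + rot d, l + d + d, l + d + d - rot d} \<noteq> {}"
      using v2 by blast+
    ultimately have "prop2 S l (l + d)"
      unfolding prop2_def Nb_edge[OF d] by (metis card.empty)
    then show ?thesis ..
  qed
qed

text \<open>As l + d is empty, five occupied neighbours would have to be all the other ones, and
  both disjuncts of \<open>vpat\<close> exclude this.\<close>

lemma vpat_card:
  assumes d: "d \<in> set dirs" and "l + d \<notin> S" and v: "vpat S l d"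
  shows "card (Nb S l) \<noteq> 5"
proof -
  let ?T = "{l + rot d, l + d - rot d, l + rot d - d, l - d, l - rot d}"
  have "Nb S l = S \<inter> ?T"
    using Nb_edge(1)[OF d, of S l] assms(2) by (auto simp: Nb_def)
  moreover have "\<not> ?T \<subseteq> S"
    using v unfolding vpat_def Let_def by blast
  ultimately have "Nb S l \<subset> ?T" by auto
  then have "card (Nb S l) < card ?T" by (intro psubset_card_mono) auto
  also have "card ?T \<le> 5"
    by (auto simp: card_insert_if)
  finally show ?thesis by simp
qed

section \<open>Valid moves keep configurations connected and free of holes\<close>

lemma lconnected_transfer:
  assumes "lconnected S"
    and f: "\<And>u v. u \<in> S \<Longrightarrow> v \<in> S \<Longrightarrow> adj u v \<Longrightarrow> (f u, f v) \<in> (induced_rel T)\<^sup>*"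
    and "\<And>x. x \<in> T \<Longrightarrow> \<exists>y\<in>S. (x, f y) \<in> (induced_rel T)\<^sup>*"
  shows "lconnected T"
  unfolding lconnected_def
proof (intro ballI)
  fix x y assume "x \<in> T" "y \<in> T"
  then obtain x0 y0 where "x0 \<in> S" "(x, f x0) \<in> (induced_rel T)\<^sup>*"
    "y0 \<in> S" "(y, f y0) \<in> (induced_rel T)\<^sup>*"
    using assms(3) by blast
  moreover from this have "(f x0, f y0) \<in> (induced_rel T)\<^sup>*"
    using assms(1) by (intro conn_map[of x0 y0 S f T] f) (auto simp: lconnected_def)
  ultimately show "(x, y) \<in> (induced_rel T)\<^sup>*"
    by (meson conn_sym rtrancl_trans)
qed

text \<open>The sites around the edge are named without coordinates, so that the case analysis on
  \<open>pat\<close>, a copy of \<open>vpat\<close>, becomes propositional.\<close>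

locale edge_ring =
  fixes S :: "loc set" and l l' s1 s2 a b c a' b' c' :: loc
  assumes nbr: "\<And>y. adj l y \<longleftrightarrow> y \<in> {l', s1, s2, a', b', c'}"
    and nbr': "\<And>y. adj l' y \<longleftrightarrow> y \<in> {l, s1, s2, a, b, c}"
    and cyc: "adj s1 a" "adj a b" "adj b c" "adj c s2" "adj s2 c'" "adj c' b'" "adj b' a'" "adj a' s1"
    and dist: "l \<notin> {a, b, c}" "l' \<notin> {a', b', c'}"
    and l: "l \<in> S" "l' \<notin> S"
    and pat: "((s1 \<in> S \<or> s2 \<in> S) \<and> \<not> (s1 \<in> S \<and> s2 \<in> S \<and> a' \<in> S \<and> b' \<in> S \<and> c' \<in> S) \<and>
         (a \<in> S \<longrightarrow> s1 \<in> S \<or> b \<in> S \<and> c \<in> S \<and> s2 \<in> S) \<and>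
         (b \<in> S \<longrightarrow> a \<in> S \<and> s1 \<in> S \<or> c \<in> S \<and> s2 \<in> S) \<and>
         (c \<in> S \<longrightarrow> s2 \<in> S \<or> b \<in> S \<and> a \<in> S \<and> s1 \<in> S) \<and>
         (a' \<in> S \<longrightarrow> s1 \<in> S \<or> b' \<in> S \<and> c' \<in> S \<and> s2 \<in> S) \<and>
         (b' \<in> S \<longrightarrow> a' \<in> S \<and> s1 \<in> S \<or> c' \<in> S \<and> s2 \<in> S) \<and>
         (c' \<in> S \<longrightarrow> s2 \<in> S \<or> b' \<in> S \<and> a' \<in> S \<and> s1 \<in> S))
      \<or> (s1 \<notin> S \<and> s2 \<notin> S \<and> (a \<in> S \<or> b \<in> S \<or> c \<in> S) \<and> (a \<in> S \<and> c \<in> S \<longrightarrow> b \<in> S) \<and>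
         (a' \<in> S \<or> b' \<in> S \<or> c' \<in> S) \<and> (a' \<in> S \<and> c' \<in> S \<longrightarrow> b' \<in> S))"
begin

abbreviation "T \<equiv> insert l' (S - {l})"

lemma adj_l: "adj l s1" "adj l s2" "adj l a'" "adj l b'" "adj l c'" "adj l l'"
  "adj l' s1" "adj l' s2" "adj l' a" "adj l' b" "adj l' c"
  by (simp_all add: nbr nbr')

lemma ne: "s1 \<noteq> l" "s2 \<noteq> l" "a' \<noteq> l" "b' \<noteq> l" "c' \<noteq> l" "s1 \<noteq> l'" "s2 \<noteq> l'" "a \<noteq> l'" "b \<noteq> l'" "c \<noteq> l'"
  "a \<noteq> l" "b \<noteq> l" "c \<noteq> l" "a' \<noteq> l'" "b' \<noteq> l'" "c' \<noteq> l'" "l \<noteq> l'"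
  using adj_l dist by auto

lemma cyc': "adj a s1" "adj b a" "adj c b" "adj s2 c" "adj c' s2" "adj b' c'" "adj a' b'" "adj s1 a'"
  using cyc by (simp_all add: adj_sym)

lemma inT: "x \<in> S \<Longrightarrow> x \<noteq> l \<Longrightarrow> x \<in> T" by blast

lemma reconnect:
  assumes "s1 \<in> S \<or> s2 \<in> S" "v \<in> S" "adj l v"
  shows "(l', v) \<in> (induced_rel T)\<^sup>*"
proof -
  have T: "l' \<in> T" "s1 \<in> S \<Longrightarrow> s1 \<in> T" "s2 \<in> S \<Longrightarrow> s2 \<in> T"
    "a' \<in> S \<Longrightarrow> a' \<in> T" "b' \<in> S \<Longrightarrow> b' \<in> T" "c' \<in> S \<Longrightarrow> c' \<in> T"
    using ne inT by blast+
  have 1: "s1 \<in> S \<Longrightarrow> (l', s1) \<in> (induced_rel T)\<^sup>*"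
    using T adj_l by (intro conn_edge)
  have 2: "s2 \<in> S \<Longrightarrow> (l', s2) \<in> (induced_rel T)\<^sup>*"
    using T adj_l by (intro conn_edge)
  have 3: "x \<in> T \<Longrightarrow> y \<in> T \<Longrightarrow> adj x y \<Longrightarrow> (l', x) \<in> (induced_rel T)\<^sup>* \<Longrightarrow> (l', y) \<in> (induced_rel T)\<^sup>*"
    for x y using conn_edge rtrancl_trans by meson
  have c1: "c' \<in> S \<Longrightarrow> s2 \<in> S \<Longrightarrow> (l', c') \<in> (induced_rel T)\<^sup>*"
    using 3[of s2 c'] T cyc 2 by blast
  have a1: "a' \<in> S \<Longrightarrow> s1 \<in> S \<Longrightarrow> (l', a') \<in> (induced_rel T)\<^sup>*"
    using 3[of s1 a'] T cyc' 1 by blast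
  have b1: "b' \<in> S \<Longrightarrow> a' \<in> S \<Longrightarrow> s1 \<in> S \<Longrightarrow> (l', b') \<in> (induced_rel T)\<^sup>*"
    using 3[of a' b'] T cyc' a1 by blast
  have b2: "b' \<in> S \<Longrightarrow> c' \<in> S \<Longrightarrow> s2 \<in> S \<Longrightarrow> (l', b') \<in> (induced_rel T)\<^sup>*"
    using 3[of c' b'] T cyc c1 by blast
  have a2: "b' \<in> S \<Longrightarrow> c' \<in> S \<Longrightarrow> s2 \<in> S \<Longrightarrow> a' \<in> S \<Longrightarrow> (l', a') \<in> (induced_rel T)\<^sup>*"
    using 3[of b' a'] T cyc b2 by blast
  have c2: "b' \<in> S \<Longrightarrow> c' \<in> S \<Longrightarrow> s1 \<in> S \<Longrightarrow> a' \<in> S \<Longrightarrow> (l', c') \<in> (induced_rel T)\<^sup>*"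
    using 3[of b' c'] T cyc' b1 by blast
  have "v \<in> {s1, s2, a', b', c'}"
    using assms nbr[of v] l by auto
  then consider "v = s1" | "v = s2" | "v = a'" | "v = b'" | "v = c'" by blast
  then show ?thesis
  proof cases
    case 1 then show ?thesis using assms \<open>s1 \<in> S \<Longrightarrow> (l', s1) \<in> (induced_rel T)\<^sup>*\<close> by blast
  next
    case 2 then show ?thesis using assms \<open>s2 \<in> S \<Longrightarrow> (l', s2) \<in> (induced_rel T)\<^sup>*\<close> by blast
  next
    case 3 then show ?thesis using assms pat a1 a2 by metis
  next
    case 4 then show ?thesis using assms pat b1 b2 by metis
  next
    case 5 then show ?thesis using assms pat c1 c2 by metis
  qed
qed

text \<open>If a common neighbour is occupied, l' takes over all connections of l by
  \<open>reconnect\<close>. Otherwise the occupied neighbours of l form a contiguous piece of an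
  arc, so l can be contracted to one of them, while l' is attached to a particle of the opposite
  arc.\<close>

lemma connected_T:
  assumes "lconnected S"
  shows "lconnected T"
proof (cases "s1 \<in> S \<or> s2 \<in> S")
  case True
  let ?f = "\<lambda>x. if x = l then l' else x"
  show ?thesis
  proof (rule lconnected_transfer[OF assms, of ?f])
    fix u v assume uv: "u \<in> S" "v \<in> S" "adj u v"
    consider "u = l" "v \<noteq> l" | "v = l" "u \<noteq> l" | "u \<noteq> l" "v \<noteq> l"
      using uv adj_irrefl by blast
    then show "(?f u, ?f v) \<in> (induced_rel T)\<^sup>*"
    proof cases
      case 1 then show ?thesis using reconnect[OF True, of v] uv by simp
    next
      case 2 then show ?thesis using reconnect[OF True, of u, THEN conn_sym] uv adj_sym by simp
    next
      case 3 then show ?thesis using uv by (simp add: conn_edge)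
    qed
  next
    fix x assume "x \<in> T"
    then show "\<exists>y\<in>S. (x, ?f y) \<in> (induced_rel T)\<^sup>*"
      using l by (cases "x = l'") (auto intro: bexI[of _ l] bexI[of _ x])
  qed
next
  case False
  then have p: "a' \<in> S \<or> b' \<in> S \<or> c' \<in> S" "a' \<in> S \<and> c' \<in> S \<longrightarrow> b' \<in> S" "a \<in> S \<or> b \<in> S \<or> c \<in> S"
    using pat by blast+
  have T: "a' \<in> S \<Longrightarrow> a' \<in> T" "b' \<in> S \<Longrightarrow> b' \<in> T" "c' \<in> S \<Longrightarrow> c' \<in> T"
    using ne inT by blast+
  have pq: "(u, v) \<in> (induced_rel T)\<^sup>*" if "u \<in> {a', b', c'}" "v \<in> {a', b', c'}" "u \<in> S" "v \<in> S" for u v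
  proof -
    have "(a', b') \<in> (induced_rel T)\<^sup>*" if "a' \<in> S" "b' \<in> S"
      using that T cyc' by (intro conn_edge) auto
    moreover have "(b', c') \<in> (induced_rel T)\<^sup>*" if "b' \<in> S" "c' \<in> S"
      using that T cyc' by (intro conn_edge) auto
    ultimately show ?thesis
      using that p(2) by (auto intro: conn_sym rtrancl_trans)
  qed
  obtain g where g: "g \<in> {a', b', c'}" "g \<in> S" using p by blast
  obtain h where h: "h \<in> {a, b, c}" "h \<in> S" using p by blast
  let ?f = "\<lambda>x. if x = l then g else x"
  have nb: "v \<in> {a', b', c'}" if "adj l v" "v \<in> S" for v
    using that nbr[of v] l False by auto
  show ?thesis
  proof (rule lconnected_transfer[OF assms, of ?f])
    fix u v assume uv: "u \<in> S" "v \<in> S" "adj u v"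
    consider "u = l" "v \<noteq> l" | "v = l" "u \<noteq> l" | "u \<noteq> l" "v \<noteq> l"
      using uv adj_irrefl by blast
    then show "(?f u, ?f v) \<in> (induced_rel T)\<^sup>*"
    proof cases
      case 1 then show ?thesis using pq[of g v] nb[of v] g uv by simp
    next
      case 2 then show ?thesis using pq[of u g] nb[of u] g uv adj_sym by simp
    next
      case 3 then show ?thesis using uv by (simp add: conn_edge)
    qed
  next
    fix x assume x: "x \<in> T"
    show "\<exists>y\<in>S. (x, ?f y) \<in> (induced_rel T)\<^sup>*"
    proof (cases "x = l'")
      case True
      have "(l', h) \<in> (induced_rel T)\<^sup>*"
        using h adj_l ne inT by (intro conn_edge) auto
      moreover have "h \<noteq> l" using h ne by auto
      ultimately show ?thesis using True h by (intro bexI[of _ h]) auto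
    next
      case False
      then show ?thesis using x by (intro bexI[of _ x]) auto
    qed
  qed
qed

text \<open>The counterpart of \<open>reconnect\<close> for the complement: the empty sites around
  l' stay joined when l' becomes occupied. Unless both common neighbours are occupied, they are
  joined through the vacated l. If both are occupied, l lies on the other side, but then the pattern
  makes the empty sites among a, b, c contiguous.\<close>

lemma detour:
  "\<exists>g. \<forall>v\<in>{s1, s2, a, b, c} - S. (g, v) \<in> (induced_rel (- T))\<^sup>*"
proof -
  have U: "l \<in> - T" "s1 \<notin> S \<Longrightarrow> s1 \<in> - T" "s2 \<notin> S \<Longrightarrow> s2 \<in> - T"
    "a \<notin> S \<Longrightarrow> a \<in> - T" "b \<notin> S \<Longrightarrow> b \<in> - T" "c \<notin> S \<Longrightarrow> c \<in> - T"
    using ne by blast+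
  show ?thesis
  proof (cases "s1 \<in> S \<and> s2 \<in> S")
    case False
    have 3: "x \<in> - T \<Longrightarrow> y \<in> - T \<Longrightarrow> adj x y \<Longrightarrow> (l, x) \<in> (induced_rel (- T))\<^sup>* \<Longrightarrow>
        (l, y) \<in> (induced_rel (- T))\<^sup>*"
      for x y using conn_edge rtrancl_trans by meson
    have 1: "s1 \<notin> S \<Longrightarrow> (l, s1) \<in> (induced_rel (- T))\<^sup>*"
      using U adj_l by (intro conn_edge)
    have 2: "s2 \<notin> S \<Longrightarrow> (l, s2) \<in> (induced_rel (- T))\<^sup>*"
      using U adj_l by (intro conn_edge)
    have a1: "s1 \<notin> S \<Longrightarrow> a \<notin> S \<Longrightarrow> (l, a) \<in> (induced_rel (- T))\<^sup>*"
      using 3[of s1 a] U cyc 1 by blast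
    have c1: "s2 \<notin> S \<Longrightarrow> c \<notin> S \<Longrightarrow> (l, c) \<in> (induced_rel (- T))\<^sup>*"
      using 3[of s2 c] U cyc' 2 by blast
    have b1: "s1 \<notin> S \<Longrightarrow> a \<notin> S \<Longrightarrow> b \<notin> S \<Longrightarrow> (l, b) \<in> (induced_rel (- T))\<^sup>*"
      using 3[of a b] U cyc a1 by blast
    have b2: "s2 \<notin> S \<Longrightarrow> c \<notin> S \<Longrightarrow> b \<notin> S \<Longrightarrow> (l, b) \<in> (induced_rel (- T))\<^sup>*"
      using 3[of c b] U cyc' c1 by blast
    have a2: "s2 \<notin> S \<Longrightarrow> c \<notin> S \<Longrightarrow> b \<notin> S \<Longrightarrow> a \<notin> S \<Longrightarrow> (l, a) \<in> (induced_rel (- T))\<^sup>*"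
      using 3[of b a] U cyc' b2 by blast
    have c2: "s1 \<notin> S \<Longrightarrow> a \<notin> S \<Longrightarrow> b \<notin> S \<Longrightarrow> c \<notin> S \<Longrightarrow> (l, c) \<in> (induced_rel (- T))\<^sup>*"
      using 3[of b c] U cyc b1 by blast
    have "a \<notin> S \<Longrightarrow> (l, a) \<in> (induced_rel (- T))\<^sup>*"
      using a1 a2 pat False by metis
    moreover have "b \<notin> S \<Longrightarrow> (l, b) \<in> (induced_rel (- T))\<^sup>*"
      using b1 b2 pat False by metis
    moreover have "c \<notin> S \<Longrightarrow> (l, c) \<in> (induced_rel (- T))\<^sup>*"
      using c1 c2 pat False by metis
    ultimately show ?thesis using 1 2 by (intro exI[of _ l]) blast
  next
    case True
    have e: "x \<in> - T \<Longrightarrow> y \<in> - T \<Longrightarrow> adj x y \<Longrightarrow> (x, y) \<in> (induced_rel (- T))\<^sup>*" for x y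
      by (rule conn_edge)
    consider "b \<notin> S" | "b \<in> S" "a \<in> S" | "b \<in> S" "c \<in> S"
      using pat True by blast
    then show ?thesis
    proof cases
      case 1
      have "\<forall>v\<in>{s1, s2, a, b, c} - S. (b, v) \<in> (induced_rel (- T))\<^sup>*"
        using 1 True e[of b a] e[of b c] U cyc cyc' by blast
      then show ?thesis by blast
    next
      case 2
      have "\<forall>v\<in>{s1, s2, a, b, c} - S. (c, v) \<in> (induced_rel (- T))\<^sup>*"
        using 2 True by blast
      then show ?thesis by blast
    next
      case 3
      have "\<forall>v\<in>{s1, s2, a, b, c} - S. (a, v) \<in> (induced_rel (- T))\<^sup>*"
        using 3 True by blast
      then show ?thesis by blast
    qed
  qed
qed

text \<open>Contracting l' to the site g of \<open>detour\<close> maps the old complement into the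
  new one. Hence a component loses at most the site l' and stays infinite.\<close>

lemma no_holes_T:
  assumes "no_holes S"
  shows "no_holes T"
proof -
  obtain g where g: "\<And>v. v \<in> {s1, s2, a, b, c} \<Longrightarrow> v \<notin> S \<Longrightarrow> (g, v) \<in> (induced_rel (- T))\<^sup>*"
    using detour by blast
  let ?f = "\<lambda>x. if x = l' then g else x"
  have nb: "v \<in> {s1, s2, a, b, c}" if "adj l' v" "v \<notin> S" for v
    using that nbr'[of v] l by auto
  have f: "(?f u, ?f v) \<in> (induced_rel (- T))\<^sup>*" if uv: "u \<in> - S" "v \<in> - S" "adj u v" for u v
  proof -
    consider "u = l'" "v \<noteq> l'" | "v = l'" "u \<noteq> l'" | "u \<noteq> l'" "v \<noteq> l'"
      using uv adj_irrefl by blast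
    then show ?thesis
    proof cases
      case 1 then show ?thesis using g[of v] nb[of v] uv by simp
    next
      case 2 then show ?thesis using g[of u, THEN conn_sym] nb[of u] uv adj_sym by simp
    next
      case 3 then show ?thesis using uv by (simp add: conn_edge)
    qed
  qed
  have inf: "infinite (comp (- T) z)" if "z \<notin> S" "z \<noteq> l'" for z
  proof -
    have "comp (- S) z - {l'} \<subseteq> comp (- T) z"
    proof
      fix y assume "y \<in> comp (- S) z - {l'}"
      then have "(?f z, ?f y) \<in> (induced_rel (- T))\<^sup>*"
        unfolding comp_def by (intro conn_map[of z y "- S" ?f "- T"] f) auto
      then show "y \<in> comp (- T) z"
        using \<open>y \<in> _\<close> that by (simp add: comp_def)
    qed
    moreover have "infinite (comp (- S) z - {l'})"
      using assms[unfolded no_holes_iff, rule_format, OF that(1)] by (rule infinite_remove)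
    ultimately show ?thesis using finite_subset by blast
  qed
  \<comment> \<open>Here the exclusion of five occupied neighbours enters: without an empty
    neighbour besides l', the vacated l would itself be a hole.\<close>
  obtain p where p: "p \<in> {s1, s2, a', b', c'}" "p \<notin> S"
    using pat by blast
  have "adj l p" "p \<noteq> l'" using p nbr[of p] ne by auto
  then have "(l, p) \<in> (induced_rel (- T))\<^sup>*"
    using p ne by (intro conn_edge) auto
  then have "comp (- T) p \<subseteq> comp (- T) l"
    by (auto simp: comp_def)
  then have "infinite (comp (- T) l)"
    using inf[OF p(2) \<open>p \<noteq> l'\<close>] finite_subset by blast
  then show ?thesis
    unfolding no_holes_iff using inf by (metis Diff_iff insert_iff singletonD)
qed

end

lemma edge_ring_vpat:
  assumes d: "d \<in> set dirs" and l: "l \<in> S" "l + d \<notin> S" and v: "vpat S l d"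
  shows "edge_ring S l (l + d) (l + rot d) (l + d - rot d) (l + d + rot d) (l + d + d)
    (l + d + d - rot d) (l + rot d - d) (l - d) (l - rot d)"
proof unfold_locales
  note A = ring_adj[OF d, of l]
  note A' = A[THEN adj_sym[THEN iffD1]]
  show "adj l y \<longleftrightarrow> y \<in> {l + d, l + rot d, l + d - rot d, l + rot d - d, l - d, l - rot d}" for y
    using adj_nbrs[OF d, of l y] by blast
  have "l + d + rot d - d = l + rot d" "l + d - d = l" by (simp_all add: algebra_simps)
  then show "adj (l + d) y \<longleftrightarrow> y \<in> {l, l + rot d, l + d - rot d, l + d + rot d, l + d + d, l + d + d - rot d}" for y
    using adj_nbrs[OF d, of "l + d" y] by auto
  show "l \<notin> {l + d + rot d, l + d + d, l + d + d - rot d}"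
    using d by (cases rule: dirs_cases; cases l; simp add: rot_def)
  show "l + d \<notin> {l + rot d - d, l - d, l - rot d}"
    using d by (cases rule: dirs_cases; cases l; simp add: rot_def)
  show "((l + rot d \<in> S \<or> l + d - rot d \<in> S) \<and>
     \<not> (l + rot d \<in> S \<and> l + d - rot d \<in> S \<and> l + rot d - d \<in> S \<and> l - d \<in> S \<and> l - rot d \<in> S) \<and>
     (l + d + rot d \<in> S \<longrightarrow> l + rot d \<in> S \<or> l + d + d \<in> S \<and> l + d + d - rot d \<in> S \<and> l + d - rot d \<in> S) \<and>
     (l + d + d \<in> S \<longrightarrow> l + d + rot d \<in> S \<and> l + rot d \<in> S \<or> l + d + d - rot d \<in> S \<and> l + d - rot d \<in> S) \<and>
     (l + d + d - rot d \<in> S \<longrightarrow> l + d - rot d \<in> S \<or> l + d + d \<in> S \<and> l + d + rot d \<in> S \<and> l + rot d \<in> S) \<and>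
     (l + rot d - d \<in> S \<longrightarrow> l + rot d \<in> S \<or> l - d \<in> S \<and> l - rot d \<in> S \<and> l + d - rot d \<in> S) \<and>
     (l - d \<in> S \<longrightarrow> l + rot d - d \<in> S \<and> l + rot d \<in> S \<or> l - rot d \<in> S \<and> l + d - rot d \<in> S) \<and>
     (l - rot d \<in> S \<longrightarrow> l + d - rot d \<in> S \<or> l - d \<in> S \<and> l + rot d - d \<in> S \<and> l + rot d \<in> S)) \<or>
    l + rot d \<notin> S \<and> l + d - rot d \<notin> S \<and>
    (l + d + rot d \<in> S \<or> l + d + d \<in> S \<or> l + d + d - rot d \<in> S) \<and>
    (l + d + rot d \<in> S \<and> l + d + d - rot d \<in> S \<longrightarrow> l + d + d \<in> S) \<and>
    (l + rot d - d \<in> S \<or> l - d \<in> S \<or> l - rot d \<in> S) \<and>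
    (l + rot d - d \<in> S \<and> l - rot d \<in> S \<longrightarrow> l - d \<in> S)"
    using v unfolding vpat_def Let_def by blast
qed (rule ring_adj[OF d] l)+

lemma vmove_conf:
  assumes "vmove S S'" "conf S"
  shows "conf S'" "card S' = card S"
proof -
  from assms(1) obtain l d where ld: "l \<in> S" "d \<in> set dirs" "l + d \<notin> S" "vpat S l d"
    and S': "S' = insert (l + d) (S - {l})"
    by (auto simp: vmove_def move_def)
  interpret edge_ring S l "l + d" "l + rot d" "l + d - rot d" "l + d + rot d" "l + d + d"
    "l + d + d - rot d" "l + rot d - d" "l - d" "l - rot d"
    by (rule edge_ring_vpat) fact+
  show "conf S'"
    using assms(2) connected_T no_holes_T by (auto simp: conf_def S')
  show "card S' = card S"
  proof -
    have "finite S" using assms(2) by (simp add: conf_def)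
    then have "card S' = Suc (card (S - {l}))"
      using ld by (simp add: S')
    also have "\<dots> = card S" using \<open>finite S\<close> ld by (intro card_Suc_Diff1) auto
    finally show ?thesis .
  qed
qed

section \<open>Irreducibility\<close>

abbreviation reach :: "loc set \<Rightarrow> loc set \<Rightarrow> bool" where
  "reach \<equiv> vmove\<^sup>*\<^sup>*"

lemma reach_conf:
  assumes "reach S S'" "conf S"
  shows "conf S' \<and> card S' = card S"
  using assms by (induction rule: rtranclp_induct) (auto dest: vmove_conf)

lemma rot_minus: "rot (- d) = - rot d"
  by (simp add: rot_def)

section \<open>Jumps, folds and obstacles on a ray\<close>

lemma vmoveI:
  "l \<in> S \<Longrightarrow> d \<in> set dirs \<Longrightarrow> l + d \<notin> S \<Longrightarrow> vpat S l d \<Longrightarrow> vmove S (insert (l + d) (S - {l}))"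
  unfolding vmove_def move_def by blast

lemma vmove_jump:
  assumes d: "d \<in> set dirs" and "s \<notin> S" "s + d \<in> S" "s + rot d \<notin> S" "s + d - rot d \<notin> S"
    and "s + rot d - d \<in> S \<or> s - d \<in> S \<or> s - rot d \<in> S"
    and "s + rot d - d \<in> S \<and> s - rot d \<in> S \<longrightarrow> s - d \<in> S"
    and "s + d + rot d \<in> S \<or> s + d + d \<in> S \<or> s + d + d - rot d \<in> S"
    and "s + d + rot d \<in> S \<and> s + d + d - rot d \<in> S \<longrightarrow> s + d + d \<in> S"
  shows "vmove S (insert s (S - {s + d}))"
proof -
  have eq: "s + d + rot (- d) = s + d - rot d" "s + d + - d = s"
    "s - rot (- d) = s + rot d" "s + rot (- d) = s - rot d" "s + - d = s - d"
    "s - d - rot (- d) = s + rot d - d" "s + d - rot d - - d = s + d + d - rot d"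
    "s + d - - d = s + d + d" "s + d - rot (- d) = s + d + rot d"
    by (simp_all add: rot_minus algebra_simps)
  have "vpat S (s + d) (- d)"
    unfolding vpat_def Let_def eq using assms(2-) by blast
  from vmoveI[OF assms(3) dirs_minus[OF d] _ this] assms(2) show ?thesis
    unfolding eq by blast
qed

lemma vmove_fold:
  assumes "d \<in> set dirs" "l \<in> S" "l + d \<notin> S" "l + rot d \<in> S" "l + d - rot d \<in> S" "l - d \<notin> S"
    "l + d + d \<in> S \<longrightarrow> l + d + rot d \<in> S \<or> l + d + d - rot d \<in> S"
  shows "vmove S (insert (l + d) (S - {l}))"
proof (rule vmoveI[OF assms(2,1,3)])
  show "vpat S l d"
    unfolding vpat_def Let_def using assms(4-) by blast
qed

text \<open>For \<open>fst d = -1\<close> this is the half-line s, s + d, s + 2d, ... Collinearity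
  is written as a cross product, so that membership is linear arithmetic once d is known.\<close>

definition ray :: "loc \<Rightarrow> loc \<Rightarrow> loc set" where
  "ray s d = {x. fst x \<le> fst s \<and> (fst x - fst s) * snd d = (snd x - snd s) * fst d}"

lemma left_dirs:
  assumes "d \<in> set dirs" "fst d = -1"
  obtains "d = (-1, 1)" "rot d = (-1, 0)" | "d = (-1, 0)" "rot d = (0, -1)"
proof -
  have "d = (-1, 1) \<or> d = (-1, 0)"
    using assms by (cases rule: dirs_cases) auto
  moreover have "rot (-1, 1) = (-1, 0)" "rot (-1, 0) = (0, -1)" by (simp_all add: rot_def)
  ultimately show ?thesis using that by blast
qed

lemma ray_mem:
  assumes "d \<in> set dirs" "fst d = -1"
  shows "s \<in> ray s d" "s + d \<in> ray s d" "s + d + d \<in> ray s d"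
    "x \<in> ray (s + d + d) d \<Longrightarrow> x \<in> ray s d"
    "s - d \<notin> ray s d" "s - d - d \<notin> ray s d" "s - d - d - d \<notin> ray s d"
    "s + rot d \<notin> ray s d" "s + d - rot d \<notin> ray s d" "s + rot d - d \<notin> ray s d" "s - rot d \<notin> ray s d"
    "s + rot d - d - d \<notin> ray s d" "s - d - rot d \<notin> ray s d" "s + rot d - d - d - d \<notin> ray s d"
    "s - d - d - rot d \<notin> ray s d" "s + d + rot d \<notin> ray s d" "s + d + d - rot d \<notin> ray s d"
  using assms by (cases rule: left_dirs; simp add: ray_def; linarith?)+

text \<open>An isolated neighbour s + d of an empty site s can be got rid of by moves along the ray
  from s in direction d: either it jumps to s itself, or it is a corner and folds away from s
  after the next obstacle on the ray has been removed in the same way.\<close>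

lemma resolve:
  assumes "conf S" "card S \<ge> 2" and d: "d \<in> set dirs" "fst d = -1"
    and "s \<notin> S" "s + d \<in> S" "s + rot d \<notin> S" "s + d - rot d \<notin> S"
    and "s + rot d - d \<in> S \<or> s - d \<in> S \<or> s - rot d \<in> S"
    and "s + rot d - d \<in> S \<and> s - rot d \<in> S \<longrightarrow> s - d \<in> S"
    and "\<forall>x\<in>S. x0 \<le> fst x"
  shows "\<exists>S'. reach S S' \<and> (\<forall>x. x \<notin> ray s d \<longrightarrow> (x \<in> S' \<longleftrightarrow> x \<in> S)) \<and> s + d \<notin> S' \<and>
           (\<forall>x\<in>S'. x0 \<le> fst x)"
  using assms
proof (induction "nat (fst s - x0)" arbitrary: s S rule: less_induct)
  case less
  note S = less.prems
  note R = ray_mem[OF d]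
  have r0: "x0 \<le> fst s - 1" using S(6,11) d(2) by force
  have jump: "\<exists>S'. reach S S' \<and> (\<forall>x. x \<notin> ray s d \<longrightarrow> (x \<in> S' \<longleftrightarrow> x \<in> S)) \<and> s + d \<notin> S' \<and>
           (\<forall>x\<in>S'. x0 \<le> fst x)"
    if S1: "reach S S1" "\<And>x. x \<notin> ray (s + d + d) d \<Longrightarrow> (x \<in> S1 \<longleftrightarrow> x \<in> S)" "\<forall>x\<in>S1. x0 \<le> fst x"
      "s + d + rot d \<in> S \<or> s + d + d \<in> S1 \<or> s + d + d - rot d \<in> S"
      "s + d + rot d \<in> S \<and> s + d + d - rot d \<in> S \<longrightarrow> s + d + d \<in> S1" for S1
  proof -
    have n: "s \<notin> ray (s + d + d) d" "s + d \<notin> ray (s + d + d) d" "s + rot d \<notin> ray (s + d + d) d"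
      "s + d - rot d \<notin> ray (s + d + d) d" "s + rot d - d \<notin> ray (s + d + d) d"
      "s - d \<notin> ray (s + d + d) d" "s - rot d \<notin> ray (s + d + d) d"
      "s + d + rot d \<notin> ray (s + d + d) d" "s + d + d - rot d \<notin> ray (s + d + d) d"
      using R[of "s + d + d"] by (simp_all add: algebra_simps)
    have "vmove S1 (insert s (S1 - {s + d}))"
    proof (rule vmove_jump[OF d(1)])
      show "s \<notin> S1" "s + d \<in> S1" "s + rot d \<notin> S1" "s + d - rot d \<notin> S1"
        using S1(2) n S(5-8) by blast+
      show "s + rot d - d \<in> S1 \<or> s - d \<in> S1 \<or> s - rot d \<in> S1"
        "s + rot d - d \<in> S1 \<and> s - rot d \<in> S1 \<longrightarrow> s - d \<in> S1"
        using S1(2) n S(9,10) by blast+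
      show "s + d + rot d \<in> S1 \<or> s + d + d \<in> S1 \<or> s + d + d - rot d \<in> S1"
        "s + d + rot d \<in> S1 \<and> s + d + d - rot d \<in> S1 \<longrightarrow> s + d + d \<in> S1"
        using S1(2,4,5) n by blast+
    qed
    then have "reach S (insert s (S1 - {s + d}))"
      using S1(1) by simp
    moreover have "s + d \<noteq> s" using d(2) by (auto simp: prod_eq_iff)
    moreover have "x0 \<le> fst s" using r0 by simp
    ultimately show ?thesis
      using S1(2,3) R(1,2)[of s] R(4)[of _ s]
      by (intro exI[of _ "insert s (S1 - {s + d})"]) blast
  qed
  have "\<exists>y\<in>S. adj (s + d) y"
    using lconnected_nbr[of S "s + d"] S by (auto simp: conf_def)
  then obtain y where y: "y \<in> S" "adj (s + d) y" by blast
  have eqs: "s + d + rot d - d = s + rot d" "s + d - d = s" "s + d + d + rot d - d = s + d + rot d"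
    "s + d + d - d = s + d" by (simp_all add: algebra_simps)
  have ne: "s + d + rot d \<in> S \<or> s + d + d \<in> S \<or> s + d + d - rot d \<in> S"
    using y S(5,7,8) unfolding adj_nbrs[OF d(1)] eqs by blast
  \<comment> \<open>If the occupied sites ahead of s + d are contiguous, the particle at s + d can
    jump to s. Otherwise exactly the two outer ones are occupied, and it can fold into s + d + d
    unless an isolated particle at s + d + d + d is in the way.\<close>
  show ?case
  proof (cases "s + d + rot d \<in> S \<and> s + d + d - rot d \<in> S \<longrightarrow> s + d + d \<in> S")
    case True
    then show ?thesis using jump[of S] ne S(11) by blast
  next
    case False
    then have F: "s + d + rot d \<in> S" "s + d + d - rot d \<in> S" "s + d + d \<notin> S" by blast+
    \<comment> \<open>One of the two outer sites lies in the same column as s + d + d, so folding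
      does not leave the half-plane bounded by x0. This bound is what makes the recursion along the
      ray end.\<close>
    have "x0 \<le> fst (s + d + rot d)" "x0 \<le> fst (s + d + d - rot d)"
      using F S(11) by blast+
    then have x0: "x0 \<le> fst (s + d + d)"
      by (cases rule: left_dirs[OF d]) simp_all
    have fold: "\<exists>S'. reach S S' \<and> (\<forall>x. x \<notin> ray s d \<longrightarrow> (x \<in> S' \<longleftrightarrow> x \<in> S)) \<and> s + d \<notin> S' \<and>
           (\<forall>x\<in>S'. x0 \<le> fst x)"
      if S1: "reach S S1" "\<And>x. x \<notin> ray (s + d + d) d \<Longrightarrow> (x \<in> S1 \<longleftrightarrow> x \<in> S)" "\<forall>x\<in>S1. x0 \<le> fst x"
        "s + d + d \<notin> S1"
        "s + d + d + d \<in> S1 \<longrightarrow> s + d + d + rot d \<in> S \<or> s + d + d + d - rot d \<in> S" for S1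
    proof -
      have n: "s \<notin> ray (s + d + d) d" "s + d \<notin> ray (s + d + d) d"
        "s + d + rot d \<notin> ray (s + d + d) d" "s + d + d - rot d \<notin> ray (s + d + d) d"
        "s + d + d + rot d \<notin> ray (s + d + d) d" "s + d + d + d - rot d \<notin> ray (s + d + d) d"
        using R[of "s + d + d"] by (simp_all add: algebra_simps)
      have "vmove S1 (insert (s + d + d) (S1 - {s + d}))"
      proof (rule vmove_fold[OF d(1)])
        show "s + d \<in> S1" "s + d + rot d \<in> S1" "s + d + d - rot d \<in> S1"
          using S1(2) n S(6) F by blast+
        show "s + d - d \<notin> S1" unfolding eqs using S1(2) n S(5) by blast
        show "s + d + d + d \<in> S1 \<longrightarrow> s + d + d + rot d \<in> S1 \<or> s + d + d + d - rot d \<in> S1"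
          using S1(2,5) n by blast
      qed (fact S1(4))
      then have "reach S (insert (s + d + d) (S1 - {s + d}))"
        using S1(1) by simp
      moreover have "s + d \<noteq> s + d + d" using d(2) by (auto simp: prod_eq_iff)
      ultimately show ?thesis
        using S1(2,3) R(2,3)[of s] R(4)[of _ s] x0
        by (intro exI[of _ "insert (s + d + d) (S1 - {s + d})"]) blast
    qed
    show ?thesis
    proof (cases "s + d + d + d \<in> S \<and> s + d + d + rot d \<notin> S \<and> s + d + d + d - rot d \<notin> S")
      case False
      then show ?thesis using fold[of S] F S(11) by blast
    next
      case True
      have "nat (fst (s + d + d) - x0) < nat (fst s - x0)"
        using r0 d(2) by simp
      from less.hyps[OF this S(1,2) d, of ] True F S(6,11)
      obtain S1 where S1: "reach S S1" "\<forall>x. x \<notin> ray (s + d + d) d \<longrightarrow> (x \<in> S1 \<longleftrightarrow> x \<in> S)"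
        "s + d + d + d \<notin> S1" "\<forall>x\<in>S1. x0 \<le> fst x"
        unfolding eqs by blast
      \<comment> \<open>Removing the next obstacle may have filled s + d + d. Then the sites ahead
        of s + d have become contiguous and the jump is possible after all.\<close>
      show ?thesis
      proof (cases "s + d + d \<in> S1")
        case True
        then show ?thesis using jump[of S1] S1 by blast
      next
        case False
        then show ?thesis using fold[of S1] S1 by blast
      qed
    qed
  qed
qed

section \<open>Emptying the rightmost column\<close>

definition col :: "int \<Rightarrow> loc set \<Rightarrow> loc set" where
  "col M Y = {p \<in> Y. fst p = M}"

text \<open>Only an isolated particle at q + d + d can prevent q from moving to q + d, and
  \<open>resolve\<close> with s = q + d removes it. If q + d gets filled in the course of this, q
  stays where it is, but column M - 1 has gained a particle; this is the second alternative.\<close>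

lemma pull:
  assumes Y: "conf Y" "card Y \<ge> 2" "\<forall>p\<in>Y. x0 \<le> fst p \<and> fst p \<le> M"
    and d: "d \<in> set dirs" "fst d = -1" and q: "q \<in> Y" "fst q = M" "x0 < M"
    and "q + d \<notin> Y" "q + rot d \<in> Y" "q - rot d \<in> Y \<longrightarrow> q + d - rot d \<in> Y"
      "q + d + d - rot d \<in> Y \<longrightarrow> q + d - rot d \<in> Y"
  shows "\<exists>Y'. reach Y Y' \<and> (\<forall>p\<in>Y'. x0 \<le> fst p \<and> fst p \<le> M) \<and>
    (col M Y' = col M Y - {q} \<or>
     col M Y' = col M Y \<and> col (M - 1) Y' = insert (q + d) (col (M - 1) Y))"
proof -
  note R = ray_mem[OF d, of "q + d"]
  have nd: "q - d \<notin> Y" using Y(3) q d(2) by force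
  have go: ?thesis
    if Z: "reach Y Z" "\<And>x. x \<notin> ray (q + d) d \<Longrightarrow> (x \<in> Z \<longleftrightarrow> x \<in> Y)" "\<forall>p\<in>Z. x0 \<le> fst p"
      "q + d \<notin> Z" "q + d + d \<in> Z \<longrightarrow> q + d + rot d \<in> Y \<or> q + d + d - rot d \<in> Y" for Z
  proof -
    have n: "q \<notin> ray (q + d) d" "q + rot d \<notin> ray (q + d) d" "q - rot d \<notin> ray (q + d) d"
      "q + d - rot d \<notin> ray (q + d) d" "q + d + rot d \<notin> ray (q + d) d"
      "q + d + d - rot d \<notin> ray (q + d) d" "q - d \<notin> ray (q + d) d"
      using R by (simp_all add: algebra_simps)
    have mem: "q \<in> Z" "q + rot d \<in> Z" "q - d \<notin> Z" "q - rot d \<in> Z \<longrightarrow> q + d - rot d \<in> Z"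
      "q + d + d - rot d \<in> Z \<longrightarrow> q + d - rot d \<in> Z"
      "q + d + d \<in> Z \<longrightarrow> q + d + rot d \<in> Z \<or> q + d + d - rot d \<in> Z"
      using Z(2) n assms nd Z(5) by blast+
    have "vpat Z q d"
      unfolding vpat_def Let_def using mem by blast
    from vmoveI[OF mem(1) d(1) Z(4) this]
    have "reach Y (insert (q + d) (Z - {q}))" using Z(1) by simp
    moreover have "fst p \<le> M" if "p \<in> Z" for p
    proof (cases "p \<in> ray (q + d) d")
      case True
      then show ?thesis using q d(2) by (simp add: ray_def)
    next
      case False
      then show ?thesis using Z(2) that Y(3) by blast
    qed
    moreover have "col M (insert (q + d) (Z - {q})) = col M Y - {q}"
    proof -
      have "p \<in> Z \<longleftrightarrow> p \<in> Y" if "fst p = M" for p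
        using Z(2)[of p] that q d(2) by (auto simp: ray_def)
      then show ?thesis using q d(2) by (auto simp: col_def)
    qed
    ultimately show ?thesis
      using Z(3) q d(2)
      by (intro exI[of _ "insert (q + d) (Z - {q})"]) auto
  qed
  show ?thesis
  proof (cases "q + d + d \<in> Y \<and> q + d + rot d \<notin> Y \<and> q + d + d - rot d \<notin> Y")
    case False
    then show ?thesis using go[of Y] Y(3) assms by blast
  next
    case True
    have eqs: "q + d + rot d - d = q + rot d" "q + d - d = q" by (simp_all add: algebra_simps)
    have "\<exists>Y'. reach Y Y' \<and> (\<forall>x. x \<notin> ray (q + d) d \<longrightarrow> (x \<in> Y' \<longleftrightarrow> x \<in> Y)) \<and> q + d + d \<notin> Y' \<and>
           (\<forall>x\<in>Y'. x0 \<le> fst x)"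
      by (rule resolve[OF Y(1,2) d]) (use True assms eqs in auto)
    then obtain Y' where Y': "reach Y Y'" "\<And>x. x \<notin> ray (q + d) d \<Longrightarrow> (x \<in> Y' \<longleftrightarrow> x \<in> Y)"
      "q + d + d \<notin> Y'" "\<forall>x\<in>Y'. x0 \<le> fst x" by blast
    show ?thesis
    proof (cases "q + d \<in> Y'")
      case False
      then show ?thesis using go[of Y'] Y' by blast
    next
      case True
      have ray: "fst p \<le> M - 1 \<and> (fst p = M - 1 \<longrightarrow> p = q + d)" if "p \<in> ray (q + d) d" for p
        using that q(2) d(2) by (auto simp: ray_def prod_eq_iff)
      have eq: "p \<in> Y' \<longleftrightarrow> p \<in> Y" if "fst p = M \<or> fst p = M - 1 \<and> p \<noteq> q + d" for p
        using Y'(2)[of p] that ray[of p] by auto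
      have "\<forall>p\<in>Y'. fst p \<le> M"
      proof
        fix p assume "p \<in> Y'"
        then show "fst p \<le> M"
          using Y'(2)[of p] ray[of p] Y(3) by (cases "p \<in> ray (q + d) d") auto
      qed
      moreover have "col M Y' = col M Y"
        using eq by (auto simp: col_def)
      moreover have "fst (q + d) = M - 1" using q(2) d(2) by simp
      then have "col (M - 1) Y' = insert (q + d) (col (M - 1) Y)"
        using eq True unfolding col_def by blast
      ultimately show ?thesis using Y' by blast
    qed
  qed
qed

text \<open>Three kinds of progress, in order of priority: a particle leaves column M, column M - 1
  gains a particle, or the top of column M climbs towards the top of column M - 1.\<close>

definition squeeze_measure :: "int \<Rightarrow> loc set \<Rightarrow> nat \<times> nat \<times> nat" where
  "squeeze_measure M Y = (card (col M Y), card Y - card (col (M - 1) Y),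
     nat (Max (snd ` col (M - 1) Y) + 1 - Max (snd ` col M Y)))"

abbreviation "squeeze_less \<equiv> less_than <*lex*> less_than <*lex*> less_than"

lemma dirs_mem: "(-1, 1) \<in> set dirs" "(-1, 0) \<in> set dirs" "(0, 1) \<in> set dirs"
  by (simp_all add: dirs_def)

lemma rot_vals: "rot (-1, 1) = (-1, 0)" "rot (-1, 0) = (0, -1)" "rot (0, 1) = (-1, 1)"
  by (simp_all add: rot_def)

lemma adj_pair:
  "adj (x, y) p \<longleftrightarrow> p \<in> {(x + 1, y), (x, y + 1), (x - 1, y + 1), (x - 1, y), (x, y - 1), (x + 1, y - 1)}"
  using adj_nbrs[of "(0, 1)" "(x, y)" p] dirs_mem(3) rot_vals(3) by auto

lemma squeeze_step:
  assumes Y: "conf Y" "card Y \<ge> 2" "\<forall>p\<in>Y. x0 \<le> fst p \<and> fst p \<le> M"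
    and M: "col M Y \<noteq> {}" "\<not> Y \<subseteq> {p. fst p = M}"
  shows "\<exists>Y'. reach Y Y' \<and> (\<forall>p\<in>Y'. x0 \<le> fst p \<and> fst p \<le> M) \<and>
    (squeeze_measure M Y', squeeze_measure M Y) \<in> squeeze_less"
proof -
  have fin: "finite Y" using Y(1) by (simp add: conf_def)
  have x0: "x0 < M"
    using Y(3) M(2) by force
  have right: "(M + 1, y) \<notin> Y" for y
    using Y(3) by force
  have finish: ?thesis
    if "reach Y Y'" "\<forall>p\<in>Y'. x0 \<le> fst p \<and> fst p \<le> M" and q: "q \<in> Y" "fst q = M"
      and s: "fst s = M - 1" "s \<notin> Y"
      and "col M Y' = col M Y - {q} \<or> col M Y' = col M Y \<and> col (M - 1) Y' = insert s (col (M - 1) Y)"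
    for Y' q s
  proof -
    have c: "conf Y'" "card Y' = card Y" using reach_conf that(1) Y(1) by blast+
    have "(squeeze_measure M Y', squeeze_measure M Y) \<in> squeeze_less"
      using that(7)
    proof
      assume "col M Y' = col M Y - {q}"
      moreover have "q \<in> col M Y" "finite (col M Y)"
        using q fin by (auto simp: col_def)
      ultimately have "card (col M Y') < card (col M Y)"
        by (metis card_Diff1_less)
      then show ?thesis by (simp add: squeeze_measure_def)
    next
      assume eq: "col M Y' = col M Y \<and> col (M - 1) Y' = insert s (col (M - 1) Y)"
      have "finite (col (M - 1) Y)" "s \<notin> col (M - 1) Y"
        using s fin by (auto simp: col_def)
      then have "card (col (M - 1) Y') = Suc (card (col (M - 1) Y))"
        using eq by simp
      moreover have "card (col (M - 1) Y') \<le> card Y'"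
        using c by (intro card_mono) (auto simp: conf_def col_def)
      ultimately have "card Y' - card (col (M - 1) Y') < card Y - card (col (M - 1) Y)"
        using c(2) by linarith
      then show ?thesis
        using eq by (simp add: squeeze_measure_def)
    qed
    then show ?thesis using that(1,2) by blast
  qed
  have pull1: ?thesis
    if "(M, y) \<in> Y" "(M - 1, y + 1) \<notin> Y" "(M - 1, y) \<in> Y" "(M - 1, y + 2) \<in> Y \<longrightarrow> (M, y + 1) \<in> Y" for y
  proof -
    have "\<exists>Y'. reach Y Y' \<and> (\<forall>p\<in>Y'. x0 \<le> fst p \<and> fst p \<le> M) \<and>
      (col M Y' = col M Y - {(M, y)} \<or>
       col M Y' = col M Y \<and> col (M - 1) Y' = insert ((M, y) + (-1, 1)) (col (M - 1) Y))"
      by (rule pull[OF Y dirs_mem(1) _ that(1) _ x0]) (use that right in \<open>simp_all add: rot_vals add.commute\<close>)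
    then obtain Y' where Y': "reach Y Y'" "\<forall>p\<in>Y'. x0 \<le> fst p \<and> fst p \<le> M"
      "col M Y' = col M Y - {(M, y)} \<or>
       col M Y' = col M Y \<and> col (M - 1) Y' = insert ((M, y) + (-1, 1)) (col (M - 1) Y)" by blast
    show ?thesis
      by (rule finish[OF Y'(1,2) that(1) _ _ _ Y'(3)]) (use that in simp_all)
  qed
  have pull2: ?thesis
    if "(M, y) \<in> Y" "(M - 1, y + 1) \<in> Y" "(M - 1, y) \<notin> Y" "(M, y - 1) \<in> Y" for y
  proof -
    have "\<exists>Y'. reach Y Y' \<and> (\<forall>p\<in>Y'. x0 \<le> fst p \<and> fst p \<le> M) \<and>
      (col M Y' = col M Y - {(M, y)} \<or>
       col M Y' = col M Y \<and> col (M - 1) Y' = insert ((M, y) + (-1, 0)) (col (M - 1) Y))"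
      by (rule pull[OF Y dirs_mem(2) _ that(1) _ x0]) (use that right in \<open>simp_all add: rot_vals add.commute\<close>)
    then obtain Y' where Y': "reach Y Y'" "\<forall>p\<in>Y'. x0 \<le> fst p \<and> fst p \<le> M"
      "col M Y' = col M Y - {(M, y)} \<or>
       col M Y' = col M Y \<and> col (M - 1) Y' = insert ((M, y) + (-1, 0)) (col (M - 1) Y)" by blast
    show ?thesis
      by (rule finish[OF Y'(1,2) that(1) _ _ _ Y'(3)]) (use that in simp_all)
  qed
  show ?thesis
  proof (cases "\<exists>y. (M, y) \<in> Y \<and> (M, y + 1) \<in> Y \<and> (M - 1, y + 1) \<notin> Y \<and> (M - 1, y) \<in> Y")
    case True
    then show ?thesis using pull1 by blast
  next
    case nofold: False
    define t where "t = Max (snd ` col M Y)"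
    have "finite (snd ` col M Y)" using fin by (simp add: col_def)
    moreover have "snd ` col M Y \<noteq> {}" using M(1) by simp
    ultimately have "t \<in> snd ` col M Y" and tmax: "\<And>y. y \<in> snd ` col M Y \<Longrightarrow> y \<le> t"
      unfolding t_def using Max_in Max_ge by blast+
    then have t: "(M, t) \<in> Y" by (auto simp: col_def)
    have top: "(M, y) \<notin> Y" if "y > t" for y
      using tmax[of y] that by (force simp: col_def)
    \<comment> \<open>Suppose the top particle does not touch column M - 1. Going down column M, a
      first contact would be a place where a particle can fold, which \<open>nofold\<close>
      excludes. So the connected set Y would lie entirely in column M.\<close>
    have contact: "(M - 1, t + 1) \<in> Y \<or> (M - 1, t) \<in> Y"
    proof (rule ccontr)
      assume no: "\<not> ((M - 1, t + 1) \<in> Y \<or> (M - 1, t) \<in> Y)"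
      let ?R = "{p. fst p = M \<and> snd p \<le> t \<and>
        (\<forall>y. snd p \<le> y \<and> y \<le> t \<longrightarrow> (M, y) \<in> Y \<and> (M - 1, y + 1) \<notin> Y \<and> (M - 1, y) \<notin> Y)}"
      have "Y \<subseteq> ?R"
      proof (rule lconnected_closed)
        show "lconnected Y" using Y(1) by (simp add: conf_def)
        show "(M, t) \<in> Y" by fact
        show "(M, t) \<in> ?R" using t no by auto
        fix u v assume u: "u \<in> ?R" and v: "v \<in> Y" "adj u v"
        obtain y where y: "u = (M, y)" "y \<le> t"
          "\<And>z. y \<le> z \<Longrightarrow> z \<le> t \<Longrightarrow> (M, z) \<in> Y \<and> (M - 1, z + 1) \<notin> Y \<and> (M - 1, z) \<notin> Y"
          using u by (cases u) auto
        from v(2) consider "v = (M + 1, y)" | "v = (M, y + 1)" | "v = (M - 1, y + 1)" | "v = (M - 1, y)"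
          | "v = (M, y - 1)" | "v = (M + 1, y - 1)" unfolding y(1) adj_pair by blast
        then show "v \<in> ?R"
        proof cases
          case 1 then show ?thesis using right v by blast
        next
          case 2
          then have "y + 1 \<le> t" using top[of "y + 1"] v by force
          then show ?thesis using 2 y(3) by simp
        next
          case 3 then show ?thesis using y(3)[of y] y(2) v by simp
        next
          case 4 then show ?thesis using y(3)[of y] y(2) v by simp
        next
          case 5
          have "(M - 1, y - 1) \<notin> Y"
            using nofold y(3)[of y] y(2) v 5 by (metis diff_add_cancel order_refl)
          moreover have "z = y - 1 \<or> y \<le> z" if "y - 1 \<le> z" for z using that by auto
          ultimately have "(M, z) \<in> Y \<and> (M - 1, z + 1) \<notin> Y \<and> (M - 1, z) \<notin> Y"
            if "y - 1 \<le> z" "z \<le> t" for z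
            using that v 5 y(3)[of z] y(3)[of y] y(2) by (metis diff_add_cancel order_refl)
          then show ?thesis using 5 y(2) by simp
        next
          case 6 then show ?thesis using right v by blast
        qed
      qed
      then show False using M(2) by blast
    qed
    show ?thesis
    proof (cases "(M, t - 1) \<in> Y \<and> (M - 1, t) \<notin> Y")
      case True
      then show ?thesis using pull2[of t] t contact by blast
    next
      case C: False
      have slide: ?thesis
        if v: "vpat Y (M, t) (0, 1)" and k: "(M - 1, t + 1) \<in> Y \<or> (M - 1, t + 2) \<in> Y"
      proof -
        let ?Y = "insert (M, t + 1) (Y - {(M, t)})"
        have "vmove Y ?Y"
          using vmoveI[OF t dirs_mem(3) _ v] top[of "t + 1"] by simp
        then have "reach Y ?Y" by simp
        moreover have "\<forall>p\<in>?Y. x0 \<le> fst p \<and> fst p \<le> M" using Y(3) x0 by simp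
        moreover have "(squeeze_measure M ?Y, squeeze_measure M Y) \<in> squeeze_less"
        proof -
          have c1: "col M ?Y = insert (M, t + 1) (col M Y - {(M, t)})" and
            c2: "col (M - 1) ?Y = col (M - 1) Y" by (auto simp: col_def)
          have fc: "finite (col M Y)" "finite (col (M - 1) Y)" using fin by (auto simp: col_def)
          have "(M, t + 1) \<notin> col M Y" "(M, t) \<in> col M Y" using top[of "t + 1"] t by (auto simp: col_def)
          then have "card (col M ?Y) = card (col M Y)"
            unfolding c1 using fc by (simp add: card_Suc_Diff1 del: card_Diff_insert)
          moreover have "card ?Y = card Y" using reach_conf[OF \<open>reach Y ?Y\<close> Y(1)] by blast
          moreover have "Max (snd ` col M ?Y) = t + 1"
          proof (rule Max_eqI)
            show "finite (snd ` col M ?Y)" unfolding c1 using fc by simp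
            show "t + 1 \<in> snd ` col M ?Y" unfolding c1 by force
            show "y \<le> t + 1" if "y \<in> snd ` col M ?Y" for y
              using that tmax unfolding c1 by force
          qed
          \<comment> \<open>The third entry is truncated at 0 by \<open>nat\<close>, so it decreases
            strictly only while the top of column M - 1 is high enough.\<close>
          moreover have "t + 1 \<le> Max (snd ` col (M - 1) Y)"
          proof -
            obtain y where "(M - 1, y) \<in> Y" "t + 1 \<le> y"
              using k by force
            then have "y \<in> snd ` col (M - 1) Y" by (force simp: col_def)
            then have "y \<le> Max (snd ` col (M - 1) Y)" using fc by simp
            then show ?thesis using \<open>t + 1 \<le> y\<close> by simp
          qed
          ultimately show ?thesis
            by (simp add: squeeze_measure_def c2 t_def[symmetric])
        qed
        ultimately show ?thesis by blast
      qed
      have e: "(M, t + 1) \<notin> Y" "(M, t + 2) \<notin> Y" using top by auto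
      \<comment> \<open>With column M + 1 empty, sliding up is a Property 1 move along an occupied
        (M - 1, t + 1), or a Property 2 move past an empty one towards (M - 1, t + 2).\<close>
      have vp: "vpat Y (M, t) (0, 1) \<longleftrightarrow>
        ((M - 1, t + 1) \<in> Y \<and> ((M, t - 1) \<in> Y \<longrightarrow> (M - 1, t) \<in> Y)) \<or>
        ((M - 1, t + 1) \<notin> Y \<and> (M - 1, t + 2) \<in> Y \<and> ((M - 1, t) \<in> Y \<or> (M, t - 1) \<in> Y))"
        unfolding vpat_def Let_def rot_vals using e right by (simp add: algebra_simps) blast
      consider (A) "(M - 1, t + 1) \<in> Y" | (B) "(M - 1, t + 1) \<notin> Y" "(M - 1, t) \<in> Y" "(M - 1, t + 2) \<in> Y"
        | (D) "(M - 1, t + 1) \<notin> Y" "(M - 1, t) \<in> Y" "(M - 1, t + 2) \<notin> Y"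
        using contact by blast
      then show ?thesis
      proof cases
        case A then show ?thesis using slide vp C by blast
      next
        case B then show ?thesis using slide vp by blast
      next
        case D then show ?thesis using pull1[of t] t by blast
      qed
    qed
  qed
qed

text \<open>The inner induction descends along \<open>squeeze_measure\<close> for fixed M. Once
  column M is empty the strip narrows, which is the outer induction.\<close>

lemma reach_column:
  assumes "conf Y" "card Y \<ge> 2" "\<forall>p\<in>Y. x0 \<le> fst p \<and> fst p \<le> M"
  shows "\<exists>Y' c. reach Y Y' \<and> (\<forall>p\<in>Y'. fst p = c)"
  using assms
proof (induction "nat (M - x0)" arbitrary: M Y rule: less_induct)
  case outer: less
  have "wf (inv_image squeeze_less (squeeze_measure M))"
    by (intro wf_inv_image wf_lex_prod wf_less_than)
  then have "conf Y \<longrightarrow> card Y \<ge> 2 \<longrightarrow> (\<forall>p\<in>Y. x0 \<le> fst p \<and> fst p \<le> M) \<longrightarrow>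
    (\<exists>Y' c. reach Y Y' \<and> (\<forall>p\<in>Y'. fst p = c))" for Y
  proof (induction Y rule: wf_induct_rule)
    case (less Y)
    show ?case
    proof (intro impI)
      assume Y: "conf Y" "card Y \<ge> 2" "\<forall>p\<in>Y. x0 \<le> fst p \<and> fst p \<le> M"
      show "\<exists>Y' c. reach Y Y' \<and> (\<forall>p\<in>Y'. fst p = c)"
      proof (cases "col M Y = {}")
        case True
        then have b: "\<forall>p\<in>Y. x0 \<le> fst p \<and> fst p \<le> M - 1"
          using Y(3) by (force simp: col_def)
        obtain p where "p \<in> Y" using Y(2) by (metis all_not_in_conv card.empty not_numeral_le_zero)
        then have "nat (M - 1 - x0) < nat (M - x0)" using b by force
        from outer.hyps[OF this Y(1,2) b] show ?thesis .
      next
        case col: False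
        show ?thesis
        proof (cases "Y \<subseteq> {p. fst p = M}")
          case True
          then show ?thesis by blast
        next
          case False
          from squeeze_step[OF Y col False] obtain Y' where Y': "reach Y Y'"
            "\<forall>p\<in>Y'. x0 \<le> fst p \<and> fst p \<le> M" "(squeeze_measure M Y', squeeze_measure M Y) \<in> squeeze_less"
            by blast
          have "conf Y'" "card Y' = card Y" using reach_conf[OF Y'(1) Y(1)] by blast+
          then have "\<exists>Z c. reach Y' Z \<and> (\<forall>p\<in>Z. fst p = c)"
            using less.IH[of Y'] Y' Y(2) by (simp add: in_inv_image)
          then show ?thesis using Y'(1) by (meson rtranclp_trans)
        qed
      qed
    qed
  qed
  then show ?case using outer.prems by blast
qed

lemma column_segment:
  assumes "conf Y" "card Y = n" "n \<ge> 1" "\<forall>p\<in>Y. fst p = c"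
  shows "\<exists>b. Y = Pair c ` {b..<b + int n}"
proof -
  have fin: "finite Y" using assms by (simp add: conf_def)
  define A where "A = snd ` Y"
  have YA: "Y = Pair c ` A"
    using assms(4) by (force simp: A_def)
  have finA: "finite A" "A \<noteq> {}" using fin assms(2,3) by (auto simp: A_def)
  define b where "b = Min A"
  define t where "t = Max A"
  have bt: "b \<in> A" "t \<in> A" "\<And>y. y \<in> A \<Longrightarrow> b \<le> y" "\<And>y. y \<in> A \<Longrightarrow> y \<le> t"
    using finA by (auto simp: b_def t_def)
  have "A = {b..t}"
  proof (rule ccontr)
    assume "A \<noteq> {b..t}"
    moreover have "A \<subseteq> {b..t}" using bt(3,4) by (simp add: subset_iff)
    ultimately obtain z where "z \<in> {b..t}" "z \<notin> A" by blast
    then have z: "b \<le> z" "z \<le> t" "z \<notin> A" by simp_all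
    have "Y \<subseteq> {p. fst p = c \<and> snd p < z}"
    proof (rule lconnected_closed)
      show "lconnected Y" using assms(1) by (simp add: conf_def)
      show "(c, b) \<in> Y" using bt(1) YA by blast
      show "(c, b) \<in> {p. fst p = c \<and> snd p < z}" using z(1,3) bt(1) by (cases "b = z") simp_all
      fix u v assume u: "u \<in> {p. fst p = c \<and> snd p < z}" and v: "v \<in> Y" "adj u v"
      obtain y where y: "u = (c, y)" "y < z" using u by (cases u) auto
      have "v = (c, y + 1) \<or> v = (c, y - 1)"
        using v assms(4) unfolding y(1) adj_pair by force
      moreover have "(c, z) \<notin> Y" using z YA by blast
      ultimately show "v \<in> {p. fst p = c \<and> snd p < z}"
        using v(1) y(2) by (cases "y + 1 = z") auto
    qed
    moreover have "(c, t) \<in> Y" using bt(2) YA by blast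
    ultimately have "t < z" by auto
    then show False using z(2) by simp
  qed
  moreover have "card A = n"
    using assms(2) unfolding YA by (simp add: card_image inj_on_def)
  ultimately have "t = b + int n - 1" using assms(3) by auto
  then have "A = {b..<b + int n}" using \<open>A = {b..t}\<close> by auto
  then show ?thesis using YA by blast
qed

section \<open>Translations\<close>

lemma mem_shift [simp]: "x \<in> shift v S \<longleftrightarrow> x - v \<in> S"
  by (auto simp: shift_def intro: image_eqI[where x = "x - v"])

lemma shift_shift: "shift u (shift v S) = shift (u + v) S"
  by (simp add: set_eq_iff diff_diff_eq del: split_paired_All)

lemma shift_0 [simp]: "shift 0 S = S"
  by (simp add: set_eq_iff del: split_paired_All)

lemma shift_image: "shift v S = (+) v ` S"
  by (auto simp: shift_def)

lemma card_shift [simp]: "card (shift v S) = card S"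
  unfolding shift_image by (simp add: card_image)

lemma finite_shift [simp]: "finite (shift v S) \<longleftrightarrow> finite S"
  unfolding shift_image by (simp add: finite_image_iff)

lemma shift_Compl: "- shift v S = shift v (- S)"
  by (simp add: set_eq_iff del: split_paired_All)

lemma adj_shift [simp]: "adj (v + x) (v + y) \<longleftrightarrow> adj x y"
  by (simp add: adj_iff)

lemma cls_shift [simp]: "cls (shift v S) = cls S"
proof -
  have "shift u S = shift (u - v) (shift v S)" for u by (simp add: shift_shift)
  then have "cls S \<subseteq> cls (shift v S)" unfolding cls_def by blast
  moreover have "cls (shift v S) \<subseteq> cls S"
    unfolding cls_def shift_shift by blast
  ultimately show ?thesis by blast
qed

lemma cls_self: "S \<in> cls S"
  unfolding cls_def by (metis rangeI shift_0)

lemma cls_eq_iff: "cls S = cls S' \<longleftrightarrow> (\<exists>v. S = shift v S')"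
  by (metis cls_self cls_shift cls_def imageE)

lemma rep_cls: "\<exists>v. rep (cls S) = shift v S"
proof -
  have "rep (cls S) \<in> cls S" unfolding rep_def using cls_self by (rule someI)
  then show ?thesis by (auto simp: cls_def)
qed

text \<open>Translation by v changes the sum of all sites by \<open>card S\<close> times v.\<close>

lemma shift_eq_self:
  assumes "finite S" "S \<noteq> {}" "shift v S = S"
  shows "v = 0"
proof -
  have "(\<Sum>x\<in>S. x) = (\<Sum>x\<in>shift v S. x)" using assms by simp
  also have "\<dots> = (\<Sum>x\<in>S. v + x)" unfolding shift_image by (simp add: sum.reindex)
  also have "\<dots> = (\<Sum>x\<in>S. v) + (\<Sum>x\<in>S. x)" by (rule sum.distrib)
  finally have "(\<Sum>x\<in>S. v) = 0" by simp
  then have "fst (\<Sum>x\<in>S. v) = 0" "snd (\<Sum>x\<in>S. v) = 0" by simp_all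
  then have "(\<Sum>x\<in>S. fst v) = 0" "(\<Sum>x\<in>S. snd v) = 0"
    unfolding fst_sum snd_sum .
  then show ?thesis using assms by (simp add: prod_eq_iff)
qed

lemma conn_shift: "(x, y) \<in> (induced_rel U)\<^sup>* \<Longrightarrow> (v + x, v + y) \<in> (induced_rel (shift v U))\<^sup>*"
  by (rule conn_map[where f = "(+) v"]) (auto intro!: conn_edge)

lemma conn_shift_iff: "(v + x, v + y) \<in> (induced_rel (shift v U))\<^sup>* \<longleftrightarrow> (x, y) \<in> (induced_rel U)\<^sup>*"
  using conn_shift[of x y U v] conn_shift[of "v + x" "v + y" "shift v U" "- v"]
  by (auto simp: shift_shift)

lemma lconnected_shift [simp]: "lconnected (shift v U) \<longleftrightarrow> lconnected U"
  by (simp add: lconnected_def shift_image conn_shift_iff[unfolded shift_image])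

lemma comp_shift: "comp (shift v U) (v + x) = shift v (comp U x)"
proof -
  have "(v + x, y) \<in> (induced_rel (shift v U))\<^sup>* \<longleftrightarrow> (x, y - v) \<in> (induced_rel U)\<^sup>*" for y
    using conn_shift_iff[of v x "y - v" U] by simp
  then show ?thesis by (simp add: comp_def set_eq_iff del: split_paired_All)
qed

lemma no_holes_shift [simp]: "no_holes (shift v S) \<longleftrightarrow> no_holes S"
proof -
  have "no_holes S \<Longrightarrow> no_holes (shift v S)" for v S
  proof -
    assume S: "no_holes S"
    show "no_holes (shift v S)"
      unfolding no_holes_iff
    proof (intro allI impI)
      fix x assume "x \<notin> shift v S"
      then have "infinite (comp (- S) (x - v))"
        using S[unfolded no_holes_iff, rule_format, of "x - v"] by simp
      then show "infinite (comp (- shift v S) x)"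
        using comp_shift[of v "- S" "x - v"] by (simp add: shift_Compl)
    qed
  qed
  from this[of S v] this[of "shift v S" "- v"] show ?thesis by (auto simp: shift_shift)
qed

lemma conf_shift [simp]: "conf (shift v S) \<longleftrightarrow> conf S"
  by (simp add: conf_def)

lemma Nb_shift: "Nb (shift v S) (v + l) = shift v (Nb S l)"
proof -
  have "adj (v + l) x \<longleftrightarrow> adj l (x - v)" for x
    by (simp add: adj_iff algebra_simps)
  then show ?thesis by (simp add: Nb_def set_eq_iff del: split_paired_All)
qed

lemma shift_Int: "shift v A \<inter> shift v B = shift v (A \<inter> B)"
  and shift_Un: "shift v A \<union> shift v B = shift v (A \<union> B)"
  and shift_Diff: "shift v A - shift v B = shift v (A - B)"
  and shift_sing: "{v + x} = shift v {x}"
  and shift_pair: "{v + x, v + y} = shift v {x, y}"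
  by (auto simp: shift_image)

lemma prop1_shift [simp]: "prop1 (shift v S) (v + l) (v + l') \<longleftrightarrow> prop1 S l l'"
  unfolding prop1_def Let_def Nb_shift shift_Int shift_Un shift_Diff shift_pair card_shift
  by (simp add: shift_image conn_shift_iff[unfolded shift_image])

lemma shift_empty [simp]: "shift v A = {} \<longleftrightarrow> A = {}"
  by (simp add: shift_image)

lemma prop2_shift [simp]: "prop2 (shift v S) (v + l) (v + l') \<longleftrightarrow> prop2 S l l'"
  unfolding prop2_def Nb_shift shift_Int shift_Un shift_Diff shift_sing card_shift by simp

lemma tri_shift [simp]: "tri (shift v S) (v + l) = tri S l"
proof -
  have "v + l + x - v = l + x" for x by simp
  then show ?thesis by (simp add: tri_def)
qed

lemma move_shift: "move (shift v S) (v + l) (v + l') = shift v (move S l l')"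
  by (auto simp: move_def shift_image)

lemma acc_shift [simp]: "acc lam (shift v S) (v + l) (v + l') = acc lam S l l'"
  unfolding acc_def prop1_shift prop2_shift move_shift tri_shift Nb_shift card_shift by simp

section \<open>The number of triangles\<close>

text \<open>One term for each orientation of the faces. Every face is counted at a fixed corner, so
  there is no overcounting by 3, and a site accounts for at most two faces.\<close>

definition triangles :: "loc set \<Rightarrow> nat" where
  "triangles S = card {u \<in> S. u + (1,0) \<in> S \<and> u + (0,1) \<in> S} +
                 card {u \<in> S. u + (0,1) \<in> S \<and> u + (-1,1) \<in> S}"

lemma triangles_shift [simp]: "triangles (shift v S) = triangles S"
proof -
  have "{u \<in> shift v S. u + d \<in> shift v S \<and> u + e \<in> shift v S} = shift v {u \<in> S. u + d \<in> S \<and> u + e \<in> S}"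
    for d e
    by (simp add: set_eq_iff algebra_simps del: split_paired_All)
  then show ?thesis by (simp add: triangles_def)
qed

lemma triangles_le: "finite S \<Longrightarrow> triangles S \<le> 2 * card S"
  unfolding triangles_def mult_2 by (intro add_mono card_mono) auto

lemma dirs_nth:
  "dirs ! 0 = (1,0)" "dirs ! Suc 0 = (0,1)" "dirs ! 2 = (-1,1)" "dirs ! 3 = (-1,0)"
  "dirs ! 4 = (0,-1)" "dirs ! 5 = (1,-1)" "dirs ! Suc (Suc 0) = (-1,1)"
  by (simp_all add: dirs_def)

lemma lessThan_6: "{..<6::nat} = {0, 1, 2, 3, 4, 5}"
  by auto

lemma tri_eq:
  "tri S l = of_bool (l + (1,0) \<in> S \<and> l + (0,1) \<in> S) + of_bool (l + (0,1) \<in> S \<and> l + (-1,1) \<in> S) +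
    of_bool (l + (-1,1) \<in> S \<and> l + (-1,0) \<in> S) + of_bool (l + (-1,0) \<in> S \<and> l + (0,-1) \<in> S) +
    of_bool (l + (0,-1) \<in> S \<and> l + (1,-1) \<in> S) + of_bool (l + (1,-1) \<in> S \<and> l + (1,0) \<in> S)"
proof -
  have "tri S l = (\<Sum>i<(6::nat). of_bool (l + dirs ! i \<in> S \<and> l + dirs ! ((i + 1) mod 6) \<in> S))"
    by (simp add: tri_def sum_of_bool_eq Int_def)
  then show ?thesis
    unfolding lessThan_6 by (simp add: dirs_nth del: of_bool_conj sum_of_bool_eq)
qed

lemma card_insert3:
  assumes "finite A" "x \<notin> A" "y \<notin> A" "z \<notin> A" "x \<noteq> y" "x \<noteq> z" "y \<noteq> z"
  shows "card {u. u \<in> A \<or> u = x \<and> P \<or> u = y \<and> Q \<or> u = z \<and> R} = card A + of_bool P + of_bool Q + of_bool R"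
proof -
  have "{u. u \<in> A \<or> u = x \<and> P \<or> u = y \<and> Q \<or> u = z \<and> R} =
    A \<union> (if P then {x} else {}) \<union> (if Q then {y} else {}) \<union> (if R then {z} else {})" by auto
  then show ?thesis using assms by (cases P; cases Q; cases R) simp_all
qed

text \<open>Of the six faces at l, three have either orientation. In each group l is the reference
  corner of one face, and a neighbour of l is that of each of the other two; these are the three
  possible new elements passed to \<open>card_insert3\<close>.\<close>

lemma triangles_insert:
  assumes "finite S" "l \<notin> S"
  shows "triangles (insert l S) = triangles S + tri S l"
proof -
  obtain x y where l: "l = (x, y)" by (cases l)
  have 1: "{u \<in> insert l S. u + (1,0) \<in> insert l S \<and> u + (0,1) \<in> insert l S} =
    {u. u \<in> {u \<in> S. u + (1,0) \<in> S \<and> u + (0,1) \<in> S} \<or>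
      u = l \<and> (l + (1,0) \<in> S \<and> l + (0,1) \<in> S) \<or>
      u = l + (-1,0) \<and> (l + (-1,0) \<in> S \<and> l + (-1,1) \<in> S) \<or>
      u = l + (0,-1) \<and> (l + (0,-1) \<in> S \<and> l + (1,-1) \<in> S)}"
    using assms(2) unfolding l by (auto simp: algebra_simps)
  have 2: "{u \<in> insert l S. u + (0,1) \<in> insert l S \<and> u + (-1,1) \<in> insert l S} =
    {u. u \<in> {u \<in> S. u + (0,1) \<in> S \<and> u + (-1,1) \<in> S} \<or>
      u = l \<and> (l + (0,1) \<in> S \<and> l + (-1,1) \<in> S) \<or>
      u = l + (0,-1) \<and> (l + (0,-1) \<in> S \<and> l + (-1,0) \<in> S) \<or>
      u = l + (1,-1) \<and> (l + (1,-1) \<in> S \<and> l + (1,0) \<in> S)}"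
    using assms(2) unfolding l by (auto simp: algebra_simps)
  have "card {u \<in> insert l S. u + (1,0) \<in> insert l S \<and> u + (0,1) \<in> insert l S} =
    card {u \<in> S. u + (1,0) \<in> S \<and> u + (0,1) \<in> S} +
      of_bool (l + (1,0) \<in> S \<and> l + (0,1) \<in> S) + of_bool (l + (-1,0) \<in> S \<and> l + (-1,1) \<in> S) +
      of_bool (l + (0,-1) \<in> S \<and> l + (1,-1) \<in> S)"
    unfolding 1 by (rule card_insert3) (use assms l in auto)
  moreover have "card {u \<in> insert l S. u + (0,1) \<in> insert l S \<and> u + (-1,1) \<in> insert l S} =
    card {u \<in> S. u + (0,1) \<in> S \<and> u + (-1,1) \<in> S} +
      of_bool (l + (0,1) \<in> S \<and> l + (-1,1) \<in> S) + of_bool (l + (0,-1) \<in> S \<and> l + (-1,0) \<in> S) +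
      of_bool (l + (1,-1) \<in> S \<and> l + (1,0) \<in> S)"
    unfolding 2 by (rule card_insert3) (use assms l in auto)
  ultimately show ?thesis
    unfolding triangles_def tri_eq by (simp add: conj_commute)
qed

section \<open>Reversibility\<close>

lemma empty_nbr:
  assumes "no_holes S" "l \<notin> S"
  obtains y where "adj l y" "y \<notin> S"
proof -
  have "\<exists>y. adj l y \<and> y \<notin> S"
  proof (rule ccontr)
    assume no: "\<not> (\<exists>y. adj l y \<and> y \<notin> S)"
    have "y = l" if "(l, y) \<in> (induced_rel (- S))\<^sup>*" for y
      using that by (induction rule: rtrancl_induct) (use no in \<open>auto simp: induced_rel_def\<close>)
    then have "comp (- S) l \<subseteq> {l}" by (auto simp: comp_def)
    then have "finite (comp (- S) l)" by (rule finite_subset) simp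
    then show False using assms(1)[unfolded no_holes_iff, rule_format, OF assms(2)] by simp
  qed
  then show ?thesis using that by blast
qed

text \<open>Condition (1) of the chain tests only the site that is left, which endangers the
  symmetry of the acceptance rule. Between hole-free configurations it holds automatically: the
  vacated l must have an empty neighbour, and this is not l'.\<close>

lemma not_five_nbrs:
  assumes "no_holes (move S l l')" "l \<in> S" "l' \<notin> S" "adj l l'"
  shows "card (Nb S l) \<noteq> 5"
proof -
  have "l \<notin> move S l l'" using assms by (auto simp: move_def)
  then obtain y where y: "adj l y" "y \<notin> move S l l'" using empty_nbr assms(1) by blast
  have "y \<noteq> l" "y \<noteq> l'" using y by (auto simp: move_def)
  then have yS: "y \<notin> S" using y by (auto simp: move_def)
  let ?N = "(+) l ` set dirs"
  have N: "?N = {x. adj l x}"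
    by (auto simp: adj_iff intro: image_eqI[where x = "x - l" for x])
  have "card ?N = 6" by (subst card_image) (simp_all add: dirs_def)
  moreover have "y \<in> ?N" "l' \<in> ?N" using y assms(4) unfolding N by auto
  ultimately have "card (?N - {y} - {l'}) = 4" using \<open>y \<noteq> l'\<close> by simp
  moreover have "Nb S l \<subseteq> ?N - {y} - {l'}"
    using yS assms(3) unfolding N by (auto simp: Nb_def)
  ultimately have "card (Nb S l) \<le> 4" by (metis card_mono finite_Diff finite_imageI finite_set)
  then show ?thesis by simp
qed

lemma move_move: "l \<in> S \<Longrightarrow> l' \<notin> S \<Longrightarrow> move (move S l l') l' l = S"
  by (auto simp: move_def)

lemma Nb_move:
  assumes "l \<in> S" "l' \<notin> S"
  shows "Nb (move S l l') l' - {l} = Nb S l' - {l}"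
    and "Nb (move S l l') l - {l'} = Nb S l - {l'}"
  using assms adj_irrefl by (auto simp: Nb_def move_def)

lemma prop_move:
  assumes "l \<in> S" "l' \<notin> S"
  shows "prop1 (move S l l') l' l \<longleftrightarrow> prop1 S l l'" "prop2 (move S l l') l' l \<longleftrightarrow> prop2 S l l'"
proof -
  have 1: "Nb (move S l l') l' \<inter> Nb (move S l l') l = Nb S l \<inter> Nb S l'"
    using assms by (auto simp: Nb_def move_def)
  have 2: "(Nb (move S l l') l' \<union> Nb (move S l l') l) - {l', l} = (Nb S l \<union> Nb S l') - {l, l'}"
    using assms by (auto simp: Nb_def move_def)
  show "prop1 (move S l l') l' l \<longleftrightarrow> prop1 S l l'"
    unfolding prop1_def Let_def 1 2 ..
  show "prop2 (move S l l') l' l \<longleftrightarrow> prop2 S l l'"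
    unfolding prop2_def Let_def 1 Nb_move[OF assms] by blast
qed

lemma tri_Diff: "tri (S - {l}) l = tri S l" "tri (insert l S) l = tri S l"
  by (cases l; simp add: tri_eq)+

lemma triangles_remove: "finite S \<Longrightarrow> l \<in> S \<Longrightarrow> triangles S = triangles (S - {l}) + tri S l"
  using triangles_insert[of "S - {l}" l] by (simp add: insert_absorb tri_Diff)

text \<open>The Metropolis rule: if the move is allowed, both sides equal lam to the number of
  triangles avoiding the moving particle, times the minimum of lam^t and lam^t'. The conditions
  themselves are symmetric by \<open>prop_move\<close> and \<open>not_five_nbrs\<close>.\<close>

lemma acc_balance:
  fixes lam :: real
  assumes lam: "lam > 0" and S: "conf S" "conf (move S l l')" "l \<in> S" "l' \<notin> S" "adj l l'"
  shows "lam ^ triangles S * acc lam S l l' =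
    lam ^ triangles (move S l l') * acc lam (move S l l') l' l"
proof -
  let ?S = "move S l l'"
  have "l \<noteq> l'" using S by auto
  then have l: "l' \<in> ?S" "l \<notin> ?S" by (auto simp: move_def)
  have nh: "no_holes S" "no_holes ?S" "finite S" using S by (auto simp: conf_def)
  have five: "card (Nb S l) \<noteq> 5" "card (Nb ?S l') \<noteq> 5"
    using not_five_nbrs[of S l l'] not_five_nbrs[of ?S l' l] nh S l move_move[OF S(3,4)] adj_sym
    by simp_all
  let ?T = "triangles (S - {l})" and ?t = "tri S l" and ?t' = "tri ?S l'"
  have T: "triangles S = ?T + ?t" using triangles_remove nh S by blast
  have T': "triangles ?S = ?T + ?t'"
    using S triangles_insert[of "S - {l}" l'] nh by (simp add: move_def tri_Diff)
  have "lam ^ ?t * min 1 (lam powr (real ?t' - real ?t)) = min (lam ^ ?t) (lam ^ ?t')"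
    using lam by (simp add: min_mult_distrib_left powr_diff powr_realpow)
  moreover have "lam ^ ?t' * min 1 (lam powr (real ?t - real ?t')) = min (lam ^ ?t') (lam ^ ?t)"
    using lam by (simp add: min_mult_distrib_left powr_diff powr_realpow)
  ultimately show ?thesis
    unfolding T T' acc_def prop_move[OF S(3,4)] move_move[OF S(3,4)]
    using five S l by (simp add: power_add mult.assoc min.commute)
qed

lemma acc_bounds: "lam > 0 \<Longrightarrow> 0 \<le> acc lam S l l' \<and> acc lam S l l' \<le> 1"
  by (simp add: acc_def)

section \<open>Detailed balance between translation classes\<close>

definition flow :: "real \<Rightarrow> loc set \<Rightarrow> loc set set \<Rightarrow> real" where
  "flow lam S C' = (\<Sum>l\<in>S. \<Sum>i<(6::nat). acc lam S l (l + dirs ! i) *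
     (if cls (move S l (l + dirs ! i)) = C' then 1 else 0))"

lemma flow_shift [simp]: "flow lam (shift v S) C' = flow lam S C'"
proof -
  have "flow lam (shift v S) C' = (\<Sum>l\<in>S. \<Sum>i<(6::nat). acc lam (shift v S) (v + l + dirs ! i - dirs ! i) (v + l + dirs ! i) *
     (if cls (move (shift v S) (v + l) (v + l + dirs ! i)) = C' then 1 else 0))"
    unfolding flow_def shift_image by (simp add: sum.reindex)
  also have "\<dots> = flow lam S C'"
    unfolding flow_def by (simp add: add.assoc move_shift)
  finally show ?thesis .
qed

lemma trans_prob_flow:
  assumes "C' \<noteq> cls S"
  shows "trans_prob lam (cls S) C' = flow lam S C' / (6 * real (card S))"
proof -
  obtain v where v: "rep (cls S) = shift v S" using rep_cls by blast
  have "trans_prob lam (cls S) C' = flow lam (shift v S) C' / (6 * real (card S))"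
    using assms unfolding trans_prob_def v Let_def flow_def
    by (simp add: sum_divide_distrib)
  then show ?thesis by simp
qed

definition off :: "loc set \<Rightarrow> loc set \<Rightarrow> loc" where
  "off X Y = (THE v. X = shift v Y)"

lemma off_shift:
  assumes "finite Y" "Y \<noteq> {}"
  shows "off (shift v Y) Y = v"
  unfolding off_def
proof (rule the_equality)
  fix u assume "shift v Y = shift u Y"
  then have "shift (- u) (shift v Y) = shift (- u) (shift u Y)" by simp
  then have "shift (- u + v) Y = Y" unfolding shift_shift by simp
  then have "- u + v = 0" using shift_eq_self assms by blast
  then show "u = v" by (metis add.inverse_inverse neg_eq_iff_add_eq_0)
qed simp

definition Mv :: "loc set \<Rightarrow> loc set set \<Rightarrow> (loc \<times> nat) set" where
  "Mv S C' = {(l, i). l \<in> S \<and> i < 6 \<and> l + dirs ! i \<notin> S \<and> cls (move S l (l + dirs ! i)) = C'}"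

text \<open>The reversed move, carried back to the representative S' by the translation
  \<open>off\<close>; index i + 3 is the opposite direction. It is a bijection between the moves
  from S into the class of S' and those from S' into the class of S, so balance of single moves adds
  up to balance of transitions.\<close>

definition rev_step :: "loc set \<Rightarrow> loc set \<Rightarrow> loc \<times> nat \<Rightarrow> loc \<times> nat" where
  "rev_step S S' = (\<lambda>(l, i). (l + dirs ! i - off (move S l (l + dirs ! i)) S', (i + 3) mod 6))"

lemma dirs_opposite: "i < 6 \<Longrightarrow> dirs ! ((i + 3) mod 6) = - dirs ! i"
proof -
  assume "i < 6"
  then have "i \<in> {0, 1, 2, 3, 4, 5}" by auto
  then show ?thesis by (auto simp: dirs_def)
qed

lemma dirs_nth_mem: "i < 6 \<Longrightarrow> dirs ! i \<in> set dirs"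
  by (rule nth_mem) (simp add: dirs_def)

lemma flow_Mv:
  assumes "finite S"
  shows "flow lam S C' = (\<Sum>(l, i)\<in>Mv S C'. acc lam S l (l + dirs ! i))"
proof -
  have "flow lam S C' = (\<Sum>(l, i)\<in>S \<times> {..<6}. acc lam S l (l + dirs ! i) *
     (if cls (move S l (l + dirs ! i)) = C' then 1 else 0))"
    unfolding flow_def by (simp add: sum.cartesian_product)
  also have "\<dots> = (\<Sum>(l, i)\<in>Mv S C'. acc lam S l (l + dirs ! i))"
  proof (rule sum.mono_neutral_cong_right)
    show "finite (S \<times> {..<6::nat})" using assms by simp
    show "Mv S C' \<subseteq> S \<times> {..<6}" by (auto simp: Mv_def)
    show "\<forall>a\<in>S \<times> {..<6} - Mv S C'. (case a of (l, i) \<Rightarrow> acc lam S l (l + dirs ! i) *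
     (if cls (move S l (l + dirs ! i)) = C' then 1 else 0)) = 0"
    proof
      fix a assume a: "a \<in> S \<times> {..<6} - Mv S C'"
      obtain l i where "a = (l, i)" by (cases a)
      with a have "l + dirs ! i \<in> S \<or> cls (move S l (l + dirs ! i)) \<noteq> C'" by (simp add: Mv_def)
      then show "(case a of (l, i) \<Rightarrow> acc lam S l (l + dirs ! i) *
     (if cls (move S l (l + dirs ! i)) = C' then 1 else 0)) = 0"
        using \<open>a = (l, i)\<close> by (elim disjE) (simp_all add: acc_def)
    qed
    fix a assume a: "a \<in> Mv S C'"
    obtain l i where "a = (l, i)" by (cases a)
    with a have "cls (move S l (l + dirs ! i)) = C'" by (simp add: Mv_def)
    then show "(case a of (l, i) \<Rightarrow> acc lam S l (l + dirs ! i) *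
     (if cls (move S l (l + dirs ! i)) = C' then 1 else 0)) = (case a of (l, i) \<Rightarrow> acc lam S l (l + dirs ! i))"
      using \<open>a = (l, i)\<close> by simp
  qed
  finally show ?thesis .
qed

lemma rev_step_props:
  fixes lam :: real
  assumes "lam > 0" and S: "conf S" "S \<noteq> {}" and S': "conf S'" "S' \<noteq> {}" and a: "a \<in> Mv S (cls S')"
  shows "rev_step S S' a \<in> Mv S' (cls S)" "rev_step S' S (rev_step S S' a) = a"
    "lam ^ triangles S * (case a of (l, i) \<Rightarrow> acc lam S l (l + dirs ! i)) =
     lam ^ triangles S' * (case rev_step S S' a of (l, i) \<Rightarrow> acc lam S' l (l + dirs ! i))"
proof -
  obtain l i where ali: "a = (l, i)" by (cases a)
  define l' where "l' = l + dirs ! i"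
  have li: "l \<in> S" "i < 6" "l' \<notin> S" "cls (move S l l') = cls S'"
    using a by (auto simp: Mv_def ali l'_def)
  have adj: "adj l l'" using dirs_nth_mem[OF li(2)] by (simp add: adj_iff l'_def)
  then have "l \<noteq> l'" by auto
  obtain v where v: "move S l l' = shift v S'" using li(4) cls_eq_iff by blast
  have fin: "finite S" "finite S'" using S S' by (auto simp: conf_def)
  have off: "off (move S l l') S' = v" unfolding v using off_shift fin(2) S'(2) by blast
  define m where "m = l' - v"
  have b: "rev_step S S' a = (m, (i + 3) mod 6)"
    by (simp add: rev_step_def ali off l'_def[symmetric] m_def)
  have mm: "m + dirs ! ((i + 3) mod 6) = l - v"
    by (simp add: dirs_opposite[OF li(2)] m_def l'_def)
  have "l' \<in> move S l l'" "l \<notin> move S l l'" using \<open>l \<noteq> l'\<close> by (auto simp: move_def)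
  then have mS: "m \<in> S'" "l - v \<notin> S'" unfolding v m_def by simp_all
  have "shift v (move S' m (l - v)) = move (shift v S') l' l"
    using move_shift[of v S' m "l - v"] by (simp add: m_def)
  also have "\<dots> = S" unfolding v[symmetric] using move_move li by blast
  finally have "shift (- v) (shift v (move S' m (l - v))) = shift (- v) S" by simp
  then have mv: "move S' m (l - v) = shift (- v) S" unfolding shift_shift by simp
  show 1: "rev_step S S' a \<in> Mv S' (cls S)"
    using mS mv by (simp add: b Mv_def mm)
  have "off (move S' m (l - v)) S = - v" unfolding mv using off_shift fin(1) S(2) by blast
  moreover have "((i + 3) mod 6 + 3) mod 6 = i" using li(2) by presburger
  ultimately show "rev_step S' S (rev_step S S' a) = a"
    unfolding b rev_step_def[of S' S] prod.case mm by (simp add: ali)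
  have "conf (move S l l')" unfolding v using S' by simp
  from acc_balance[OF assms(1) S(1) this li(1,3) adj]
  have "lam ^ triangles S * acc lam S l l' = lam ^ triangles S' * acc lam (shift v S') l' l"
    unfolding v by simp
  also have "acc lam (shift v S') l' l = acc lam S' m (l - v)"
    using acc_shift[of lam v S' m "l - v"] by (simp add: m_def)
  finally show "lam ^ triangles S * (case a of (l, i) \<Rightarrow> acc lam S l (l + dirs ! i)) =
     lam ^ triangles S' * (case rev_step S S' a of (l, i) \<Rightarrow> acc lam S' l (l + dirs ! i))"
    unfolding b prod.case mm by (simp add: ali l'_def[symmetric])
qed

lemma flow_balance:
  fixes lam :: real
  assumes "lam > 0" and S: "conf S" "S \<noteq> {}" and S': "conf S'" "S' \<noteq> {}"
  shows "lam ^ triangles S * flow lam S (cls S') = lam ^ triangles S' * flow lam S' (cls S)"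
proof -
  have fin: "finite S" "finite S'" using S S' by (auto simp: conf_def)
  have "lam ^ triangles S * flow lam S (cls S') =
    (\<Sum>a\<in>Mv S (cls S'). lam ^ triangles S * (case a of (l, i) \<Rightarrow> acc lam S l (l + dirs ! i)))"
    by (simp add: flow_Mv[OF fin(1)] sum_distrib_left)
  also have "\<dots> = (\<Sum>a\<in>Mv S' (cls S). lam ^ triangles S' * (case a of (l, i) \<Rightarrow> acc lam S' l (l + dirs ! i)))"
    by (rule sum.reindex_bij_witness[of _ "rev_step S' S" "rev_step S S'"])
      (use rev_step_props[OF assms] rev_step_props[OF assms(1) S' S] in simp_all)
  also have "\<dots> = lam ^ triangles S' * flow lam S' (cls S)"
    by (simp add: flow_Mv[OF fin(2)] sum_distrib_left)
  finally show ?thesis .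
qed

definition weight :: "real \<Rightarrow> loc set set \<Rightarrow> real" where
  "weight lam C = lam ^ triangles (rep C)"

lemma weight_cls [simp]: "weight lam (cls S) = lam ^ triangles S"
  using rep_cls[of S] by (auto simp: weight_def)

lemma trans_prob_balance:
  fixes lam :: real
  assumes "lam > 0" "C \<in> Omega n" "C' \<in> Omega n" "n \<ge> 1"
  shows "weight lam C * trans_prob lam C C' = weight lam C' * trans_prob lam C' C"
proof (cases "C = C'")
  case False
  obtain S S' where S: "C = cls S" "conf S" "card S = n" and S': "C' = cls S'" "conf S'" "card S' = n"
    using assms(2,3) unfolding Omega_conf by blast
  have ne: "S \<noteq> {}" "S' \<noteq> {}" using S S' assms(4) by auto
  have C: "cls S' \<noteq> cls S" "cls S \<noteq> cls S'" using False S S' by auto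
  show ?thesis
    using flow_balance[OF assms(1) S(2) ne(1) S'(2) ne(2)]
    unfolding S(1) S'(1) trans_prob_flow[OF C(1)] trans_prob_flow[OF C(2)] S(3) S'(3) by simp
qed simp

lemma trans_prob_nonneg: "lam > 0 \<Longrightarrow> 0 \<le> trans_prob lam C C'"
  unfolding trans_prob_def Let_def using acc_bounds[of lam]
  by (intro sum_nonneg mult_nonneg_nonneg add_nonneg_nonneg) auto

text \<open>An upper bound is enough for the maximum principle below, where the maximum is
  nonnegative; mass may thus leave A.\<close>

lemma trans_prob_sum:
  assumes "lam > 0" "finite A"
  shows "(\<Sum>C'\<in>A. trans_prob lam C C') \<le> 1"
proof -
  let ?S = "rep C"
  let ?p = "\<lambda>l i C'. acc lam ?S l (padd l (dirs ! i)) * (if cls (move ?S l (padd l (dirs ! i))) = C' then 1 else 0)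
         + (1 - acc lam ?S l (padd l (dirs ! i))) * (if C' = C then 1 else 0)"
  have p: "(\<Sum>C'\<in>A. ?p l i C') \<le> 1" for l i
  proof -
    let ?a = "acc lam ?S l (padd l (dirs ! i))"
    have "(\<Sum>C'\<in>A. ?p l i C') = ?a * (\<Sum>C'\<in>A. if cls (move ?S l (padd l (dirs ! i))) = C' then 1 else 0)
        + (1 - ?a) * (\<Sum>C'\<in>A. if C' = C then 1 else 0)"
      by (simp add: sum.distrib sum_distrib_left)
    also have "\<dots> \<le> ?a * 1 + (1 - ?a) * 1"
      using acc_bounds[OF assms(1), of ?S l "padd l (dirs ! i)"] assms(2)
      by (intro add_mono mult_left_mono) (simp_all add: sum.delta sum.delta')
    finally show ?thesis by simp
  qed
  have "(\<Sum>C'\<in>A. trans_prob lam C C') = (\<Sum>l\<in>?S. \<Sum>i<(6::nat). \<Sum>C'\<in>A. 1 / (6 * real (card ?S)) * ?p l i C')"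
    unfolding trans_prob_def Let_def
    by (subst sum.swap, intro sum.cong refl, subst sum.swap, rule refl)
  also have "\<dots> = (\<Sum>l\<in>?S. \<Sum>i<(6::nat). 1 / (6 * real (card ?S)) * (\<Sum>C'\<in>A. ?p l i C'))"
    by (simp only: sum_distrib_left)
  also have "\<dots> \<le> (\<Sum>l\<in>?S. \<Sum>i<(6::nat). 1 / (6 * real (card ?S)) * 1)"
    by (intro sum_mono mult_left_mono p) simp
  also have "\<dots> \<le> 1" by (cases "card ?S = 0") simp_all
  finally show ?thesis .
qed

lemma trans_prob_vmove:
  assumes "lam > 0" "vmove S S'" "conf S" and neq: "cls S' \<noteq> cls S"
  shows "trans_prob lam (cls S) (cls S') > 0"
proof -
  obtain l d where ld: "l \<in> S" "d \<in> set dirs" "l + d \<notin> S" "vpat S l d" "S' = move S l (l + d)"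
    using assms(2) by (auto simp: vmove_def)
  have "length dirs = 6" by (simp add: dirs_def)
  then obtain i where i: "i < 6" "d = dirs ! i" using ld(2) by (metis in_set_conv_nth)
  have fin: "finite S" using assms(3) by (simp add: conf_def)
  have "acc lam S l (l + d) > 0"
    using vpat_prop[OF ld(2,3,4)] vpat_card[OF ld(2,3,4)] ld(3) assms(1) by (simp add: acc_def)
  moreover have "acc lam S l (l + d) \<le> flow lam S (cls S')"
  proof -
    have "(l, i) \<in> Mv S (cls S')" using ld i by (auto simp: Mv_def)
    moreover have "finite (Mv S (cls S'))"
      by (rule finite_subset[of _ "S \<times> {..<6}"]) (use fin in \<open>auto simp: Mv_def\<close>)
    ultimately show ?thesis
      using member_le_sum[of "(l, i)" "Mv S (cls S')" "\<lambda>(l, i). acc lam S l (l + dirs ! i)"]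
        acc_bounds[OF assms(1)]
      unfolding flow_Mv[OF fin] i(2) by fastforce
  qed
  moreover have "card S > 0" using ld(1) fin card_gt_0_iff by blast
  ultimately show ?thesis unfolding trans_prob_flow[OF neq] by simp
qed

section \<open>The stationary distribution\<close>

text \<open>By balance a transition is positive exactly if its reversal is, so a set closed under
  transitions is closed backwards too. One-way reachability therefore yields an equivalence.\<close>

lemma reach_trans_closed:
  fixes lam :: real
  assumes "lam > 0" and A: "\<And>C C'. C \<in> A \<Longrightarrow> C' \<in> Omega n \<Longrightarrow> trans_prob lam C C' > 0 \<Longrightarrow> C' \<in> A"
    and "reach S S'" "conf S" "card S = n" "n \<ge> 1"
  shows "cls S \<in> A \<longleftrightarrow> cls S' \<in> A"
  using assms(3)
proof (induction rule: rtranclp_induct)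
  case (step T T')
  have T: "conf T" "card T = n" using reach_conf[OF step.hyps(1) assms(4)] assms(5) by blast+
  have T': "conf T'" "card T' = n" using vmove_conf[OF step.hyps(2) T(1)] T(2) by auto
  have O: "cls T \<in> Omega n" "cls T' \<in> Omega n" using T T' unfolding Omega_conf by blast+
  have "cls T \<in> A \<longleftrightarrow> cls T' \<in> A"
  proof (cases "cls T' = cls T")
    case False
    have pos: "trans_prob lam (cls T) (cls T') > 0"
      by (rule trans_prob_vmove[OF assms(1) step.hyps(2) T(1) False])
    have "weight lam (cls T') * trans_prob lam (cls T') (cls T) > 0"
      using trans_prob_balance[OF assms(1) O assms(6)] pos assms(1)
      by (metis mult_pos_pos weight_cls zero_less_power)
    then have "trans_prob lam (cls T') (cls T) > 0"
      using assms(1) by (simp add: zero_less_mult_iff)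
    then show ?thesis using A pos O by blast
  qed simp
  then show ?case using step.IH by blast
qed simp

lemma irreducible:
  fixes lam :: real
  assumes "lam > 0" and A: "\<And>C C'. C \<in> A \<Longrightarrow> C' \<in> Omega n \<Longrightarrow> trans_prob lam C C' > 0 \<Longrightarrow> C' \<in> A"
    and C: "C \<in> Omega n" "C' \<in> Omega n" "C \<in> A" "n \<ge> 2"
  shows "C' \<in> A"
proof -
  have line: "C \<in> A \<longleftrightarrow> cls (Pair 0 ` {0..<int n}) \<in> A" if CO: "C \<in> Omega n" for C
  proof -
    obtain S where S: "C = cls S" "conf S" "card S = n" using CO unfolding Omega_conf by blast
    have fin: "finite (fst ` S)" using S by (simp add: conf_def)
    have "\<forall>p\<in>S. Min (fst ` S) \<le> fst p \<and> fst p \<le> Max (fst ` S)" using fin by simp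
    then obtain S' c where S': "reach S S'" "\<forall>p\<in>S'. fst p = c"
      using reach_column[of S "Min (fst ` S)" "Max (fst ` S)"] S C(4) by blast
    have "conf S'" "card S' = n" using reach_conf[OF S'(1) S(2)] S(3) by auto
    then obtain b where b: "S' = Pair c ` {b..<b + int n}"
      using column_segment[of S' n c] S'(2) C(4) by auto
    have "{b..<b + int n} = (+) b ` {0..<int n}" by (simp add: add.commute)
    then have "S' = shift (c, b) (Pair 0 ` {0..<int n})"
      unfolding b shift_image by (simp only: image_image) simp
    then have "cls S' = cls (Pair 0 ` {0..<int n})" by simp
    then show ?thesis
      using reach_trans_closed[OF assms(1) A S'(1) S(2,3)] C(4) unfolding S(1) by simp
  qed
  show ?thesis using line[OF C(1)] line[OF C(2)] C(3) by blast
qed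

text \<open>A maximum principle. By balance, the density h of \<pi> with respect to
  \<open>weight\<close> is harmonic. A harmonic function that attains its maximum at C attains it at
  all classes reachable from C in one step, and by irreducibility everywhere.\<close>

lemma stationary_weight:
  fixes lam :: real
  assumes "lam > 0" and st: "stationary lam n \<pi>" and "n \<ge> 2"
  shows "\<exists>c. \<forall>C\<in>Omega n. \<pi> C = c * weight lam C"
proof -
  let ?O = "Omega n"
  have st: "\<And>C. C \<in> ?O \<Longrightarrow> 0 \<le> \<pi> C" "(\<Sum>C\<in>?O. \<pi> C) = 1"
    "\<And>C'. C' \<in> ?O \<Longrightarrow> (\<Sum>C\<in>?O. \<pi> C * trans_prob lam C C') = \<pi> C'"
    using assms(2) unfolding stationary_def by blast+
  \<comment> \<open>A sum over an infinite set is 0 by convention, so total mass 1 already forces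
    \<open>Omega n\<close> to be finite.\<close>
  have fin: "finite ?O" using st(2) by (metis sum.infinite zero_neq_one)
  have ne: "?O \<noteq> {}" using st(2) by auto
  have w: "weight lam C > 0" for C using assms(1) by (simp add: weight_def)
  define h where "h C = \<pi> C / weight lam C" for C
  have h0: "h C \<ge> 0" if "C \<in> ?O" for C using st(1)[OF that] w[of C] by (simp add: h_def)
  have harm: "h C' = (\<Sum>C\<in>?O. trans_prob lam C' C * h C)" if C': "C' \<in> ?O" for C'
  proof -
    have "weight lam C' * h C' = (\<Sum>C\<in>?O. \<pi> C * trans_prob lam C C')"
      using st(3)[OF C'] w[of C'] by (simp add: h_def)
    also have "\<dots> = (\<Sum>C\<in>?O. weight lam C' * (trans_prob lam C' C * h C))"
    proof (intro sum.cong refl)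
      fix C assume "C \<in> ?O"
      have "\<pi> C * trans_prob lam C C' = h C * (weight lam C * trans_prob lam C C')"
        using w[of C] by (simp add: h_def)
      also have "\<dots> = weight lam C' * (trans_prob lam C' C * h C)"
        using trans_prob_balance[OF assms(1) \<open>C \<in> ?O\<close> C'] assms(3) by simp
      finally show "\<pi> C * trans_prob lam C C' = weight lam C' * (trans_prob lam C' C * h C)" .
    qed
    finally have "weight lam C' * h C' = weight lam C' * (\<Sum>C\<in>?O. trans_prob lam C' C * h C)"
      by (simp add: sum_distrib_left)
    then show ?thesis using w[of C'] by simp
  qed
  define m where "m = Max (h ` ?O)"
  have m: "h C \<le> m" if "C \<in> ?O" for C using that fin by (simp add: m_def)
  have "m \<in> h ` ?O" unfolding m_def using fin ne by (intro Max_in) auto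
  then obtain C0 where C0: "C0 \<in> ?O" "h C0 = m" by auto
  have m0: "m \<ge> 0" using h0[OF C0(1)] C0(2) by simp
  let ?A = "{C \<in> ?O. h C = m}"
  have closed: "C' \<in> ?A" if "C \<in> ?A" "C' \<in> ?O" "trans_prob lam C C' > 0" for C C'
  proof (rule ccontr)
    assume "C' \<notin> ?A"
    then have "h C' < m" using m[OF that(2)] that(2) by auto
    have C: "C \<in> ?O" "h C = m" using that by auto
    have "(\<Sum>D\<in>?O. trans_prob lam C D * h D) < (\<Sum>D\<in>?O. trans_prob lam C D * m)"
    proof (rule sum_strict_mono_ex1[OF fin])
      show "\<forall>D\<in>?O. trans_prob lam C D * h D \<le> trans_prob lam C D * m"
        using m trans_prob_nonneg[OF assms(1)] by (simp add: mult_left_mono)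
      show "\<exists>D\<in>?O. trans_prob lam C D * h D < trans_prob lam C D * m"
        using that \<open>h C' < m\<close> by (intro bexI[of _ C']) auto
    qed
    also have "\<dots> = (\<Sum>D\<in>?O. trans_prob lam C D) * m" by (simp add: sum_distrib_right)
    also have "\<dots> \<le> 1 * m" using trans_prob_sum[OF assms(1) fin] m0 by (intro mult_right_mono)
    finally show False using harm[OF C(1)] C(2) by simp
  qed
  have "h C = m" if "C \<in> ?O" for C
    using irreducible[OF assms(1) closed C0(1) that _ assms(3)] C0 by auto
  then have "\<pi> C = m * weight lam C" if "C \<in> ?O" for C
    using that w[of C] by (metis h_def nonzero_divide_eq_eq less_irrefl)
  then show ?thesis by blast
qed

section \<open>Column-convex configurations\<close>

lemma lconnected_Un:
  assumes "lconnected A" "lconnected B" "a \<in> A" "b \<in> B" "adj a b"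
  shows "lconnected (A \<union> B)"
proof -
  have A: "(x, a) \<in> (induced_rel (A \<union> B))\<^sup>*" if "x \<in> A" for x
  proof -
    have "(x, a) \<in> (induced_rel A)\<^sup>*" using assms(1,3) that unfolding lconnected_def by blast
    then show ?thesis by (rule conn_mono) simp
  qed
  have B: "(x, b) \<in> (induced_rel (A \<union> B))\<^sup>*" if "x \<in> B" for x
  proof -
    have "(x, b) \<in> (induced_rel B)\<^sup>*" using assms(2,4) that unfolding lconnected_def by blast
    then show ?thesis by (rule conn_mono) simp
  qed
  have "(a, b) \<in> (induced_rel (A \<union> B))\<^sup>*" using assms by (intro conn_edge) auto
  then have ba: "(b, a) \<in> (induced_rel (A \<union> B))\<^sup>*" by (rule conn_sym)
  have C: "(x, a) \<in> (induced_rel (A \<union> B))\<^sup>*" if "x \<in> A \<union> B" for x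
    using A[of x] rtrancl_trans[OF B[of x] ba] that by blast
  show ?thesis unfolding lconnected_def
  proof (intro ballI)
    fix x y assume "x \<in> A \<union> B" "y \<in> A \<union> B"
    then show "(x, y) \<in> (induced_rel (A \<union> B))\<^sup>*"
      using C conn_sym[OF C] by (meson rtrancl_trans)
  qed
qed

definition col_convex :: "loc set \<Rightarrow> bool" where
  "col_convex S \<longleftrightarrow> (\<forall>x y1 y2 y. (x, y1) \<in> S \<and> (x, y2) \<in> S \<and> y1 \<le> y \<and> y \<le> y2 \<longrightarrow> (x, y) \<in> S)"

lemma infinite_comp_ray:
  assumes "\<And>m. (x, y + e * int m) \<in> U" "e = 1 \<or> e = -1"
  shows "infinite (comp U (x, y))"
proof -
  have "((x, y), (x, y + e * int m)) \<in> (induced_rel U)\<^sup>*" for m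
  proof (induction m)
    case (Suc m)
    have "adj (x, y + e * int m) (x, y + e * int (Suc m))"
      using assms(2) by (auto simp: adj_iff dirs_def algebra_simps)
    then have "((x, y + e * int m), (x, y + e * int (Suc m))) \<in> (induced_rel U)\<^sup>*"
      by (intro conn_edge assms(1))
    with Suc show ?case by (rule rtrancl_trans)
  qed simp
  then have "range (\<lambda>m. (x, y + e * int m)) \<subseteq> comp U (x, y)" by (auto simp: comp_def)
  moreover have "inj (\<lambda>m. (x, y + e * int m))" using assms(2) by (auto simp: inj_def)
  ultimately show ?thesis using finite_subset finite_imageD infinite_UNIV_nat by blast
qed

text \<open>An empty site cannot have particles of its column both above and below it, so it escapes
  to infinity along a vertical ray.\<close>

lemma col_convex_no_holes:
  assumes "col_convex S"
  shows "no_holes S"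
  unfolding no_holes_iff
proof (intro allI impI)
  fix p assume p: "p \<notin> S"
  obtain x y where xy: "p = (x, y)" by (cases p)
  have "(\<forall>z\<ge>y. (x, z) \<notin> S) \<or> (\<forall>z\<le>y. (x, z) \<notin> S)"
    using assms p unfolding col_convex_def xy by blast
  then show "infinite (comp (- S) p)"
  proof
    assume "\<forall>z\<ge>y. (x, z) \<notin> S"
    then show ?thesis unfolding xy by (intro infinite_comp_ray[where e = 1]) auto
  next
    assume "\<forall>z\<le>y. (x, z) \<notin> S"
    then show ?thesis unfolding xy by (intro infinite_comp_ray[where e = "-1"]) auto
  qed
qed

definition seg :: "nat \<Rightarrow> loc set" where
  "seg k = {0} \<times> {0..<int k}"

lemma seg_mem [simp]: "(x, y) \<in> seg k \<longleftrightarrow> x = 0 \<and> 0 \<le> y \<and> y < int k"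
  by (auto simp: seg_def)

lemma seg_props: "finite (seg k)" "card (seg k) = k"
  by (simp_all add: seg_def card_cartesian_product)

lemma lconnected_seg: "lconnected (seg k)"
proof (induction k)
  case (Suc k)
  have eq: "seg (Suc k) = seg k \<union> {(0, int k)}" by (auto simp: seg_def)
  show ?case
  proof (cases "k = 0")
    case True
    then show ?thesis unfolding eq by (simp add: seg_def lconnected_def)
  next
    case False
    have "adj (0, int k - 1) (0, int k)" by (simp add: adj_iff dirs_def)
    moreover have "lconnected {(0, int k)}" by (simp add: lconnected_def)
    ultimately show ?thesis
      unfolding eq using Suc False by (intro lconnected_Un[of _ _ "(0, int k - 1)" "(0, int k)"]) auto
  qed
qed (simp add: seg_def lconnected_def)

definition attach :: "nat \<Rightarrow> int \<Rightarrow> loc set \<Rightarrow> loc set" where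
  "attach k j S = seg k \<union> shift (-1, -j) S"

lemma attach_mem: "(x, y) \<in> attach k j S \<longleftrightarrow> x = 0 \<and> 0 \<le> y \<and> y < int k \<or> (x + 1, y + j) \<in> S"
  by (simp add: attach_def)

text \<open>In stacks n k the rightmost column is the segment of height k above the origin; j is the
  offset of the bottom of this column from the bottom of the column to its left.\<close>

fun stacks :: "nat \<Rightarrow> nat \<Rightarrow> loc set set" where
  "stacks n k = (if k = 0 \<or> n < k then {} else if n = k then {seg k}
     else \<Union>h\<in>{1, 2, 3}. \<Union>j\<in>{- int k..int h - 1}. attach k j ` stacks (n - k) h)"

declare stacks.simps [simp del]

lemma stacks_rec:
  "0 < k \<Longrightarrow> k < n \<Longrightarrow>
    stacks n k = (\<Union>h\<in>{1, 2, 3}. \<Union>j\<in>{- int k..int h - 1}. attach k j ` stacks (n - k) h)"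
  by (subst stacks.simps) simp

lemma stacks_cases:
  assumes "S \<in> stacks n k"
  obtains "0 < k" "n = k" "S = seg k"
  | h j S0 where "0 < k" "k < n" "h \<in> {1, 2, 3}" "j \<in> {- int k..int h - 1}"
      "S0 \<in> stacks (n - k) h" "S = attach k j S0"
proof -
  consider "0 < k" "n = k" | "0 < k" "k < n"
    using assms by (subst (asm) stacks.simps) (auto split: if_splits)
  then show ?thesis
  proof cases
    case 1
    then have "S = seg k" using assms by (subst (asm) stacks.simps) simp
    then show ?thesis using that(1) 1 by blast
  next
    case 2
    then show ?thesis using assms that(2) unfolding stacks_rec[OF 2] by blast
  qed
qed

lemma finite_stacks: "finite (stacks n k)"
proof (induction n arbitrary: k rule: less_induct)
  case (less n)
  show ?case
  proof (cases "0 < k \<and> k < n")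
    case True
    then show ?thesis using less.IH[of "n - k"] by (subst stacks_rec) auto
  next
    case False
    then show ?thesis by (subst stacks.simps) auto
  qed
qed

lemma stacks_nonempty: "1 \<le> k \<Longrightarrow> k \<le> n \<Longrightarrow> stacks n k \<noteq> {}"
proof (induction n arbitrary: k rule: less_induct)
  case (less n)
  show ?case
  proof (cases "n = k")
    case True
    then show ?thesis using less.prems by (subst stacks.simps) auto
  next
    case False
    then obtain S where "S \<in> stacks (n - k) 1" using less.IH[of "n - k" 1] less.prems by fastforce
    then have "attach k 0 S \<in> stacks n k"
      using False less.prems by (subst stacks_rec) auto
    then show ?thesis by blast
  qed
qed

lemma stacks_props:
  assumes "S \<in> stacks n k"
  shows "finite S \<and> card S = n \<and> lconnected S \<and> col_convex S \<and> (\<forall>p\<in>S. fst p \<le> 0) \<and>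
    (\<forall>y. (0, y) \<in> S \<longleftrightarrow> 0 \<le> y \<and> y < int k)"
  using assms
proof (induction n arbitrary: k S rule: less_induct)
  case (less n)
  from less.prems show ?case
  proof (cases rule: stacks_cases)
    case 1
    then show ?thesis using seg_props lconnected_seg by (auto simp: col_convex_def)
  next
    case (2 h j S0)
    have IH: "finite S0" "card S0 = n - k" "lconnected S0" "col_convex S0"
      "\<And>x y. (x, y) \<in> S0 \<Longrightarrow> x \<le> 0" "\<And>y. (0, y) \<in> S0 \<longleftrightarrow> 0 \<le> y \<and> y < int h"
      using less.IH[OF _ 2(5)] 2(1,2) by force+
    have disj: "seg k \<inter> shift (-1, -j) S0 = {}"
      using IH(5) by force
    have "card S = n"
      unfolding 2(6) attach_def using IH(1,2) 2(2) seg_props disj by (subst card_Un_disjoint) auto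
    moreover have "finite S" unfolding 2(6) attach_def using IH(1) seg_props by simp
    moreover have "lconnected S"
    proof -
      \<comment> \<open>The site (0, z) touches (-1, z) and (-1, z + 1), so the new column touches
        the heights 0 to k of the column on its left. This explains the range of j. The contact
        chosen here is the lowest one, and at height k it has to be made from below.\<close>
      define y where "y = max (- j) 0"
      have y: "0 \<le> y + j" "y + j < int h" "0 \<le> y" "y \<le> int k"
        using 2(3,4) by (auto simp: y_def)
      have 1: "(-1, y) \<in> shift (-1, -j) S0" using IH(6) y by simp
      define z where "z = (if y < int k then y else y - 1)"
      have z: "(0, z) \<in> seg k" using y 2(1) by (auto simp: z_def)
      have "adj (0, z) (-1, y)" by (simp add: z_def adj_iff dirs_def)
      then show ?thesis
        unfolding 2(6) attach_def using lconnected_seg IH(3) z 1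
        by (intro lconnected_Un[of _ _ "(0, z)" "(-1, y)"]) auto
    qed
    moreover have "col_convex S"
      unfolding col_convex_def
    proof (intro allI impI)
      fix x y1 y2 y assume a: "(x, y1) \<in> S \<and> (x, y2) \<in> S \<and> y1 \<le> y \<and> y \<le> y2"
      show "(x, y) \<in> S"
      proof (cases "x = 0")
        case True
        then show ?thesis using a IH(5) unfolding 2(6) attach_mem by force
      next
        case False
        then have "(x + 1, y1 + j) \<in> S0" "(x + 1, y2 + j) \<in> S0" using a unfolding 2(6) attach_mem by auto
        then have "(x + 1, y + j) \<in> S0"
          using IH(4) a unfolding col_convex_def by (meson add_le_cancel_right)
        then show ?thesis unfolding 2(6) attach_mem by blast
      qed
    qed
    moreover have "fst p \<le> 0" if "p \<in> S" for p
      using that IH(5) unfolding 2(6) by (cases p) (force simp: attach_mem)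
    moreover have "(0, y) \<in> S \<longleftrightarrow> 0 \<le> y \<and> y < int k" for y
      using IH(5) unfolding 2(6) attach_mem by force
    ultimately show ?thesis by blast
  qed
qed

lemma stacks_conf:
  assumes "S \<in> stacks n k"
  shows "conf S" "card S = n"
  using stacks_props[OF assms] col_convex_no_holes by (auto simp: conf_def)

section \<open>The transfer matrix of column heights\<close>

definition new_tri :: "nat \<Rightarrow> nat \<Rightarrow> int \<Rightarrow> nat" where
  "new_tri h k j = nat (min (int h - 1 - j) (int k) - max (- j) 0) +
     nat (min (int k - 1) (int h - 1 - j) - max 0 (- j - 1))"

text \<open>The new faces lie between the last two columns. Those with two corners in the left
  column are indexed by ?A, those with two corners in the right column by ?B; the two summands of
  \<open>new_tri\<close> are the sizes of these intervals.\<close>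

lemma triangles_attach:
  assumes S: "S \<in> stacks n h"
  shows "triangles S + new_tri h k j \<le> triangles (attach k j S)"
proof -
  have P: "finite S" "\<And>x y. (x, y) \<in> S \<Longrightarrow> x \<le> 0" "\<And>y. (0, y) \<in> S \<longleftrightarrow> 0 \<le> y \<and> y < int h"
    using stacks_props[OF S] by force+
  let ?T = "attach k j S" and ?S = "shift (-1, -j) S"
  have fin: "finite ?S" "finite ?T" using P(1) seg_props by (simp_all add: attach_def)
  let ?A = "{max (- j) 0 .. min (int h - 2 - j) (int k - 1)}"
  let ?B = "{max 0 (- j - 1) .. min (int k - 2) (int h - 2 - j)}"
  let ?X = "{u \<in> ?S. u + (1,0) \<in> ?S \<and> u + (0,1) \<in> ?S}"
  let ?Y = "{u \<in> ?S. u + (0,1) \<in> ?S \<and> u + (-1,1) \<in> ?S}"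
  have n0: "(0, y) \<notin> ?S" for y using P(2)[of 1 "y + j"] by auto
  then have "?X \<inter> Pair (-1 :: int) ` ?A = {}" "?Y \<inter> Pair (0 :: int) ` ?B = {}" by auto
  note disj = this
  have finX: "finite ?X" "finite ?Y" by (rule finite_subset[OF _ fin(1)], blast)+
  have ST: "?S \<subseteq> ?T" by (simp add: attach_def)
  have A: "(-1, y) \<in> ?T \<and> (-1, y) + (1,0) \<in> ?T \<and> (-1, y) + (0,1) \<in> ?T" if "y \<in> ?A" for y
    using that P(3)[of "y + j"] P(3)[of "y + 1 + j"] by (simp add: attach_mem)
  have B: "(0, y) \<in> ?T \<and> (0, y) + (0,1) \<in> ?T \<and> (0, y) + (-1,1) \<in> ?T" if "y \<in> ?B" for y
    using that P(3)[of "y + 1 + j"] by (simp add: attach_mem)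
  have subA: "?X \<union> Pair (-1 :: int) ` ?A \<subseteq> {u \<in> ?T. u + (1,0) \<in> ?T \<and> u + (0,1) \<in> ?T}"
    using ST A by blast
  have subB: "?Y \<union> Pair (0 :: int) ` ?B \<subseteq> {u \<in> ?T. u + (0,1) \<in> ?T \<and> u + (-1,1) \<in> ?T}"
    using ST B by blast
  have finT: "finite {u \<in> ?T. u + (1,0) \<in> ?T \<and> u + (0,1) \<in> ?T}"
    "finite {u \<in> ?T. u + (0,1) \<in> ?T \<and> u + (-1,1) \<in> ?T}"
    by (rule finite_subset[OF _ fin(2)], blast)+
  have "card ?X + card (Pair (-1 :: int) ` ?A) = card (?X \<union> Pair (-1 :: int) ` ?A)"
    by (subst card_Un_disjoint) (fact finX disj | rule refl | rule finite_imageI, simp)+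
  also have "\<dots> \<le> card {u \<in> ?T. u + (1,0) \<in> ?T \<and> u + (0,1) \<in> ?T}"
    by (rule card_mono[OF finT(1) subA])
  finally have 1: "card ?X + card ?A \<le> card {u \<in> ?T. u + (1,0) \<in> ?T \<and> u + (0,1) \<in> ?T}"
    by (simp add: card_image inj_on_def)
  have "card ?Y + card (Pair (0 :: int) ` ?B) = card (?Y \<union> Pair (0 :: int) ` ?B)"
    by (subst card_Un_disjoint) (fact finX disj | rule refl | rule finite_imageI, simp)+
  also have "\<dots> \<le> card {u \<in> ?T. u + (0,1) \<in> ?T \<and> u + (-1,1) \<in> ?T}"
    by (rule card_mono[OF finT(2) subB])
  finally have 2: "card ?Y + card ?B \<le> card {u \<in> ?T. u + (0,1) \<in> ?T \<and> u + (-1,1) \<in> ?T}"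
    by (simp add: card_image inj_on_def)
  have "triangles S = card ?X + card ?Y"
    using triangles_shift[of "(-1, -j)" S] by (simp only: triangles_def)
  moreover have "new_tri h k j = card ?A + card ?B"
    unfolding new_tri_def card_atLeastAtMost_int
    by (intro arg_cong2[of _ _ _ _ "(+)"] arg_cong[of _ _ nat]) (simp_all add: min_def max_def)
  ultimately show ?thesis using 1 2 unfolding triangles_def[of ?T] by linarith
qed

text \<open>The column at -1 of the result occupies the heights from -j to h - 1 - j, from which h
  and j can be read off.\<close>

lemma attach_inj:
  assumes "S \<in> stacks n h" "S' \<in> stacks n' h'" "1 \<le> h" "1 \<le> h'" and eq: "attach k j S = attach k j' S'"
  shows "h = h' \<and> j = j' \<and> S = S'"
proof -
  have P: "\<And>x y. (x, y) \<in> S \<Longrightarrow> x \<le> 0" "\<And>y. (0, y) \<in> S \<longleftrightarrow> 0 \<le> y \<and> y < int h"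
    "\<And>x y. (x, y) \<in> S' \<Longrightarrow> x \<le> 0" "\<And>y. (0, y) \<in> S' \<longleftrightarrow> 0 \<le> y \<and> y < int h'"
    using stacks_props[OF assms(1)] stacks_props[OF assms(2)] by force+
  have "0 \<le> y + j \<and> y + j < int h \<longleftrightarrow> 0 \<le> y + j' \<and> y + j' < int h'" for y
    using arg_cong[OF eq, of "\<lambda>A. (-1, y) \<in> A"] P(2,4) by (simp add: attach_mem)
  from this[of "- j"] this[of "- j'"] this[of "int h - 1 - j"] this[of "int h' - 1 - j'"]
  have hj: "h = h'" "j = j'" using assms(3,4) by auto
  have "(x, y) \<in> S \<longleftrightarrow> (x, y) \<in> S'" for x y
  proof (cases "x \<le> 0")
    case True
    then show ?thesis
      using arg_cong[OF eq, of "\<lambda>A. (x - 1, y - j) \<in> A"] hj by (simp add: attach_mem)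
  next
    case False
    then show ?thesis using P(1,3) by blast
  qed
  then show ?thesis using hj by auto
qed

definition stack_sum :: "real \<Rightarrow> nat \<Rightarrow> nat \<Rightarrow> real" where
  "stack_sum lam n k = (\<Sum>S\<in>stacks n k. lam ^ triangles S)"

lemma stack_sum_pos:
  assumes "lam > 0" "1 \<le> k" "k \<le> n"
  shows "stack_sum lam n k > 0"
  unfolding stack_sum_def
  using assms finite_stacks stacks_nonempty by (intro sum_pos) auto

lemma stack_sum_rec:
  fixes lam :: real
  assumes "lam \<ge> 1" "0 < k" "k < n"
  shows "(\<Sum>h\<in>{1, 2, 3}. (\<Sum>j\<in>{- int k..int h - 1}. lam ^ new_tri h k j) * stack_sum lam (n - k) h)
    \<le> stack_sum lam n k"
proof -
  let ?I = "SIGMA h:{1, 2, 3}. {- int k..int h - 1} \<times> stacks (n - k) h"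
  let ?f = "\<lambda>(h, j, S). attach k j S"
  have "(\<Sum>h\<in>{1, 2, 3}. (\<Sum>j\<in>{- int k..int h - 1}. lam ^ new_tri h k j) * stack_sum lam (n - k) h)
    = (\<Sum>h\<in>{1, 2, 3}. \<Sum>(j, S)\<in>{- int k..int h - 1} \<times> stacks (n - k) h. lam ^ (triangles S + new_tri h k j))"
    unfolding stack_sum_def sum_product
    by (intro sum.cong refl) (simp add: sum.cartesian_product power_add mult.commute)
  also have "\<dots> = (\<Sum>(h, j, S)\<in>?I. lam ^ (triangles S + new_tri h k j))"
    using finite_stacks by (subst sum.Sigma) (auto simp: case_prod_unfold)
  also have "\<dots> \<le> (\<Sum>(h, j, S)\<in>?I. lam ^ triangles (attach k j S))"
    using triangles_attach assms(1) by (intro sum_mono) (auto intro!: power_increasing)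
  also have "\<dots> = (\<Sum>S\<in>?f ` ?I. lam ^ triangles S)"
  proof (subst sum.reindex)
    show "inj_on ?f ?I"
      by (rule inj_onI) (clarsimp, metis attach_inj One_nat_def le_numeral_extra(4) one_le_numeral)
  qed (auto intro!: sum.cong)
  also have "?f ` ?I = stacks n k"
    unfolding stacks_rec[OF assms(2,3)]
  proof (intro equalityI subsetI)
    fix T assume "T \<in> ?f ` ?I"
    then obtain p where p: "p \<in> ?I" "T = ?f p" by blast
    obtain h j S where "p = (h, j, S)" by (cases p)
    then show "T \<in> (\<Union>h\<in>{1, 2, 3}. \<Union>j\<in>{- int k..int h - 1}. attach k j ` stacks (n - k) h)"
      using p by blast
  next
    fix T assume "T \<in> (\<Union>h\<in>{1, 2, 3}. \<Union>j\<in>{- int k..int h - 1}. attach k j ` stacks (n - k) h)"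
    then obtain h j S where *: "h \<in> {1, 2, 3}" "j \<in> {- int k..int h - 1}" "S \<in> stacks (n - k) h"
      "T = attach k j S" by blast
    then have "(h, j, S) \<in> ?I" by blast
    then show "T \<in> ?f ` ?I" by (rule image_eqI[rotated]) (simp add: *(4))
  qed
  finally show ?thesis unfolding stack_sum_def .
qed

lemma new_tri_sums:
  fixes lam :: real
  defines "N \<equiv> \<lambda>h k. \<Sum>j\<in>{- int k..int h - 1}. lam ^ new_tri h k j"
  shows "N 1 1 = 2" "N 2 1 = lam + 2" "N 3 1 = 2 * lam + 2"
    "N 1 2 = lam + 2" "N 2 2 = 2 * lam ^ 2 + 2" "N 3 2 = lam ^ 3 + 2 * lam ^ 2 + 2"
    "N 1 3 = 2 * lam + 2" "N 2 3 = lam ^ 3 + 2 * lam ^ 2 + 2" "N 3 3 = 2 * lam ^ 4 + 2 * lam ^ 2 + 2"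
proof -
  have I: "{-1..0::int} = {-1, 0}" "{-1..1::int} = {-1, 0, 1}" "{-1..2::int} = {-1, 0, 1, 2}"
    "{-2..0::int} = {-2, -1, 0}" "{-2..1::int} = {-2, -1, 0, 1}" "{-2..2::int} = {-2, -1, 0, 1, 2}"
    "{-3..0::int} = {-3, -2, -1, 0}" "{-3..1::int} = {-3, -2, -1, 0, 1}"
    "{-3..2::int} = {-3, -2, -1, 0, 1, 2}"
    by auto
  show "N 1 1 = 2" "N 2 1 = lam + 2" "N 3 1 = 2 * lam + 2"
    "N 1 2 = lam + 2" "N 2 2 = 2 * lam ^ 2 + 2" "N 3 2 = lam ^ 3 + 2 * lam ^ 2 + 2"
    "N 1 3 = 2 * lam + 2" "N 2 3 = lam ^ 3 + 2 * lam ^ 2 + 2" "N 3 3 = 2 * lam ^ 4 + 2 * lam ^ 2 + 2"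
    by (simp_all add: N_def I new_tri_def)
      (simp_all add: power2_eq_square power3_eq_cube algebra_simps)
qed

text \<open>In terms of z = 1 / lam, the left-hand sides of the three inequalities below are the row sums
  of the transfer matrix of the heights 1, 2, 3.\<close>

lemma row_sums:
  fixes z :: real
  assumes "23/50 \<le> z"
  shows "1.03 \<le> 3 * z^2 + 4 * z^3 + 2 * z^4"
    and "1.03 ^ 2 \<le> 4 * z^2 + 4 * z^3 + 2 * z^4 + 2 * z^5"
    and "1.03 ^ 3 \<le> 3 * z^2 + 4 * z^3 + 4 * z^4 + 2 * z^5 + 2 * z^6"
proof -
  \<comment> \<open>By monotonicity only z = 23/50 matters. There the three right-hand sides are
    about 1.11, 1.37 and 1.26, against 1.03, 1.06 and 1.09 on the left.\<close>
  have p: "(23/50) ^ m \<le> z ^ m" for m using assms by (intro power_mono) auto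
  note p[of 2] p[of 3] p[of 4] p[of 5] p[of 6]
  then show "1.03 \<le> 3 * z^2 + 4 * z^3 + 2 * z^4"
    "1.03 ^ 2 \<le> 4 * z^2 + 4 * z^3 + 2 * z^4 + 2 * z^5"
    "1.03 ^ 3 \<le> 3 * z^2 + 4 * z^3 + 4 * z^4 + 2 * z^5 + 2 * z^6"
    by (simp_all add: power_divide)
qed

lemma sum_three: "(\<Sum>h\<in>{1, 2, 3::nat}. f h) = f 1 + f 2 + f 3" for f :: "nat \<Rightarrow> real"
  by simp

text \<open>The vector lam^(-h) serves as an approximate Perron vector. Inserting c * m^n / lam^k
  with m = 1.03 * lam^2 into \<open>stack_sum_rec\<close> leaves exactly this inequality, because m
  / lam = 1.03 * lam. With heights 1 and 2 only, the row sums at z = 23/50 would be about 0.83 and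
  0.92, too small even with 1 in place of 1.03.\<close>

lemma new_tri_row:
  fixes lam :: real
  assumes "1 \<le> lam" "lam \<le> 50/23" "k \<in> {1, 2, 3}"
  shows "(1.03 * lam) ^ k \<le> (\<Sum>h\<in>{1, 2, 3}. (\<Sum>j\<in>{- int k..int h - 1}. lam ^ new_tri h k j) / lam ^ h)"
proof -
  define z where "z = 1 / lam"
  have z: "23/50 \<le> z" using assms by (simp add: z_def field_simps)
  have lam: "lam = 1 / z" "z > 0" using assms by (simp_all add: z_def)
  consider "k = 1" | "k = 2" | "k = 3" using assms(3) by blast
  then show ?thesis
  proof cases
    case 1
    have "(1.03 * lam) ^ k = 1.03 / z"
      unfolding lam(1) 1 by (simp only: times_divide_eq_right mult_1_right power_divide power_one_right)
    also have "\<dots> \<le> (3 * z^2 + 4 * z^3 + 2 * z^4) / z"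
      using row_sums(1)[OF z] lam(2) by (intro divide_right_mono) auto
    also have "\<dots> = (\<Sum>h\<in>{1, 2, 3}. (\<Sum>j\<in>{- int k..int h - 1}. lam ^ new_tri h k j) / lam ^ h)"
      unfolding 1 sum_three new_tri_sums lam(1) using lam(2)
      by (simp add: field_simps) (simp add: eval_nat_numeral algebra_simps)
    finally show ?thesis .
  next
    case 2
    have "(1.03 * lam) ^ k = 1.03 ^ 2 / z^2"
      unfolding lam(1) 2 by (simp only: times_divide_eq_right mult_1_right power_divide power_one_right)
    also have "\<dots> \<le> (4 * z^2 + 4 * z^3 + 2 * z^4 + 2 * z^5) / z^2"
      using row_sums(2)[OF z] lam(2) by (intro divide_right_mono) auto
    also have "\<dots> = (\<Sum>h\<in>{1, 2, 3}. (\<Sum>j\<in>{- int k..int h - 1}. lam ^ new_tri h k j) / lam ^ h)"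
      unfolding 2 sum_three new_tri_sums lam(1) using lam(2)
      by (simp add: field_simps) (simp add: eval_nat_numeral algebra_simps)
    finally show ?thesis .
  next
    case 3
    have "(1.03 * lam) ^ k = 1.03 ^ 3 / z^3"
      unfolding lam(1) 3 by (simp only: times_divide_eq_right mult_1_right power_divide power_one_right)
    also have "\<dots> \<le> (3 * z^2 + 4 * z^3 + 4 * z^4 + 2 * z^5 + 2 * z^6) / z^3"
      using row_sums(3)[OF z] lam(2) by (intro divide_right_mono) auto
    also have "\<dots> = (\<Sum>h\<in>{1, 2, 3}. (\<Sum>j\<in>{- int k..int h - 1}. lam ^ new_tri h k j) / lam ^ h)"
      unfolding 3 sum_three new_tri_sums lam(1) using lam(2)
      by (simp add: field_simps) (simp add: eval_nat_numeral algebra_simps)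
    finally show ?thesis .
  qed
qed

lemma stack_sum_growth:
  fixes lam :: real
  assumes "1 \<le> lam" "lam \<le> 50/23"
  shows "\<exists>c>0. \<forall>n\<ge>3. \<forall>k\<in>{1, 2, 3}. c * (1.03 * lam ^ 2) ^ n \<le> stack_sum lam n k * lam ^ k"
proof -
  let ?m = "1.03 * lam ^ 2"
  define r where "r n k = stack_sum lam n k * lam ^ k / ?m ^ n" for n k
  \<comment> \<open>The recursion leads from n >= 6 to n - k >= 3, so 3, 4, 5 are the base cases.
    From n = 3 on, all three heights occur, and c is positive.\<close>
  let ?B = "(\<lambda>(n, k). r n k) ` ({3, 4, 5} \<times> {1, 2, 3})"
  define c where "c = Min ?B"
  have m: "?m > 0" using assms by simp
  have "r n k > 0" if "n \<in> {3, 4, 5}" "k \<in> {1, 2, 3}" for n k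
    using stack_sum_pos[of lam k n] that assms m unfolding r_def by (intro divide_pos_pos mult_pos_pos) auto
  then have "c > 0" unfolding c_def by (subst Min_gr_iff) auto
  have base: "c \<le> r n k" if "n \<in> {3, 4, 5}" "k \<in> {1, 2, 3}" for n k
    unfolding c_def using that by (intro Min_le) auto
  have "c * ?m ^ n \<le> stack_sum lam n k * lam ^ k" if "n \<ge> 3" "k \<in> {1, 2, 3}" for n k
    using that
  proof (induction n arbitrary: k rule: less_induct)
    case (less n)
    show ?case
    proof (cases "n \<le> 5")
      case True
      then have "n \<in> {3, 4, 5}" using less.prems by auto
      from base[OF this less.prems(2)] show ?thesis using m by (simp add: r_def pos_le_divide_eq)
    next
      case False
      then have k: "0 < k" "k < n" "n - k < n" "3 \<le> n - k" using less.prems by auto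
      define N where "N h = (\<Sum>j\<in>{- int k..int h - 1}. lam ^ new_tri h k j)" for h
      have N0: "N h \<ge> 0" for h unfolding N_def using assms by (intro sum_nonneg) simp
      have "c * ?m ^ n = c * ?m ^ (n - k) * (lam ^ k * (1.03 * lam) ^ k)"
      proof -
        have "lam ^ k * (1.03 * lam) ^ k = ?m ^ k"
          by (simp add: power_mult_distrib[symmetric] power2_eq_square mult.left_commute)
        then show ?thesis using k(2) by (simp add: power_add[symmetric])
      qed
      also have "\<dots> \<le> c * ?m ^ (n - k) * (lam ^ k * (\<Sum>h\<in>{1, 2, 3}. N h / lam ^ h))"
        unfolding N_def using new_tri_row[OF assms less.prems(2)] \<open>c > 0\<close> m assms
        by (intro mult_left_mono) auto
      also have "\<dots> = (\<Sum>h\<in>{1, 2, 3}. N h * (c * ?m ^ (n - k) / lam ^ h)) * lam ^ k"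
        unfolding sum_distrib_left sum_distrib_right by (intro sum.cong refl) simp
      also have "\<dots> \<le> (\<Sum>h\<in>{1, 2, 3}. N h * stack_sum lam (n - k) h) * lam ^ k"
      proof (intro mult_right_mono sum_mono mult_left_mono N0)
        fix h :: nat assume "h \<in> {1, 2, 3}"
        from less.IH[OF k(3,4) this] show "c * ?m ^ (n - k) / lam ^ h \<le> stack_sum lam (n - k) h"
          using assms by (simp add: pos_divide_le_eq)
      qed (use assms in simp)
      also have "\<dots> \<le> stack_sum lam n k * lam ^ k"
        unfolding N_def using stack_sum_rec[OF assms(1) k(1,2)] assms by (intro mult_right_mono) auto
      finally show ?thesis .
    qed
  qed
  then show ?thesis using \<open>c > 0\<close> by blast
qed

text \<open>The rightmost column is the single site 0, which fixes the translation. So passing to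
  classes loses nothing.\<close>

lemma inj_on_cls_stacks: "inj_on cls (stacks n 1)"
proof (rule inj_onI)
  fix S S' assume S: "S \<in> stacks n 1" and S': "S' \<in> stacks n 1" and eq: "cls S = cls S'"
  obtain v where v: "S = shift v S'" using eq cls_eq_iff by blast
  have P: "\<And>x y. (x, y) \<in> S \<Longrightarrow> x \<le> 0" "\<And>y. (0, y) \<in> S \<longleftrightarrow> 0 \<le> y \<and> y < 1"
    "\<And>x y. (x, y) \<in> S' \<Longrightarrow> x \<le> 0" "\<And>y. (0, y) \<in> S' \<longleftrightarrow> 0 \<le> y \<and> y < 1"
    using stacks_props[OF S] stacks_props[OF S'] by force+
  obtain a b where ab: "v = (a, b)" by (cases v)
  have "(0, 0) \<in> S" using P(2) by simp
  then have "(- a, - b) \<in> S'" by (simp add: v ab)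
  then have a1: "- a \<le> 0" using P(3) by blast
  have "(0, 0) \<in> S'" using P(4) by simp
  then have ab': "(a, b) \<in> S" by (simp add: v ab zero_prod_def)
  then have "a \<le> 0" using P(1) by blast
  then have "a = 0" using a1 by simp
  then have "b = 0" using ab' P(2) by auto
  then have "v = 0" using ab \<open>a = 0\<close> by (simp add: zero_prod_def)
  then show "S = S'" using v by simp
qed

lemma partition_function_growth:
  fixes lam :: real
  assumes "1 \<le> lam" "lam \<le> 50/23"
  shows "\<exists>c>0. \<forall>n\<ge>3. finite (Omega n) \<longrightarrow> c * (1.03 * lam ^ 2) ^ n \<le> (\<Sum>C\<in>Omega n. weight lam C)"
proof -
  obtain c where c: "c > 0" "\<And>n. n \<ge> 3 \<Longrightarrow> c * (1.03 * lam ^ 2) ^ n \<le> stack_sum lam n 1 * lam ^ 1"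
    using stack_sum_growth[OF assms] by blast
  have "c / lam * (1.03 * lam ^ 2) ^ n \<le> (\<Sum>C\<in>Omega n. weight lam C)" if n: "n \<ge> 3" "finite (Omega n)" for n
  proof -
    have "c / lam * (1.03 * lam ^ 2) ^ n \<le> stack_sum lam n 1"
      using c(2)[OF n(1)] assms by (simp add: pos_divide_le_eq)
    also have "\<dots> = (\<Sum>C\<in>cls ` stacks n 1. weight lam C)"
      unfolding stack_sum_def using inj_on_cls_stacks by (simp add: sum.reindex)
    also have "\<dots> \<le> (\<Sum>C\<in>Omega n. weight lam C)"
      using n(2) assms stacks_conf by (intro sum_mono2) (auto simp: Omega_conf weight_def)
    finally show ?thesis .
  qed
  then show ?thesis using c(1) assms by (intro exI[of _ "c / lam"]) auto
qed

section \<open>Counting configurations of small perimeter\<close>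

definition site_bdry :: "loc set \<Rightarrow> loc set" where
  "site_bdry K = {x. x \<notin> K \<and> (\<exists>u\<in>K. adj u x)}"

lemma nbrs_image: "{x. adj u x} = (+) u ` set dirs"
  by (auto simp: adj_iff intro: image_eqI[where x = "x - u" for x])

lemma card_nbrs: "finite {x. adj u x}" "card {x. adj u x} \<le> 6"
  unfolding nbrs_image by (auto intro!: order_trans[OF card_image_le] simp: dirs_def card_insert_if)

lemma finite_site_bdry:
  assumes "finite K"
  shows "finite (site_bdry K)"
proof (rule finite_subset)
  show "site_bdry K \<subseteq> (\<Union>u\<in>K. {x. adj u x})" by (auto simp: site_bdry_def)
qed (use assms card_nbrs in blast)

text \<open>The total mass of the product measure on the subsets of W.\<close>

lemma sum_Pow_binomial:
  fixes p q :: real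
  assumes "finite W" "p + q = 1"
  shows "(\<Sum>X\<in>Pow W. p ^ card X * q ^ card (W - X)) = 1"
proof -
  have "(\<Prod>x\<in>W. p + q) = (\<Sum>X\<in>Pow W. (\<Prod>x\<in>X. p) * (\<Prod>x\<in>W - X. q))"
    by (rule prod_add) fact
  then show ?thesis using assms(2) by simp
qed

text \<open>If every site is open independently with probability p, then the left-hand side is the
  probability that the open cluster of the origin belongs to F.\<close>

lemma percolation_bound:
  fixes p q :: real
  assumes "0 \<le> p" "0 \<le> q" "p + q = 1" and F: "finite F"
    "\<And>K. K \<in> F \<Longrightarrow> finite K \<and> lconnected K \<and> 0 \<in> K"
  shows "(\<Sum>K\<in>F. p ^ card K * q ^ card (site_bdry K)) \<le> 1"
proof -
  \<comment> \<open>A finite window that contains all clusters of F with their boundaries, so that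
    the probability space is finite. Below, \<open>E K\<close> is the event that K is open and its
    boundary closed.\<close>
  define V where "V = (\<Union>K\<in>F. K \<union> site_bdry K)"
  have finV: "finite V" unfolding V_def using F finite_site_bdry by blast
  define g where "g w = p ^ card w * q ^ card (V - w)" for w
  define E where "E K = {w \<in> Pow V. K \<subseteq> w \<and> w \<inter> site_bdry K = {}}" for K
  have E: "sum g (E K) = p ^ card K * q ^ card (site_bdry K)" if K: "K \<in> F" for K
  proof -
    define W where "W = V - K - site_bdry K"
    have KV: "K \<subseteq> V" "site_bdry K \<subseteq> V" using K by (auto simp: V_def)
    have fin: "finite K" "finite (site_bdry K)" "finite W"
      using F(2)[OF K] finite_site_bdry finV by (auto simp: W_def)
    have disj: "K \<inter> site_bdry K = {}" by (auto simp: site_bdry_def)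
    have "sum g (E K) = (\<Sum>X\<in>Pow W. p ^ card K * q ^ card (site_bdry K) * (p ^ card X * q ^ card (W - X)))"
    proof (rule sum.reindex_bij_witness[of _ "\<lambda>X. K \<union> X" "\<lambda>w. w - K"])
      fix w assume w: "w \<in> E K"
      show "K \<union> (w - K) = w" "w - K \<in> Pow W" using w by (auto simp: E_def W_def)
      have "card w = card K + card (w - K)"
        using w fin(1) finite_subset[OF _ finV, of w]
        by (subst card_Un_disjoint[symmetric]) (auto simp: E_def Un_absorb1)
      moreover have "V - w = site_bdry K \<union> (W - (w - K))"
        using w KV by (auto simp: E_def W_def)
      then have "card (V - w) = card (site_bdry K) + card (W - (w - K))"
        using fin by (subst card_Un_disjoint[symmetric]) (auto simp: W_def)
      ultimately show "p ^ card K * q ^ card (site_bdry K) * (p ^ card (w - K) * q ^ card (W - (w - K))) = g w"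
        by (simp add: g_def power_add)
    next
      fix X assume "X \<in> Pow W"
      then show "K \<union> X - K = X" "K \<union> X \<in> E K" using KV disj by (auto simp: E_def W_def)
    qed
    also have "\<dots> = p ^ card K * q ^ card (site_bdry K) * (\<Sum>X\<in>Pow W. p ^ card X * q ^ card (W - X))"
      by (simp add: sum_distrib_left)
    also have "\<dots> = p ^ card K * q ^ card (site_bdry K)"
      using sum_Pow_binomial[OF fin(3) assms(3)] by simp
    finally show ?thesis .
  qed
  \<comment> \<open>The events are disjoint: a walk from 0 inside K that left K' would step on the
    boundary of K', which is closed in w while K is open.\<close>
  have sub: "K \<subseteq> K'" if "K \<in> F" "K' \<in> F" "w \<in> E K" "w \<in> E K'" for K K' w
  proof (rule lconnected_closed[of K 0])
    show "lconnected K" "0 \<in> K" "0 \<in> K'" using F(2) that by blast+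
    fix u v assume "u \<in> K'" "v \<in> K" "adj u v"
    then show "v \<in> K'" using that(3,4) by (auto simp: E_def site_bdry_def)
  qed
  have "(\<Sum>K\<in>F. p ^ card K * q ^ card (site_bdry K)) = (\<Sum>K\<in>F. sum g (E K))"
    using E by simp
  also have "\<dots> = sum g (\<Union>K\<in>F. E K)"
  proof (rule sum.UNION_disjoint[symmetric])
    show "\<forall>K\<in>F. finite (E K)" using finV by (simp add: E_def)
    show "\<forall>K\<in>F. \<forall>K'\<in>F. K \<noteq> K' \<longrightarrow> E K \<inter> E K' = {}" using sub by blast
  qed fact
  also have "\<dots> \<le> sum g (Pow V)"
    using finV assms by (intro sum_mono2) (auto simp: E_def g_def)
  also have "\<dots> = 1" unfolding g_def by (rule sum_Pow_binomial) fact+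
  finally show ?thesis .
qed

lemma site_bdry_shift: "site_bdry (shift v S) = shift v (site_bdry S)"
proof -
  have "(\<exists>u\<in>shift v S. adj u x) \<longleftrightarrow> (\<exists>u\<in>S. adj u (x - v))" for x
    unfolding shift_image by (simp add: adj_iff algebra_simps)
  then show ?thesis by (simp add: site_bdry_def set_eq_iff del: split_paired_All)
qed

text \<open>Around a particle that has both occupied and empty neighbours, some occupied neighbour
  is followed by an empty one, which is a dart counted by the perimeter. So the perimeter bounds the
  number of particles at the boundary, and each of these has at most six neighbours.\<close>

lemma card_site_bdry_le:
  assumes "finite S" "lconnected S" "card S \<ge> 2"
  shows "card (site_bdry S) \<le> 6 * perim_set S"
proof -
  define U where "U = {u \<in> S. \<exists>x. adj u x \<and> x \<notin> S}"
  define P where "P = {(u, i). u \<in> S \<and> i < (6::nat) \<and> padd u (dirs ! i) \<in> S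
                       \<and> padd u (dirs ! ((i + 1) mod 6)) \<notin> S}"
  have finU: "finite U" using assms(1) by (simp add: U_def)
  have finP: "finite P"
    by (rule finite_subset[of _ "S \<times> {..<6}"]) (use assms(1) in \<open>auto simp: P_def\<close>)
  have "card (site_bdry S) \<le> card (\<Union>u\<in>U. {x. adj u x})"
    using finU card_nbrs by (intro card_mono finite_UN_I) (auto simp: site_bdry_def U_def)
  also have "\<dots> \<le> (\<Sum>u\<in>U. card {x. adj u x})" by (rule card_UN_le) fact
  also have "\<dots> \<le> (\<Sum>u\<in>U. 6)" by (intro sum_mono card_nbrs)
  also have "\<dots> = 6 * card U" by simp
  also have "card U \<le> card (fst ` P)"
  proof (intro card_mono finite_imageI finP subsetI)
    fix u assume u: "u \<in> U"
    then have "u \<in> S" by (simp add: U_def)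
    then obtain y where y: "y \<in> S" "adj u y" using lconnected_nbr assms by blast
    obtain x where x: "adj u x" "x \<notin> S" using u by (auto simp: U_def)
    have "\<exists>i<6. u + dirs ! i \<in> S \<and> u + dirs ! ((i + 1) mod 6) \<notin> S"
    proof (rule ccontr)
      assume no: "\<not> (\<exists>i<6. u + dirs ! i \<in> S \<and> u + dirs ! ((i + 1) mod 6) \<notin> S)"
      have no: "u + dirs ! i \<in> S \<Longrightarrow> u + dirs ! ((i + 1) mod 6) \<in> S" if "i < 6" for i
        using no that by blast
      have r: "u + (1,0) \<in> S \<Longrightarrow> u + (0,1) \<in> S" "u + (0,1) \<in> S \<Longrightarrow> u + (-1,1) \<in> S"
        "u + (-1,1) \<in> S \<Longrightarrow> u + (-1,0) \<in> S" "u + (-1,0) \<in> S \<Longrightarrow> u + (0,-1) \<in> S"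
        "u + (0,-1) \<in> S \<Longrightarrow> u + (1,-1) \<in> S" "u + (1,-1) \<in> S \<Longrightarrow> u + (1,0) \<in> S"
        using no[of 0] no[of 1] no[of 2] no[of 3] no[of 4] no[of 5] by (simp_all add: dirs_nth)
      have nb: "z \<in> {u + (1,0), u + (0,1), u + (-1,1), u + (-1,0), u + (0,-1), u + (1,-1)}"
        if "adj u z" for z
      proof -
        have "z \<in> (+) u ` set dirs" using that nbrs_image by blast
        then show ?thesis by (simp add: dirs_def)
      qed
      have "u + (1,0) \<in> S" using nb[OF y(2)] y(1) r by (elim insertE emptyE) blast+
      then show False using nb[OF x(1)] x(2) r by (elim insertE emptyE) blast+
    qed
    then obtain i where "(u, i) \<in> P" using \<open>u \<in> S\<close> by (auto simp: P_def)
    then show "u \<in> fst ` P" by force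
  qed
  also have "card (fst ` P) \<le> card P" by (rule card_image_le) fact
  also have "card P = perim_set S" by (simp add: P_def perim_set_def)
  finally show ?thesis by simp
qed

lemma Omega_rep:
  assumes "C \<in> Omega n"
  shows "conf (rep C)" "card (rep C) = n" "cls (rep C) = C"
proof -
  obtain S where S: "C = cls S" "conf S" "card S = n" using assms unfolding Omega_conf by blast
  obtain v where "rep (cls S) = shift v S" using rep_cls by blast
  then show "conf (rep C)" "card (rep C) = n" "cls (rep C) = C" using S by simp_all
qed

text \<open>Percolation with p = 100/101: each configuration, translated to contain the origin, has
  probability at least p^n * q^(6b), and these probabilities add up to at most 1. The price is a
  factor 1/p = 1.01 per particle and 1/q = 101 per boundary site.\<close>

lemma card_small_perim:
  fixes b :: real
  assumes "finite (Omega n)" "n \<ge> 2"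
  shows "real (card {C \<in> Omega n. real (perim C) \<le> b}) \<le> (101/100) ^ n * 101 powr (6 * b)"
proof -
  let ?A = "{C \<in> Omega n. real (perim C) \<le> b}"
  \<comment> \<open>An arbitrary particle is moved to the origin; K is injective because the class
    of the translate is C again.\<close>
  define K where "K C = shift (- (SOME v. v \<in> rep C)) (rep C)" for C
  have inj: "inj_on K ?A"
  proof (rule inj_onI)
    fix C C' assume "C \<in> ?A" "C' \<in> ?A" "K C = K C'"
    then have "cls (K C) = cls (K C')" by simp
    moreover have "cls (K C) = C" "cls (K C') = C'"
      using Omega_rep(3)[of C n] Omega_rep(3)[of C' n] \<open>C \<in> ?A\<close> \<open>C' \<in> ?A\<close> by (simp_all add: K_def)
    ultimately show "C = C'" by simp
  qed
  have K: "finite (K C)" "lconnected (K C)" "0 \<in> K C" "card (K C) = n"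
    "real (card (site_bdry (K C))) \<le> 6 * b" if "C \<in> ?A" for C
  proof -
    have r: "conf (rep C)" "card (rep C) = n" using that Omega_rep by auto
    then have "rep C \<noteq> {}" using assms(2) by auto
    then have "(SOME v. v \<in> rep C) \<in> rep C" by (rule some_in_eq[THEN iffD2])
    then show "0 \<in> K C" by (simp add: K_def)
    show "finite (K C)" "lconnected (K C)" "card (K C) = n" using r by (simp_all add: K_def conf_def)
    have "card (site_bdry (K C)) \<le> 6 * perim C"
      unfolding K_def site_bdry_shift card_shift perim_def
      using r assms(2) by (intro card_site_bdry_le) (auto simp: conf_def)
    then have "real (card (site_bdry (K C))) \<le> 6 * real (perim C)" by linarith
    then show "real (card (site_bdry (K C))) \<le> 6 * b" using that by simp
  qed
  let ?q = "(100/101) ^ n * (1/101) powr (6 * b) :: real"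
  have "real (card ?A) * ?q = (\<Sum>C\<in>?A. ?q)" by simp
  also have "\<dots> \<le> (\<Sum>C\<in>?A. (100/101) ^ card (K C) * (1/101) ^ card (site_bdry (K C)))"
  proof (rule sum_mono)
    fix C assume C: "C \<in> ?A"
    have "(1/101::real) powr (6 * b) \<le> (1/101) powr real (card (site_bdry (K C)))"
      using K(5)[OF C] by (intro powr_mono') auto
    then show "?q \<le> (100/101) ^ card (K C) * (1/101) ^ card (site_bdry (K C))"
      unfolding K(4)[OF C] by (intro mult_left_mono) (simp_all add: powr_realpow)
  qed
  also have "\<dots> = (\<Sum>L\<in>K ` ?A. (100/101) ^ card L * (1/101) ^ card (site_bdry L))"
    using inj by (simp add: sum.reindex)
  also have "\<dots> \<le> 1"
    by (rule percolation_bound) (use assms(1) K in auto)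
  finally have "real (card ?A) * ?q \<le> 1" .
  moreover have "?q > 0" by simp
  ultimately have "real (card ?A) \<le> 1 / ?q" by (simp add: pos_le_divide_eq)
  also have "1 / ?q = (101/100) ^ n * 101 powr (6 * b)"
    by (simp add: power_divide powr_divide)
  finally show ?thesis .
qed

section \<open>Expansion\<close>

lemma weight_le:
  assumes "1 \<le> lam" "C \<in> Omega n"
  shows "weight lam C \<le> lam ^ (2 * n)"
proof -
  have "triangles (rep C) \<le> 2 * n"
    using triangles_le[of "rep C"] Omega_rep[OF assms(2)] by (simp add: conf_def)
  then show ?thesis unfolding weight_def using assms(1) by (rule power_increasing)
qed

text \<open>The value of \<beta> is chosen so that the at most 12 * \<beta> * n boundary sites, at a
  factor 101 each, contribute no more than the particles do, namely 1.01^n. The factor lam^(2n)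
  bounding a single weight cancels against the partition function.\<close>

lemma compressed_probability:
  fixes lam c \<beta> :: real
  assumes lam: "1 \<le> lam" and n: "n \<ge> 3" and st: "stationary lam n \<pi>"
    and c: "c > 0" "c * (1.03 * lam ^ 2) ^ n \<le> (\<Sum>C\<in>Omega n. weight lam C)"
    and b: "\<beta> = ln 1.01 / (12 * ln 101)"
  shows "(\<Sum>C\<in>{C \<in> Omega n. real (perim C) \<le> \<beta> * (2 * real n - 2)}. \<pi> C) \<le> (1.0201 / 1.03) ^ n / c"
proof -
  let ?A = "{C \<in> Omega n. real (perim C) \<le> \<beta> * (2 * real n - 2)}"
  define Z where "Z = (\<Sum>C\<in>Omega n. weight lam C)"
  have "(\<Sum>C\<in>Omega n. \<pi> C) = 1" using st by (simp add: stationary_def)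
  moreover obtain d where d: "\<And>C. C \<in> Omega n \<Longrightarrow> \<pi> C = d * weight lam C"
    using stationary_weight[OF _ st] lam n by fastforce
  ultimately have "d * Z = 1" by (simp add: Z_def sum_distrib_left)
  have fin: "finite (Omega n)"
    using \<open>(\<Sum>C\<in>Omega n. \<pi> C) = 1\<close> by (metis sum.infinite zero_neq_one)
  have cm: "c * (1.03 * lam ^ 2) ^ n > 0" using c(1) lam by simp
  then have "Z > 0" using c(2) unfolding Z_def by linarith
  have d': "d = 1 / Z" using \<open>d * Z = 1\<close> \<open>Z > 0\<close> by (simp add: field_simps)
  have "0 < \<beta>" unfolding b by simp
  have "real (card ?A) \<le> (101/100) ^ n * 101 powr (6 * (\<beta> * (2 * real n - 2)))"
    by (rule card_small_perim) (use fin n in auto)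
  also have "\<dots> \<le> (101/100) ^ n * 101 powr (12 * \<beta> * real n)"
    using \<open>0 < \<beta>\<close> by (intro mult_left_mono powr_mono) (auto simp: algebra_simps)
  also have "101 powr (12 * \<beta> * real n) = (101/100) ^ n"
  proof -
    have "101 powr (12 * \<beta> * real n) = exp (real n * ln 1.01)"
      by (simp add: powr_def b)
    also have "\<dots> = 1.01 ^ n" by (simp add: exp_of_nat_mult)
    finally show ?thesis by simp
  qed
  also have "(101/100) ^ n * (101/100) ^ n = (1.0201 :: real) ^ n"
    by (simp add: power_mult_distrib[symmetric])
  finally have A: "real (card ?A) \<le> 1.0201 ^ n" .
  have "(\<Sum>C\<in>?A. \<pi> C) = (\<Sum>C\<in>?A. weight lam C) / Z"
    using d by (simp add: d' sum_divide_distrib)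
  also have "\<dots> \<le> (\<Sum>C\<in>?A. lam ^ (2 * n)) / Z"
    using weight_le[OF lam] \<open>Z > 0\<close> by (intro divide_right_mono sum_mono) auto
  also have "\<dots> \<le> 1.0201 ^ n * lam ^ (2 * n) / Z"
    using A \<open>Z > 0\<close> lam by (intro divide_right_mono) (auto intro!: mult_right_mono)
  also have "\<dots> \<le> 1.0201 ^ n * lam ^ (2 * n) / (c * (1.03 * lam ^ 2) ^ n)"
    using c(2) cm lam unfolding Z_def by (intro divide_left_mono) auto
  also have "a ^ n * lam ^ (2 * n) / (c * (e * lam ^ 2) ^ n) = (a / e) ^ n / c" for a e
    using lam by (simp add: power_mult_distrib power_mult power_divide)
  finally show ?thesis .
qed

theorem theorem4:
  fixes lam :: real
  assumes "1 \<le> lam"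
      and "lam < (2 * 2430068453031180290203185942420933) powr (1 / 100)"
  shows "\<exists>\<beta>::real. 0 < \<beta> \<and> \<beta> < 1 \<and>
           (\<exists>(nstar::nat) (\<gamma>::real). 0 < \<gamma> \<and> \<gamma> < 1 \<and>
              (\<forall>n > nstar. \<forall>\<pi>. stationary lam n \<pi> \<longrightarrow>
                 (\<Sum>C\<in>{C \<in> Omega n. real (perim C) \<le> \<beta> * (2 * real n - 2)}. \<pi> C)
                   < \<gamma> powr sqrt (real n)))"
proof -
  have root: "(x ^ 100) powr (1 / 100) = x" if "x > 0" for x :: real
  proof -
    have "x ^ 100 = x powr 100" using that by simp
    then have "(x ^ 100) powr (1 / 100) = x powr (100 * (1 / 100))" by (simp only: powr_powr)
    then show ?thesis using that by simp
  qed
  \<comment> \<open>The fraction 50/23 is a convenient rational just above the bound on lam; its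
    reciprocal is the 23/50 of \<open>row_sums\<close>.\<close>
  have "(2 * 2430068453031180290203185942420933 :: real) \<le> (50/23) ^ 100"
    by (simp add: power_divide)
  then have "(2 * 2430068453031180290203185942420933 :: real) powr (1 / 100) \<le> ((50/23) ^ 100) powr (1 / 100)"
    by (intro powr_mono2) auto
  also have "\<dots> = 50/23"
    by (rule root) simp
  finally have "lam \<le> 50/23" using assms(2) by linarith
  then obtain c where c: "c > 0"
    "\<And>n. n \<ge> 3 \<Longrightarrow> finite (Omega n) \<Longrightarrow> c * (1.03 * lam ^ 2) ^ n \<le> (\<Sum>C\<in>Omega n. weight lam C)"
    using partition_function_growth[OF assms(1)] by blast
  define \<beta> where "\<beta> = ln 1.01 / (12 * ln 101 :: real)"
  have "ln 1.01 < ln (101 :: real)" by (intro ln_less_cancel_iff[THEN iffD2]) auto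
  moreover have "0 < ln (1.01 :: real)" by simp
  ultimately have "0 < ln (1.01 :: real)" "ln 1.01 < 12 * ln (101 :: real)" by linarith+
  then have \<beta>: "0 < \<beta>" "\<beta> < 1" unfolding \<beta>_def by simp_all
  \<comment> \<open>The square root of the decay rate: one factor \<gamma>^n absorbs the constant
    1/c for large n, the other one remains.\<close>
  define \<gamma> where "\<gamma> = sqrt (1.0201 / 1.03)"
  have \<gamma>: "0 < \<gamma>" "\<gamma> < 1" "\<gamma> * \<gamma> = 1.0201 / 1.03" unfolding \<gamma>_def by simp_all
  have "(\<lambda>n. \<gamma> ^ n) \<longlonglongrightarrow> 0" using \<gamma> by (intro LIMSEQ_power_zero) simp
  then have "eventually (\<lambda>n. \<gamma> ^ n < c) sequentially" using c(1) by (rule order_tendstoD)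
  then obtain n0 where n0: "\<And>n. n \<ge> n0 \<Longrightarrow> \<gamma> ^ n < c" by (auto simp: eventually_sequentially)
  have "(\<Sum>C\<in>{C \<in> Omega n. real (perim C) \<le> \<beta> * (2 * real n - 2)}. \<pi> C) < \<gamma> powr sqrt (real n)"
    if n: "n > max n0 3" and st: "stationary lam n \<pi>" for n \<pi>
  proof -
    have "finite (Omega n)"
      using st unfolding stationary_def by (metis sum.infinite zero_neq_one)
    then have "(\<Sum>C\<in>{C \<in> Omega n. real (perim C) \<le> \<beta> * (2 * real n - 2)}. \<pi> C) \<le> (1.0201 / 1.03) ^ n / c"
      using compressed_probability[OF assms(1) _ st c(1) c(2) \<beta>_def] n by simp
    also have "\<dots> = \<gamma> ^ n * (\<gamma> ^ n / c)" unfolding \<gamma>(3)[symmetric] by (simp add: power_mult_distrib)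
    also have "\<dots> < \<gamma> ^ n * 1"
      using n0[of n] n \<gamma> c(1) by (intro mult_strict_left_mono) auto
    also have "\<dots> = \<gamma> powr real n" using \<gamma> by (simp add: powr_realpow)
    also have "\<dots> \<le> \<gamma> powr sqrt (real n)"
    proof (rule powr_mono')
      have "1 \<le> sqrt (real n)" using n by simp
      then have "sqrt (real n) * 1 \<le> sqrt (real n) * sqrt (real n)" by (intro mult_left_mono) auto
      then show "sqrt (real n) \<le> real n" by simp
    qed (use \<gamma> in auto)
    finally show ?thesis .
  qed
  then show ?thesis using \<beta> \<gamma>(1,2) by blast
qed

end
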